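(* Let $\Gamma:J^1\pi\to J^2\pi$ be a second order connection, let $(\varphi,v)$ be a pair consisting of a non-vanishing closed $1$-form $\varphi$ and a vector field $v$ on $X$ with $i_v\varphi=1$, and let $Z:V\to J^1\pi$ ($V\subset Y$ open) be a local connection embedded in $\Gamma$, with connection form $\mathcal{Z}=dx^i\otimes Z_i$. Then the total shape operator $\hat A_Z=Z^{\wedge}\mathcal{Q}=A^\sigma_{\nu i}\,dx^i\wedge\bar\omega^\nu\otimes\frac{\partial}{\partial y^\sigma}$ satisfies $$[\![\mathcal{Z},\hat A_Z]\!]=-A^2-Z^{\wedge}\Phi,$$ where $A^2$ denotes the vector-valued $3$-form $$A^2=\tfrac14\{\!\{\hat A_Z,\hat A_Z\}\!\}=\tfrac12\bigl(A^\sigma_{\rho k}A^\nu_{\sigma i}-A^\sigma_{\rho i}A^\nu_{\sigma k}\bigr)\,dx^i\wedge dx^k\wedge\bar\omega^\rho\otimes\frac{\partial}{\partial y^\nu},$$ $\{\!\{\cdot,\cdot\}\!\}$ being the algebraic Nijenhuis–Richardson bracket of vector-valued forms.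
   Context: All objects are smooth; summation convention (over all values of repeated indices) is used. $\pi:Y\to X$ is a fibred manifold with $\dim X=n>1$, $\dim Y=n+m$; $\pi_{1,0}:J^1\pi\to Y$, $J^2\pi$ are the jet bundles, with fibred coordinates $(x^i,y^\sigma)$, $(x^i,y^\sigma,y^\sigma_j)$, $(x^i,y^\sigma,y^\sigma_j,y^\sigma_{jk})$. $V\pi$, $V\pi_{1,0}$ are the vertical bundles of $\pi$, $\pi_{1,0}$. $\omega^\sigma=dy^\sigma-y^\sigma_jdx^j$. Second order connection: a section $\Gamma:J^1\pi\to J^2\pi$ of $J^2\pi\to J^1\pi$, with components $F^\sigma_{ij}=y^\sigma_{ij}\circ\Gamma=F^\sigma_{ji}$. Put $\Gamma_i=\frac{\partial}{\partial x^i}+y^\sigma_i\frac{\partial}{\partial y^\sigma}+F^\sigma_{ij}\frac{\partial}{\partial y^\sigma_j}$, $D_\Gamma=\mathrm{span}\{\Gamma_i\}$, $\mathcal{G}=dx^i\otimes\Gamma_i$. Data on $X$: $\varphi=\varphi_idx^i$ closed non-vanishing, $v=v^i\partial/\partial x^i$, $i_v\varphi=1$. $S^\varphi=\varphi_i\,\omega^\sigma\otimes\frac{\partial}{\partial y^\sigma_i}$, $\Gamma_v=v^i\Gamma_i$. The endomorphism $\mathcal{L}_{\Gamma_v}S^\varphi$ of $TJ^1\pi$ has three eigenvalues, one zero, one positive and one negative; $H=\mathrm{span}\{H_\sigma=\frac{\partial}{\partial y^\sigma}+H^\nu_{\sigma k}\frac{\partial}{\partial y^\nu_k}\}$ is its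 eigendistribution for the negative eigenvalue (this defines $H^\nu_{\sigma k}$). In coordinates adapted so that $\varphi=dx^1$, $v^1=1$ (indices $p,q$ from $2$ to $n$): $H^\nu_{\sigma1}=\frac12\bigl(\frac{\partial F^\nu_{11}}{\partial y^\sigma_1}-v^pv^q\frac{\partial F^\nu_{pq}}{\partial y^\sigma_1}\bigr)$, $H^\nu_{\sigma p}=v^k\frac{\partial F^\nu_{pk}}{\partial y^\sigma_1}$. There is a splitting $TJ^1\pi=D_\Gamma\oplus H\oplus V\pi_{1,0}$ with projectors $\mathcal{G}$, $\mathcal{P}=\omega^\sigma\otimes H_\sigma$, $\mathcal{Q}=\psi^\sigma_i\otimes\frac{\partial}{\partial y^\sigma_i}$, where $\psi^\nu_k=dy^\nu_k-F^\nu_{ki}dx^i-H^\nu_{\sigma k}\omega^\sigma$. $[\![\cdot,\cdot]\!]$ is the Frölicher–Nijenhuis bracket: $[\![\omega\otimes\xi,\eta\otimes\zeta]\!]=\omega\wedge\eta\otimes[\xi,\zeta]+\omega\wedge\mathcal{L}_\xi\eta\otimes\zeta-\mathcal{L}_\zeta\omega\wedge\eta\otimes\xi+(-1)^{\deg\omega}(d\omega\wedge i_\xi\eta\otimes\zeta+i_\zeta\omega\wedge d\eta\otimes\xi)$. $\{\!\{\cdot,\cdot\}\!\}$ is the algebraic Nijenhuis–Richardson bracket of vector-valued forms; no convention for its sign and normalisation is specified beyond this. Jacobi endomorphism: $\Phi=\mathcal{Q}\circ[\![\mathcal{G},\mathcal{P}]\!]=\Phi^\nu_{i\sigma k}\,dx^i\wedge\omega^\sigma\otimes\frac{\partial}{\partial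 y^\nu_k}$, with $\Phi^\nu_{i\sigma k}=\Gamma_i(H^\nu_{\sigma k})-H_\sigma(F^\nu_{ik})+H^\rho_{\sigma i}H^\nu_{\rho k}$. Embedded connection: a local connection is a local section $Z:V\to J^1\pi$ of $\pi_{1,0}$, with components $Z^\sigma_i=y^\sigma_i\circ Z$, $Z_i=\frac{\partial}{\partial x^i}+Z^\sigma_i\frac{\partial}{\partial y^\sigma}$, $D_Z=\mathrm{span}\{Z_i\}$, $\bar\omega^\sigma=Z^*\omega^\sigma=dy^\sigma-Z^\sigma_jdx^j$. It is embedded in $\Gamma$ if $T_yZ(D_Z(y))\subset D_\Gamma(Z(y))$ for all $y\in V$. The map $Z^{\wedge}$: let $\hat s$ be the isomorphism $\frac{\partial}{\partial y^\sigma_i}\mapsto dx^i\otimes\frac{\partial}{\partial y^\sigma}$. For a $V\pi_{1,0}$-valued $q$-form $\mathcal{K}$ on $J^1\pi$, $Z^{\wedge}\mathcal{K}$ is the $V\pi$-valued $(q+1)$-form on $V$ $$(Z^{\wedge}\mathcal{K})(y)(\xi_1,\dots,\xi_{q+1})=\sum_{r=1}^{q+1}(-1)^{q+r}\,i_{\xi_r}\Bigl(\hat s_{Z(y)}\bigl(\mathcal{K}(Z(y))(TZ(\xi_1),\dots,\widehat{TZ(\xi_r)},\dots,TZ(\xi_{q+1}))\bigr)\Bigr)$$ (the hat denotes omission); i.e. if $\mathcal{K}=\eta^\sigma_i\otimes\frac{\partial}{\partial y^\sigma_i}$ then $Z^{\wedge}\mathcal{K}=(-1)^{q+1}dx^i\wedge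 Z^*\eta^\sigma_i\otimes\frac{\partial}{\partial y^\sigma}$. The total shape operator is $\hat A_Z=Z^{\wedge}\mathcal{Q}$, with components $A^\sigma_{\nu i}=\frac{\partial Z^\sigma_i}{\partial y^\nu}-H^\sigma_{\nu i}\circ Z$. *)

theory Defs
  imports "HOL-Analysis.Analysis" "HOL-Combinatorics.Permutations"
begin

section \<open>Smooth manifolds and fibred manifolds\<close>

primrec times_differentiable_on ::
    "nat \<Rightarrow> 'a::euclidean_space set \<Rightarrow> ('a \<Rightarrow> 'b::real_normed_vector) \<Rightarrow> bool" where
  "times_differentiable_on 0 S f \<longleftrightarrow> continuous_on S f"
| "times_differentiable_on (Suc k) S f \<longleftrightarrow>
     (\<forall>x\<in>S. f differentiable (at x)) \<and>
     (\<forall>w. times_differentiable_on k S (\<lambda>x. frechet_derivative f (at x) w))"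

text \<open>Only used for open \<open>S\<close>, where this is the class of infinitely differentiable functions.\<close>

definition smooth_on :: "'a::euclidean_space set \<Rightarrow> ('a \<Rightarrow> 'b::real_normed_vector) \<Rightarrow> bool" where
  "smooth_on S f \<longleftrightarrow> (\<forall>k. times_differentiable_on k S f)"

text \<open>A chart is a pair of its domain and its coordinate map; the values of the coordinate map
  outside of the domain are irrelevant. A manifold is a whole type, with a maximal atlas.\<close>

type_synonym ('p, 'e) chart = "'p set \<times> ('p \<Rightarrow> 'e)"

definition chart_inv :: "('p, 'e) chart \<Rightarrow> 'e \<Rightarrow> 'p" where
  "chart_inv c = inv_into (fst c) (snd c)"

definition is_chart :: "('p::topological_space, 'e::euclidean_space) chart \<Rightarrow> bool" where
  "is_chart c \<longleftrightarrow> open (fst c) \<and> open (snd c ` fst c) \<and>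
     homeomorphism (fst c) (snd c ` fst c) (snd c) (chart_inv c)"

definition compatible :: "('p, 'e::euclidean_space) chart \<Rightarrow> ('p, 'e) chart \<Rightarrow> bool" where
  "compatible c d \<longleftrightarrow> smooth_on (snd c ` (fst c \<inter> fst d)) (snd d \<circ> chart_inv c)"

definition smooth_structure ::
    "('p::topological_space, 'e::euclidean_space) chart set \<Rightarrow> bool" where
  "smooth_structure A \<longleftrightarrow> (\<forall>c\<in>A. is_chart c) \<and> (\<Union>c\<in>A. fst c) = UNIV \<and>
     (\<forall>c. is_chart c \<longrightarrow> (c \<in> A \<longleftrightarrow> (\<forall>d\<in>A. compatible c d \<and> compatible d c)))"

definition smooth_map_on ::
    "('p::topological_space, 'e::euclidean_space) chart set \<Rightarrow>
     ('q::topological_space, 'f::euclidean_space) chart set \<Rightarrow> 'p set \<Rightarrow> ('p \<Rightarrow> 'q) \<Rightarrow> bool" where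
  "smooth_map_on A B W f \<longleftrightarrow> open W \<and> continuous_on W f \<and>
     (\<forall>c\<in>A. \<forall>d\<in>B. smooth_on (snd c ` (W \<inter> fst c \<inter> f -` fst d)) (snd d \<circ> f \<circ> chart_inv c))"

record ('x, 'y, 'n, 'm) fibring =
  proj :: "'y \<Rightarrow> 'x"
  base_atlas :: "('x, real^'n) chart set"
  total_atlas :: "('y, (real^'n) \<times> (real^'m)) chart set"

definition fibred_manifold ::
    "('x::topological_space, 'y::topological_space, 'n::finite, 'm::finite) fibring \<Rightarrow> bool" where
  "fibred_manifold M \<longleftrightarrow>
     smooth_structure (base_atlas M) \<and> smooth_structure (total_atlas M) \<and>
     surj (proj M) \<and> smooth_map_on (total_atlas M) (base_atlas M) UNIV (proj M) \<and>
     (\<forall>y. \<forall>c\<in>total_atlas M. \<forall>b\<in>base_atlas M. y \<in> fst c \<and> proj M y \<in> fst b \<longrightarrow>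
        surj (frechet_derivative (snd b \<circ> proj M \<circ> chart_inv c) (at (snd c y))))"

text \<open>A fibred chart \<open>c\<close> of the total space with coordinates \<open>(x\<^sup>i, y\<^sup>\<sigma>)\<close>, over the chart \<open>b\<close>
  of the base with coordinates \<open>x\<^sup>i\<close>.\<close>

definition fibred_chart ::
    "('x, 'y, 'n::finite, 'm::finite) fibring \<Rightarrow> ('y, (real^'n) \<times> (real^'m)) chart \<Rightarrow>
     ('x, real^'n) chart \<Rightarrow> bool" where
  "fibred_chart M c b \<longleftrightarrow> c \<in> total_atlas M \<and> b \<in> base_atlas M \<and> fst b = proj M ` fst c \<and>
     (\<forall>y\<in>fst c. snd b (proj M y) = fst (snd c y))"


section \<open>Jets\<close>

primrec pderivs :: "'n list \<Rightarrow> (real^'n \<Rightarrow> 'b::real_normed_vector) \<Rightarrow> real^'n \<Rightarrow> 'b" where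
  "pderivs [] f = f"
| "pderivs (i # is) f = (\<lambda>a. frechet_derivative (pderivs is f) (at a) (axis i 1))"

definition section_at ::
    "('x::topological_space, 'y::topological_space, 'n::finite, 'm::finite) fibring \<Rightarrow> 'x \<Rightarrow>
     ('x \<Rightarrow> 'y) \<Rightarrow> bool" where
  "section_at M x s \<longleftrightarrow>
     (\<exists>W. x \<in> W \<and> smooth_map_on (base_atlas M) (total_atlas M) W s \<and> (\<forall>w\<in>W. proj M (s w) = w))"

definition fibre_rep ::
    "('y, (real^'n) \<times> (real^'m)) chart \<Rightarrow> ('x, real^'n) chart \<Rightarrow> ('x \<Rightarrow> 'y) \<Rightarrow>
     real^'n::finite \<Rightarrow> real^'m::finite" where
  "fibre_rep c b s = (\<lambda>a. snd (snd c (s (chart_inv b a))))"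

definition jet_equiv ::
    "('x::topological_space, 'y::topological_space, 'n::finite, 'm::finite) fibring \<Rightarrow> nat \<Rightarrow> 'x \<Rightarrow>
     ('x \<Rightarrow> 'y) \<Rightarrow> ('x \<Rightarrow> 'y) \<Rightarrow> bool" where
  "jet_equiv M k x s t \<longleftrightarrow> section_at M x s \<and> section_at M x t \<and> s x = t x \<and>
     (\<forall>c b. fibred_chart M c b \<and> s x \<in> fst c \<longrightarrow>
        (\<forall>is. length is \<le> k \<longrightarrow>
           pderivs is (fibre_rep c b s) (snd b x) = pderivs is (fibre_rep c b t) (snd b x)))"

type_synonym ('x, 'y) jet = "'x \<times> ('x \<Rightarrow> 'y) set"

definition jet ::
    "('x::topological_space, 'y::topological_space, 'n::finite, 'm::finite) fibring \<Rightarrow> nat \<Rightarrow> 'x \<Rightarrow>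
     ('x \<Rightarrow> 'y) \<Rightarrow> ('x, 'y) jet" where
  "jet M k x s = (x, {t. jet_equiv M k x s t})"

definition jets ::
    "('x::topological_space, 'y::topological_space, 'n::finite, 'm::finite) fibring \<Rightarrow> nat \<Rightarrow>
     ('x, 'y) jet set" where
  "jets M k = {jet M k x s | x s. section_at M x s}"

definition jet_rep :: "('x, 'y) jet \<Rightarrow> 'x \<Rightarrow> 'y" where
  "jet_rep j = (SOME s. s \<in> snd j)"

text \<open>The projection of \<open>k\<close>-jets to the total space and, for \<open>l \<le> k\<close>, to \<open>l\<close>-jets.\<close>

definition jet_target :: "('x, 'y) jet \<Rightarrow> 'y" where
  "jet_target j = jet_rep j (fst j)"

definition jet_forget ::
    "('x::topological_space, 'y::topological_space, 'n::finite, 'm::finite) fibring \<Rightarrow> nat \<Rightarrow>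
     ('x, 'y) jet \<Rightarrow> ('x, 'y) jet" where
  "jet_forget M l j = jet M l (fst j) (jet_rep j)"

text \<open>Induced coordinates: \<open>y\<^sup>\<sigma>\<^sub>i\<close> is component \<open>\<sigma>, i\<close> of \<open>jet_y1\<close>, and \<open>y\<^sup>\<sigma>\<^sub>i\<^sub>k\<close> is component
  \<open>\<sigma>, i, k\<close> of \<open>jet_y2\<close>.\<close>

definition jet_y1 ::
    "('y, (real^'n) \<times> (real^'m)) chart \<Rightarrow> ('x, real^'n) chart \<Rightarrow> ('x, 'y) jet \<Rightarrow>
     real^'n::finite^'m::finite" where
  "jet_y1 c b j = (\<chi> \<sigma> i. pderivs [i] (fibre_rep c b (jet_rep j)) (snd b (fst j)) $ \<sigma>)"

definition jet_y2 ::
    "('y, (real^'n) \<times> (real^'m)) chart \<Rightarrow> ('x, real^'n) chart \<Rightarrow> ('x, 'y) jet \<Rightarrow>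
     real^'n::finite^'n^'m::finite" where
  "jet_y2 c b j = (\<chi> \<sigma> i k. pderivs [i, k] (fibre_rep c b (jet_rep j)) (snd b (fst j)) $ \<sigma>)"

type_synonym ('n, 'm) ycoord = "(real^'n) \<times> (real^'m)"
type_synonym ('n, 'm) jcoord = "((real^'n) \<times> (real^'m)) \<times> (real^'n^'m)"

definition jet1_coord ::
    "('y, (real^'n) \<times> (real^'m)) chart \<Rightarrow> ('x, real^'n) chart \<Rightarrow> ('x, 'y) jet \<Rightarrow>
     ('n::finite, 'm::finite) jcoord" where
  "jet1_coord c b j = (snd c (jet_target j), jet_y1 c b j)"

definition jet1_inv ::
    "('x::topological_space, 'y::topological_space, 'n::finite, 'm::finite) fibring \<Rightarrow>
     ('y, (real^'n) \<times> (real^'m)) chart \<Rightarrow> ('x, real^'n) chart \<Rightarrow> ('n, 'm) jcoord \<Rightarrow> ('x, 'y) jet"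
  where
  "jet1_inv M c b = inv_into {j \<in> jets M 1. jet_target j \<in> fst c} (jet1_coord c b)"


section \<open>Connections and data on the base\<close>

text \<open>The components \<open>F\<^sup>\<sigma>\<^sub>i\<^sub>j\<close> of a second order connection, as functions of the coordinates on
  the first jet bundle.\<close>

definition conn_coeff ::
    "('x::topological_space, 'y::topological_space, 'n::finite, 'm::finite) fibring \<Rightarrow>
     (('x, 'y) jet \<Rightarrow> ('x, 'y) jet) \<Rightarrow>
     ('y, (real^'n) \<times> (real^'m)) chart \<Rightarrow> ('x, real^'n) chart \<Rightarrow> ('n, 'm) jcoord \<Rightarrow> real^'n^'n^'m"
  where
  "conn_coeff M \<Gamma> c b p = jet_y2 c b (\<Gamma> (jet1_inv M c b p))"

definition second_order_connection ::
    "('x::topological_space, 'y::topological_space, 'n::finite, 'm::finite) fibring \<Rightarrow>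
     (('x, 'y) jet \<Rightarrow> ('x, 'y) jet) \<Rightarrow> bool" where
  "second_order_connection M \<Gamma> \<longleftrightarrow>
     (\<forall>j\<in>jets M 1. \<Gamma> j \<in> jets M 2 \<and> jet_forget M 1 (\<Gamma> j) = j) \<and>
     (\<forall>c b. fibred_chart M c b \<longrightarrow> smooth_on ((snd c ` fst c) \<times> UNIV) (conn_coeff M \<Gamma> c b))"

text \<open>The components \<open>Z\<^sup>\<sigma>\<^sub>i\<close> of a local connection, as functions of the coordinates on the total
  space.\<close>

definition section_coeff ::
    "(('y \<Rightarrow> ('x, 'y) jet)) \<Rightarrow>
     ('y, (real^'n) \<times> (real^'m)) chart \<Rightarrow> ('x, real^'n) chart \<Rightarrow> ('n::finite, 'm::finite) ycoord \<Rightarrow>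
     real^'n^'m"
  where
  "section_coeff Z c b a = jet_y1 c b (Z (chart_inv c a))"

definition local_connection ::
    "('x::topological_space, 'y::topological_space, 'n::finite, 'm::finite) fibring \<Rightarrow> 'y set \<Rightarrow>
     ('y \<Rightarrow> ('x, 'y) jet) \<Rightarrow> bool" where
  "local_connection M V Z \<longleftrightarrow> open V \<and> (\<forall>y\<in>V. Z y \<in> jets M 1 \<and> jet_target (Z y) = y) \<and>
     (\<forall>c b. fibred_chart M c b \<longrightarrow> smooth_on (snd c ` (V \<inter> fst c)) (section_coeff Z c b))"

text \<open>Tensor fields are families of coordinate representations, indexed by the charts, that
  transform in the proper way; the values are the component vectors \<open>\<phi>\<^sub>i\<close> and \<open>v\<^sup>i\<close>.\<close>

definition one_form ::
    "('x::topological_space, real^'n::finite) chart set \<Rightarrow>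
     (('x, real^'n) chart \<Rightarrow> real^'n \<Rightarrow> real^'n) \<Rightarrow> bool" where
  "one_form A \<phi> \<longleftrightarrow> (\<forall>b\<in>A. smooth_on (snd b ` fst b) (\<phi> b)) \<and>
     (\<forall>b\<in>A. \<forall>d\<in>A. \<forall>x\<in>fst b \<inter> fst d. \<forall>w.
        \<phi> b (snd b x) \<bullet> w =
        \<phi> d (snd d x) \<bullet> frechet_derivative (snd d \<circ> chart_inv b) (at (snd b x)) w)"

definition vector_field ::
    "('x::topological_space, real^'n::finite) chart set \<Rightarrow>
     (('x, real^'n) chart \<Rightarrow> real^'n \<Rightarrow> real^'n) \<Rightarrow> bool" where
  "vector_field A v \<longleftrightarrow> (\<forall>b\<in>A. smooth_on (snd b ` fst b) (v b)) \<and>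
     (\<forall>b\<in>A. \<forall>d\<in>A. \<forall>x\<in>fst b \<inter> fst d.
        v d (snd d x) = frechet_derivative (snd d \<circ> chart_inv b) (at (snd b x)) (v b (snd b x)))"


section \<open>Calculus of vector-valued forms on open sets of a Euclidean space\<close>

text \<open>A \<open>k\<close>-form takes a point and \<open>k\<close> vectors, given as the values of a sequence at the indices
  below \<open>k\<close>; the rest of the sequence is ignored. The wedge product is normalised so that
  \<open>(\<alpha> \<and> \<beta>)(\<xi>, \<zeta>) = \<alpha>(\<xi>) \<beta>(\<zeta>) - \<alpha>(\<zeta>) \<beta>(\<xi>)\<close> for one-forms.\<close>

type_synonym ('e, 'b) form = "'e \<Rightarrow> (nat \<Rightarrow> 'e) \<Rightarrow> 'b"

definition wedge :: "nat \<Rightarrow> nat \<Rightarrow> ('e, real) form \<Rightarrow> ('e, real) form \<Rightarrow> ('e, real) form" where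
  "wedge k l \<alpha> \<beta> = (\<lambda>p X.
     (\<Sum>\<tau> | \<tau> permutes {..<k+l}.
        of_int (sign \<tau>) * \<alpha> p (\<lambda>i. X (\<tau> i)) * \<beta> p (\<lambda>i. X (\<tau> (k+i)))) / (fact k * fact l))"

definition omit :: "nat \<Rightarrow> (nat \<Rightarrow> 'e) \<Rightarrow> nat \<Rightarrow> 'e" where
  "omit r X = (\<lambda>i. if i < r then X i else X (Suc i))"

definition ext_deriv :: "nat \<Rightarrow> ('e::euclidean_space, real) form \<Rightarrow> ('e, real) form" where
  "ext_deriv k \<alpha> = (\<lambda>p X.
     \<Sum>r\<le>k. (-1)^r * frechet_derivative (\<lambda>q. \<alpha> q (omit r X)) (at p) (X r))"

definition hook ::
    "nat \<Rightarrow> ('e::euclidean_space \<Rightarrow> 'e) \<Rightarrow> ('e, real) form \<Rightarrow> ('e, real) form" where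
  "hook k \<xi> \<alpha> = (\<lambda>p X. if k = 0 then 0 else \<alpha> p (case_nat (\<xi> p) X))"

definition lie_deriv ::
    "nat \<Rightarrow> ('e::euclidean_space \<Rightarrow> 'e) \<Rightarrow> ('e, real) form \<Rightarrow> ('e, real) form" where
  "lie_deriv k \<xi> \<alpha> = (\<lambda>p X.
     frechet_derivative (\<lambda>q. \<alpha> q X) (at p) (\<xi> p) +
     (\<Sum>j<k. \<alpha> p (X(j := frechet_derivative \<xi> (at p) (X j)))))"

definition lie_bracket ::
    "('e::euclidean_space \<Rightarrow> 'e) \<Rightarrow> ('e \<Rightarrow> 'e) \<Rightarrow> 'e \<Rightarrow> 'e" where
  "lie_bracket \<xi> \<zeta> = (\<lambda>p. frechet_derivative \<zeta> (at p) (\<xi> p) - frechet_derivative \<xi> (at p) (\<zeta> p))"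

text \<open>The Froelicher-Nijenhuis bracket of the decomposable forms \<open>\<omega> \<otimes> \<xi>\<close> and \<open>\<eta> \<otimes> \<zeta>\<close> of degrees
  \<open>k\<close> and \<open>l\<close>.\<close>

definition fn_decomposable ::
    "nat \<Rightarrow> nat \<Rightarrow> ('e::euclidean_space, real) form \<Rightarrow> ('e \<Rightarrow> 'e) \<Rightarrow>
     ('e, real) form \<Rightarrow> ('e \<Rightarrow> 'e) \<Rightarrow> ('e, 'e) form" where
  "fn_decomposable k l \<omega> \<xi> \<eta> \<zeta> = (\<lambda>p X.
     wedge k l \<omega> \<eta> p X *\<^sub>R lie_bracket \<xi> \<zeta> p
     + wedge k l \<omega> (lie_deriv l \<xi> \<eta>) p X *\<^sub>R \<zeta> p
     - wedge k l (lie_deriv k \<zeta> \<omega>) \<eta> p X *\<^sub>R \<xi> p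
     + (-1)^k *\<^sub>R
       (wedge (k+1) (l-1) (ext_deriv k \<omega>) (hook l \<xi> \<eta>) p X *\<^sub>R \<zeta> p
        + wedge (k-1) (l+1) (hook k \<zeta> \<omega>) (ext_deriv l \<eta>) p X *\<^sub>R \<xi> p))"

text \<open>Its biadditive extension, by means of the decompositions of \<open>K\<close> and \<open>L\<close> along the constant
  vector fields of the standard basis.\<close>

definition fn_bracket ::
    "nat \<Rightarrow> nat \<Rightarrow> ('e::euclidean_space, 'e) form \<Rightarrow> ('e, 'e) form \<Rightarrow> ('e, 'e) form" where
  "fn_bracket k l K L = (\<lambda>p X.
     \<Sum>a\<in>Basis. \<Sum>b\<in>Basis.
       fn_decomposable k l (\<lambda>q Y. K q Y \<bullet> a) (\<lambda>_. a) (\<lambda>q Y. L q Y \<bullet> b) (\<lambda>_. b) p X)"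

text \<open>The insertion \<open>i\<^sub>K L\<close>, that is \<open>\<omega> \<and> i\<^sub>\<xi> \<eta> \<otimes> \<zeta>\<close> for \<open>K = \<omega> \<otimes> \<xi>\<close> and \<open>L = \<eta> \<otimes> \<zeta>\<close>.\<close>

definition insertion ::
    "nat \<Rightarrow> nat \<Rightarrow> ('e::euclidean_space, 'e) form \<Rightarrow> ('e, 'e) form \<Rightarrow> ('e, 'e) form" where
  "insertion k l K L = (\<lambda>p X. if l = 0 then 0 else
     (\<Sum>\<tau> | \<tau> permutes {..<k+l-1}.
        of_int (sign \<tau>) *\<^sub>R L p (case_nat (K p (\<lambda>i. X (\<tau> i))) (\<lambda>i. X (\<tau> (k+i)))))
     /\<^sub>R (fact k * fact (l-1)))"

text \<open>The algebraic bracket \<open>i\<^sub>K L - (-1)\<^bsup>(k-1)(l-1)\<^esup> i\<^sub>L K\<close>, up to a constant factor. A nonzero constant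
  factor gives an isomorphic graded Lie algebra; \<open>-2\<close> is the one for which one quarter of
  the bracket of \<open>A\<^sup>\<sigma>\<^sub>\<nu>\<^sub>i dx\<^sup>i \<and> \<omega>\<^sup>\<nu> \<otimes> \<partial>\<^sub>\<sigma>\<close> with itself is
  \<open>1/2 (A\<^sup>\<sigma>\<^sub>\<rho>\<^sub>k A\<^sup>\<nu>\<^sub>\<sigma>\<^sub>i - A\<^sup>\<sigma>\<^sub>\<rho>\<^sub>i A\<^sup>\<nu>\<^sub>\<sigma>\<^sub>k) dx\<^sup>i \<and> dx\<^sup>k \<and> \<omega>\<^sup>\<rho> \<otimes> \<partial>\<^sub>\<nu>\<close>.
  (The parity of \<open>(k+1)(l+1)\<close> is that of \<open>(k-1)(l-1)\<close>.)\<close>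

definition nr_bracket ::
    "nat \<Rightarrow> nat \<Rightarrow> ('e::euclidean_space, 'e) form \<Rightarrow> ('e, 'e) form \<Rightarrow> ('e, 'e) form" where
  "nr_bracket k l K L = (\<lambda>p X.
     (-2) *\<^sub>R (insertion k l K L p X - (-1)^((k+1)*(l+1)) *\<^sub>R insertion l k L K p X))"

definition closed_one_form ::
    "('x, real^'n::finite) chart set \<Rightarrow> (('x, real^'n) chart \<Rightarrow> real^'n \<Rightarrow> real^'n) \<Rightarrow> bool" where
  "closed_one_form A \<phi> \<longleftrightarrow>
     (\<forall>b\<in>A. \<forall>a\<in>snd b ` fst b. \<forall>X. ext_deriv 1 (\<lambda>q Y. \<phi> b q \<bullet> Y 0) a X = 0)"


section \<open>Geometry of a second order connection in fibred coordinates\<close>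

text \<open>In this section \<open>F\<close>, \<open>\<phi>\<close>, \<open>v\<close> and \<open>z\<close> are the coordinate representations of the second order
  connection, of the data on the base, and of the local connection. A point of the jet bundle is
  \<open>p = ((x, y), y')\<close> with \<open>y' $ \<sigma> $ i = y\<^sup>\<sigma>\<^sub>i\<close>, and its tangent vectors are written alike.\<close>

definition Gam :: "(('n::finite, 'm::finite) jcoord \<Rightarrow> real^'n^'n^'m) \<Rightarrow> 'n \<Rightarrow>
    ('n, 'm) jcoord \<Rightarrow> ('n, 'm) jcoord" where
  "Gam F i p = ((axis i 1, \<chi> \<sigma>. snd p $ \<sigma> $ i), \<chi> \<sigma> j. F p $ \<sigma> $ i $ j)"

definition dist_Gam :: "(('n::finite, 'm::finite) jcoord \<Rightarrow> real^'n^'n^'m) \<Rightarrow>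
    ('n, 'm) jcoord \<Rightarrow> ('n, 'm) jcoord set" where
  "dist_Gam F p = span (range (\<lambda>i. Gam F i p))"

definition omega :: "'m::finite \<Rightarrow> ('n::finite, 'm) jcoord \<Rightarrow> ('n, 'm) jcoord \<Rightarrow> real" where
  "omega \<sigma> p \<xi> = snd (fst \<xi>) $ \<sigma> - (\<Sum>j\<in>UNIV. snd p $ \<sigma> $ j * fst (fst \<xi>) $ j)"

definition S_endo :: "(real^'n \<Rightarrow> real^'n) \<Rightarrow>
    ('n::finite, 'm::finite) jcoord \<Rightarrow> ('n, 'm) jcoord \<Rightarrow> ('n, 'm) jcoord" where
  "S_endo \<phi> p \<xi> = ((0, 0), \<chi> \<sigma> i. \<phi> (fst (fst p)) $ i * omega \<sigma> p \<xi>)"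

definition Gam_v :: "(('n::finite, 'm::finite) jcoord \<Rightarrow> real^'n^'n^'m) \<Rightarrow> (real^'n \<Rightarrow> real^'n) \<Rightarrow>
    ('n, 'm) jcoord \<Rightarrow> ('n, 'm) jcoord" where
  "Gam_v F v p = (\<Sum>i\<in>UNIV. (v (fst (fst p)) $ i) *\<^sub>R Gam F i p)"

text \<open>\<open>(L\<^sub>\<xi> T) w = [\<xi>, T w] - T [\<xi>, w]\<close>, with \<open>w\<close> extended to a constant vector field.\<close>

definition lie_endo :: "('e::euclidean_space \<Rightarrow> 'e) \<Rightarrow> ('e \<Rightarrow> 'e \<Rightarrow> 'e) \<Rightarrow> 'e \<Rightarrow> 'e \<Rightarrow> 'e" where
  "lie_endo \<xi> T p w = lie_bracket \<xi> (\<lambda>q. T q w) p - T p (lie_bracket \<xi> (\<lambda>_. w) p)"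

text \<open>As there is exactly one negative eigenvalue, this is its eigenspace.\<close>

definition neg_eigenspace :: "(('n::finite, 'm::finite) jcoord \<Rightarrow> real^'n^'n^'m) \<Rightarrow>
    (real^'n \<Rightarrow> real^'n) \<Rightarrow> (real^'n \<Rightarrow> real^'n) \<Rightarrow> ('n, 'm) jcoord \<Rightarrow> ('n, 'm) jcoord set" where
  "neg_eigenspace F \<phi> v p =
     {\<xi>. \<exists>\<mu><0. lie_endo (Gam_v F v) (S_endo \<phi>) p \<xi> = \<mu> *\<^sub>R \<xi>}"

definition H_vec :: "real^'n^'m^'m \<Rightarrow> 'm::finite \<Rightarrow> ('n::finite, 'm) jcoord" where
  "H_vec h \<sigma> = ((0, axis \<sigma> 1), \<chi> \<nu> k. h $ \<nu> $ \<sigma> $ k)"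

text \<open>\<open>H\<^sup>\<nu>\<^sub>\<sigma>\<^sub>k\<close> is component \<open>\<nu>, \<sigma>, k\<close>.\<close>

definition H_coeff :: "(('n::finite, 'm::finite) jcoord \<Rightarrow> real^'n^'n^'m) \<Rightarrow>
    (real^'n \<Rightarrow> real^'n) \<Rightarrow> (real^'n \<Rightarrow> real^'n) \<Rightarrow> ('n, 'm) jcoord \<Rightarrow> real^'n^'m^'m" where
  "H_coeff F \<phi> v p = (THE h. span (range (H_vec h)) = neg_eigenspace F \<phi> v p)"

definition proj_G :: "(('n::finite, 'm::finite) jcoord \<Rightarrow> real^'n^'n^'m) \<Rightarrow>
    ('n, 'm) jcoord \<Rightarrow> ('n, 'm) jcoord \<Rightarrow> ('n, 'm) jcoord" where
  "proj_G F p \<xi> = (\<Sum>i\<in>UNIV. (fst (fst \<xi>) $ i) *\<^sub>R Gam F i p)"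

definition proj_P :: "(('n::finite, 'm::finite) jcoord \<Rightarrow> real^'n^'n^'m) \<Rightarrow>
    (real^'n \<Rightarrow> real^'n) \<Rightarrow> (real^'n \<Rightarrow> real^'n) \<Rightarrow>
    ('n, 'm) jcoord \<Rightarrow> ('n, 'm) jcoord \<Rightarrow> ('n, 'm) jcoord" where
  "proj_P F \<phi> v p \<xi> = (\<Sum>\<sigma>\<in>UNIV. omega \<sigma> p \<xi> *\<^sub>R H_vec (H_coeff F \<phi> v p) \<sigma>)"

definition psi :: "(('n::finite, 'm::finite) jcoord \<Rightarrow> real^'n^'n^'m) \<Rightarrow>
    (real^'n \<Rightarrow> real^'n) \<Rightarrow> (real^'n \<Rightarrow> real^'n) \<Rightarrow> 'm \<Rightarrow> 'n \<Rightarrow>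
    ('n, 'm) jcoord \<Rightarrow> ('n, 'm) jcoord \<Rightarrow> real" where
  "psi F \<phi> v \<nu> k p \<xi> = snd \<xi> $ \<nu> $ k
     - (\<Sum>i\<in>UNIV. F p $ \<nu> $ k $ i * fst (fst \<xi>) $ i)
     - (\<Sum>\<sigma>\<in>UNIV. H_coeff F \<phi> v p $ \<nu> $ \<sigma> $ k * omega \<sigma> p \<xi>)"

definition proj_Q :: "(('n::finite, 'm::finite) jcoord \<Rightarrow> real^'n^'n^'m) \<Rightarrow>
    (real^'n \<Rightarrow> real^'n) \<Rightarrow> (real^'n \<Rightarrow> real^'n) \<Rightarrow>
    ('n, 'm) jcoord \<Rightarrow> ('n, 'm) jcoord \<Rightarrow> ('n, 'm) jcoord" where
  "proj_Q F \<phi> v p \<xi> = ((0, 0), \<chi> \<nu> k. psi F \<phi> v \<nu> k p \<xi>)"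

definition endo_form :: "('e \<Rightarrow> 'e \<Rightarrow> 'b) \<Rightarrow> ('e, 'b) form" where
  "endo_form T = (\<lambda>p X. T p (X 0))"

definition jacobi_endo :: "(('n::finite, 'm::finite) jcoord \<Rightarrow> real^'n^'n^'m) \<Rightarrow>
    (real^'n \<Rightarrow> real^'n) \<Rightarrow> (real^'n \<Rightarrow> real^'n) \<Rightarrow> (('n, 'm) jcoord, ('n, 'm) jcoord) form" where
  "jacobi_endo F \<phi> v = (\<lambda>p X.
     proj_Q F \<phi> v p (fn_bracket 1 1 (endo_form (proj_G F)) (endo_form (proj_P F \<phi> v)) p X))"

definition Zvec :: "(('n::finite, 'm::finite) ycoord \<Rightarrow> real^'n^'m) \<Rightarrow> 'n \<Rightarrow>
    ('n, 'm) ycoord \<Rightarrow> ('n, 'm) ycoord" where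
  "Zvec z i a = (axis i 1, \<chi> \<sigma>. z a $ \<sigma> $ i)"

definition dist_Z :: "(('n::finite, 'm::finite) ycoord \<Rightarrow> real^'n^'m) \<Rightarrow>
    ('n, 'm) ycoord \<Rightarrow> ('n, 'm) ycoord set" where
  "dist_Z z a = span (range (\<lambda>i. Zvec z i a))"

definition tangent_Z :: "(('n::finite, 'm::finite) ycoord \<Rightarrow> real^'n^'m) \<Rightarrow>
    ('n, 'm) ycoord \<Rightarrow> ('n, 'm) ycoord \<Rightarrow> ('n, 'm) jcoord" where
  "tangent_Z z a = frechet_derivative (\<lambda>a. (a, z a)) (at a)"

definition embedded ::
    "('x::topological_space, 'y::topological_space, 'n::finite, 'm::finite) fibring \<Rightarrow>
     (('x, 'y) jet \<Rightarrow> ('x, 'y) jet) \<Rightarrow> 'y set \<Rightarrow> ('y \<Rightarrow> ('x, 'y) jet) \<Rightarrow> bool" where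
  "embedded M \<Gamma> V Z \<longleftrightarrow>
     (\<forall>c b. fibred_chart M c b \<longrightarrow> (\<forall>a\<in>snd c ` (V \<inter> fst c).
        let F = conn_coeff M \<Gamma> c b; z = section_coeff Z c b
        in tangent_Z z a ` dist_Z z a \<subseteq> dist_Gam F (a, z a)))"

definition conn_form :: "(('n::finite, 'm::finite) ycoord \<Rightarrow> real^'n^'m) \<Rightarrow>
    (('n, 'm) ycoord, ('n, 'm) ycoord) form" where
  "conn_form z = (\<lambda>a X. \<Sum>i\<in>UNIV. (fst (X 0) $ i) *\<^sub>R Zvec z i a)"

definition dx :: "'n::finite \<Rightarrow> (('n, 'm::finite) ycoord, real) form" where
  "dx i = (\<lambda>a X. fst (X 0) $ i)"

definition omega_bar :: "(('n::finite, 'm::finite) ycoord \<Rightarrow> real^'n^'m) \<Rightarrow> 'm \<Rightarrow>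
    (('n, 'm) ycoord, real) form" where
  "omega_bar z \<sigma> = (\<lambda>a X. snd (X 0) $ \<sigma> - (\<Sum>j\<in>UNIV. z a $ \<sigma> $ j * fst (X 0) $ j))"

definition dy_vec :: "'m::finite \<Rightarrow> ('n::finite, 'm) ycoord" where
  "dy_vec \<sigma> = (0, axis \<sigma> 1)"

text \<open>The value \<open>i\<^sub>w (s u)\<close> for a vector \<open>u\<close> vertical over the total space, where
  \<open>s (\<partial>/\<partial>y\<^sup>\<sigma>\<^sub>i) = dx\<^sup>i \<otimes> \<partial>/\<partial>y\<^sup>\<sigma>\<close>.\<close>

definition s_hat :: "('n::finite, 'm::finite) jcoord \<Rightarrow> ('n, 'm) ycoord \<Rightarrow> ('n, 'm) ycoord" where
  "s_hat u w = (0, \<chi> \<sigma>. \<Sum>i\<in>UNIV. snd u $ \<sigma> $ i * fst w $ i)"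

text \<open>Indices of vectors start at \<open>0\<close>, hence the exponent \<open>q + r + 1\<close>.\<close>

definition Z_wedge :: "nat \<Rightarrow> (('n::finite, 'm::finite) ycoord \<Rightarrow> real^'n^'m) \<Rightarrow>
    (('n, 'm) jcoord, ('n, 'm) jcoord) form \<Rightarrow> (('n, 'm) ycoord, ('n, 'm) ycoord) form" where
  "Z_wedge q z K = (\<lambda>a X. \<Sum>r\<le>q. (-1)^(q+r+1) *\<^sub>R
     s_hat (K (a, z a) (omit r (\<lambda>i. tangent_Z z a (X i)))) (X r))"

definition total_shape :: "(('n::finite, 'm::finite) jcoord \<Rightarrow> real^'n^'n^'m) \<Rightarrow>
    (real^'n \<Rightarrow> real^'n) \<Rightarrow> (real^'n \<Rightarrow> real^'n) \<Rightarrow> (('n, 'm) ycoord \<Rightarrow> real^'n^'m) \<Rightarrow>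
    (('n, 'm) ycoord, ('n, 'm) ycoord) form" where
  "total_shape F \<phi> v z = Z_wedge 1 z (endo_form (proj_Q F \<phi> v))"

text \<open>The component \<open>A\<^sup>\<sigma>\<^sub>\<nu>\<^sub>i\<close>.\<close>

definition A_coeff :: "(('n::finite, 'm::finite) jcoord \<Rightarrow> real^'n^'n^'m) \<Rightarrow>
    (real^'n \<Rightarrow> real^'n) \<Rightarrow> (real^'n \<Rightarrow> real^'n) \<Rightarrow> (('n, 'm) ycoord \<Rightarrow> real^'n^'m) \<Rightarrow>
    'm \<Rightarrow> 'm \<Rightarrow> 'n \<Rightarrow> ('n, 'm) ycoord \<Rightarrow> real" where
  "A_coeff F \<phi> v z \<sigma> \<nu> i a =
     frechet_derivative (\<lambda>a. z a $ \<sigma> $ i) (at a) (dy_vec \<nu>)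
     - H_coeff F \<phi> v (a, z a) $ \<sigma> $ \<nu> $ i"

end

(* In the coordinates of a fibred chart, write x for the base part and w for the vertical part
   (the value of omega_bar) of a tangent vector, so that A, H and the Jacobi endomorphism Phi become
   bilinear expressions in such x and w, and let B be the derivative of Z in the vertical directions,
   B = A + H. As K = conn_form z is horizontal and L = total_shape is vertical-valued, the bracket
   [K, L](X, Y, W) is the cyclic sum of DL(KX)(Y, W) - DK(L(X, Y), W) - L(dK(X, Y), W). Embeddedness
   says Z_i(Z_k) = F_ik o Z; a vertical derivative of this equation and the symmetry of the second
   derivatives of Z express the derivative of A along Z_i by the derivatives of F and H on the graph.
   Substituting B = A + H, the symmetry of F in the lower indices cancels everything but A^2 and Phi.

   The symmetry of F is needed on a full neighbourhood of the graph in the jet bundle, since the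
   derivatives of F along H_sigma enter Phi: hence the construction of a section with prescribed
   1-jet. The formula for H follows from the eigenvalue equation by contraction with v. *)

theory Submission
  imports Defs
begin

section \<open>Iterated differentiability\<close>

text \<open>The obstacle is that the objects are not given by formulas: H is a definite description,
  a jet with given coordinates is a value of \<open>inv_into\<close>, and the bracket is a double
  sum over a basis. Each has to become an expression that can be differentiated. The formula for H
  shows that the description has a value and that this value is differentiable, as the derivative of
  H along D_\<Gamma> occurs both in Phi and in the derivative of A; on the graph the two occurrences
  agree, because TZ maps Z_i to \<Gamma>_i. Contraction with v takes the place of coordinates
  adapted to \<phi>, so any fibred chart will do. In the bracket the derivative of A appears only in
  combinations skew in the two base arguments; hence the derivatives of F, symmetric in them, drop
  out of the derivative of A and of Phi separately, and besides the derivative of H only terms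
  quadratic in A and H are left.\<close>

lemma differentiable_cong_open:
  assumes "f differentiable at x" "\<And>y. y \<in> S \<Longrightarrow> g y = f y" "open S" "x \<in> S"
  shows "g differentiable at x"
proof -
  obtain D where "(f has_derivative D) (at x)"
    using assms(1) by (auto simp: differentiable_def)
  then have "(g has_derivative D) (at x)"
    by (rule has_derivative_transform_within_open[OF _ assms(3,4)]) (simp add: assms(2))
  then show ?thesis by (auto simp: differentiable_def)
qed

lemma times_differentiable_on_cong:
  assumes "open S" "\<And>x. x \<in> S \<Longrightarrow> f x = g x"
  shows "times_differentiable_on k S f \<longleftrightarrow> times_differentiable_on k S g"
  using assms(2)
proof (induction k arbitrary: f g)
  case 0
  then show ?case by (simp cong: continuous_on_cong)
next
  case (Suc k)
  have d: "f differentiable at x \<longleftrightarrow> g differentiable at x" if "x \<in> S" for x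
    using differentiable_cong_open[OF _ _ assms(1) that, of f g]
      differentiable_cong_open[OF _ _ assms(1) that, of g f] Suc.prems by auto
  show ?case
  proof (cases "\<forall>x\<in>S. f differentiable at x")
    case True
    have "frechet_derivative f (at x) = frechet_derivative g (at x)" if "x \<in> S" for x
      using frechet_derivative_transform_within_open[OF _ assms(1) that] True Suc.prems that by metis
    then have "times_differentiable_on k S (\<lambda>x. frechet_derivative f (at x) w) \<longleftrightarrow>
        times_differentiable_on k S (\<lambda>x. frechet_derivative g (at x) w)" for w
      by (intro Suc.IH) auto
    then show ?thesis using d by simp
  qed (use d in auto)
qed

lemma times_differentiable_on_subset:
  "times_differentiable_on k T f \<Longrightarrow> S \<subseteq> T \<Longrightarrow> times_differentiable_on k S f"
  by (induction k arbitrary: f) (auto intro: continuous_on_subset)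

lemma times_differentiable_on_Suc_imp:
  "times_differentiable_on (Suc k) S f \<Longrightarrow> times_differentiable_on k S f"
proof (induction k arbitrary: f)
  case 0
  then show ?case
    by (auto intro!: continuous_at_imp_continuous_on differentiable_imp_continuous_within)
next
  case (Suc k)
  have "times_differentiable_on k S (\<lambda>x. frechet_derivative f (at x) w)" for w
    using Suc.prems by (intro Suc.IH) simp
  then show ?case using Suc.prems by simp
qed

lemma times_differentiable_on_const:
  "times_differentiable_on k S (\<lambda>x. c)"
  by (induction k arbitrary: c) auto

lemma times_differentiable_on_bounded_linear:
  assumes "open S" "times_differentiable_on k S f" "bounded_linear L"
  shows "times_differentiable_on k S (\<lambda>x. L (f x))"
  using assms(2)
proof (induction k arbitrary: f)
  case 0
  then show ?case using bounded_linear.continuous_on[OF assms(3)] by auto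
next
  case (Suc k)
  have D: "((\<lambda>x. L (f x)) has_derivative (\<lambda>w. L (frechet_derivative f (at x) w))) (at x)"
    if "x \<in> S" for x
    using Suc.prems that
    by (intro bounded_linear.has_derivative[OF assms(3)]) (simp add: frechet_derivative_works)
  have "times_differentiable_on k S (\<lambda>x. frechet_derivative (\<lambda>x. L (f x)) (at x) w)" for w
    using Suc.IH[of "\<lambda>x. frechet_derivative f (at x) w"] Suc.prems
      times_differentiable_on_cong[OF assms(1), of "\<lambda>x. frechet_derivative (\<lambda>x. L (f x)) (at x) w"
        "\<lambda>x. L (frechet_derivative f (at x) w)"]
    by (auto simp: frechet_derivative_at[OF D, symmetric])
  then show ?case using D by (auto simp: differentiable_def)
qed

lemma times_differentiable_on_add:
  assumes "open S" "times_differentiable_on k S f" "times_differentiable_on k S g"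
  shows "times_differentiable_on k S (\<lambda>x. f x + g x)"
  using assms(2,3)
proof (induction k arbitrary: f g)
  case 0
  then show ?case by (auto intro: continuous_on_add)
next
  case (Suc k)
  have D: "((\<lambda>x. f x + g x) has_derivative
      (\<lambda>w. frechet_derivative f (at x) w + frechet_derivative g (at x) w)) (at x)"
    if "x \<in> S" for x
    using Suc.prems that by (intro has_derivative_add) (auto simp: frechet_derivative_works)
  have "times_differentiable_on k S (\<lambda>x. frechet_derivative (\<lambda>x. f x + g x) (at x) w)" for w
    using Suc.IH[of "\<lambda>x. frechet_derivative f (at x) w" "\<lambda>x. frechet_derivative g (at x) w"] Suc.prems
      times_differentiable_on_cong[OF assms(1), of "\<lambda>x. frechet_derivative (\<lambda>x. f x + g x) (at x) w"
        "\<lambda>x. frechet_derivative f (at x) w + frechet_derivative g (at x) w"]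
    by (auto simp: frechet_derivative_at[OF D, symmetric])
  then show ?case using D by (auto simp: differentiable_def)
qed

lemma times_differentiable_on_sum:
  assumes "open S" "finite I" "\<And>i. i \<in> I \<Longrightarrow> times_differentiable_on k S (f i)"
  shows "times_differentiable_on k S (\<lambda>x. \<Sum>i\<in>I. f i x)"
  using assms(2,3)
  by (induction I rule: finite_induct)
     (auto intro!: times_differentiable_on_const times_differentiable_on_add[OF assms(1)])

lemma times_differentiable_on_scaleR:
  assumes "open S" "times_differentiable_on k S f" "times_differentiable_on k S g"
  shows "times_differentiable_on k S (\<lambda>x. f x *\<^sub>R g x)"
  using assms(2,3)
proof (induction k arbitrary: f g)
  case 0
  then show ?case by (auto intro: continuous_on_scaleR)
next
  case (Suc k)
  have D: "((\<lambda>x. f x *\<^sub>R g x) has_derivative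
      (\<lambda>w. f x *\<^sub>R frechet_derivative g (at x) w + frechet_derivative f (at x) w *\<^sub>R g x)) (at x)"
    if "x \<in> S" for x
    using Suc.prems that by (intro has_derivative_scaleR) (auto simp: frechet_derivative_works)
  have fg: "times_differentiable_on k S f" "times_differentiable_on k S g"
    using Suc.prems times_differentiable_on_Suc_imp by blast+
  have "times_differentiable_on k S (\<lambda>x. frechet_derivative (\<lambda>x. f x *\<^sub>R g x) (at x) w)" for w
    using times_differentiable_on_add[OF assms(1)
        Suc.IH[of f "\<lambda>x. frechet_derivative g (at x) w"]
        Suc.IH[of "\<lambda>x. frechet_derivative f (at x) w" g]] fg Suc.prems
      times_differentiable_on_cong[OF assms(1), of "\<lambda>x. frechet_derivative (\<lambda>x. f x *\<^sub>R g x) (at x) w"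
        "\<lambda>x. f x *\<^sub>R frechet_derivative g (at x) w + frechet_derivative f (at x) w *\<^sub>R g x"]
    by (auto simp: frechet_derivative_at[OF D, symmetric])
  then show ?case using D by (auto simp: differentiable_def)
qed

lemma linear_eq_sum_Basis:
  fixes L :: "'a::euclidean_space \<Rightarrow> 'b::real_vector"
  assumes "linear L"
  shows "L w = (\<Sum>e\<in>Basis. (w \<bullet> e) *\<^sub>R L e)"
proof -
  have "L w = L (\<Sum>e\<in>Basis. (w \<bullet> e) *\<^sub>R e)"
    by (simp add: euclidean_representation)
  also have "\<dots> = (\<Sum>e\<in>Basis. (w \<bullet> e) *\<^sub>R L e)"
    using assms by (simp add: linear_sum linear_scale)
  finally show ?thesis .
qed

text \<open>The chain rule puts a direction depending on \<open>x\<close> into the derivative of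
  \<open>g\<close>, whereas the induction hypothesis speaks of a fixed direction. Expanding the
  direction in the basis leaves fixed directions \<open>e\<close> with variable coefficients, so
  that the rules for sums and for \<open>*\<^sub>R\<close> apply.\<close>

lemma times_differentiable_on_compose:
  fixes f :: "'a::euclidean_space \<Rightarrow> 'b::euclidean_space"
  assumes "open S" "open T" "f ` S \<subseteq> T"
    and "times_differentiable_on k S f" "times_differentiable_on k T g"
  shows "times_differentiable_on k S (\<lambda>x. g (f x))"
  using assms(4,5)
proof (induction k arbitrary: g)
  case 0
  then show ?case using assms(3) by (auto intro: continuous_on_compose2)
next
  case (Suc k)
  have df: "f differentiable at x" and dg: "g differentiable at (f x)" if "x \<in> S" for x
    using Suc.prems that assms(3) by auto
  have D: "((\<lambda>x. g (f x)) has_derivative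
      (\<lambda>w. \<Sum>e\<in>Basis. (frechet_derivative f (at x) w \<bullet> e) *\<^sub>R frechet_derivative g (at (f x)) e)) (at x)"
    if "x \<in> S" for x
  proof -
    have "((\<lambda>x. g (f x)) has_derivative
      (\<lambda>w. frechet_derivative g (at (f x)) (frechet_derivative f (at x) w))) (at x)"
      using diff_chain_at[of f _ x g] df[OF that] dg[OF that]
      by (auto simp: frechet_derivative_works o_def)
    moreover have "(\<lambda>w. frechet_derivative g (at (f x)) (frechet_derivative f (at x) w)) =
      (\<lambda>w. \<Sum>e\<in>Basis. (frechet_derivative f (at x) w \<bullet> e) *\<^sub>R frechet_derivative g (at (f x)) e)"
      by (intro ext linear_eq_sum_Basis linear_frechet_derivative dg that)
    ultimately show ?thesis by simp
  qed
  have f: "times_differentiable_on k S f"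
    using Suc.prems times_differentiable_on_Suc_imp by blast
  have "times_differentiable_on k S (\<lambda>x. frechet_derivative (\<lambda>x. g (f x)) (at x) w)" for w
  proof -
    have "times_differentiable_on k S
      (\<lambda>x. \<Sum>e\<in>Basis. (frechet_derivative f (at x) w \<bullet> e) *\<^sub>R frechet_derivative g (at (f x)) e)"
      using Suc.prems f
      by (intro times_differentiable_on_sum times_differentiable_on_scaleR assms(1)
          times_differentiable_on_bounded_linear[OF assms(1) _ bounded_linear_inner_left]
          Suc.IH[of "\<lambda>y. frechet_derivative g (at y) _"]) auto
    then show ?thesis
      using times_differentiable_on_cong[OF assms(1), of "\<lambda>x. frechet_derivative (\<lambda>x. g (f x)) (at x) w"
        "\<lambda>x. \<Sum>e\<in>Basis. (frechet_derivative f (at x) w \<bullet> e) *\<^sub>R frechet_derivative g (at (f x)) e"]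
      by (auto simp: frechet_derivative_at[OF D, symmetric])
  qed
  then show ?case using D by (auto simp: differentiable_def)
qed

lemma smooth_on_subset: "smooth_on T f \<Longrightarrow> S \<subseteq> T \<Longrightarrow> smooth_on S f"
  using times_differentiable_on_subset unfolding smooth_on_def by blast

lemma smooth_on_compose:
  fixes f :: "'a::euclidean_space \<Rightarrow> 'b::euclidean_space"
  assumes "open S" "open T" "f ` S \<subseteq> T" "smooth_on S f" "smooth_on T g"
  shows "smooth_on S (\<lambda>x. g (f x))"
  using times_differentiable_on_compose[OF assms(1-3)] assms(4,5) unfolding smooth_on_def by blast

lemma smooth_on_bounded_linear:
  "open S \<Longrightarrow> smooth_on S f \<Longrightarrow> bounded_linear L \<Longrightarrow> smooth_on S (\<lambda>x. L (f x))"
  using times_differentiable_on_bounded_linear unfolding smooth_on_def by blast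

lemma smooth_on_affine:
  assumes "\<And>x. (f has_derivative L) (at x)"
  shows "smooth_on S f"
proof -
  have "times_differentiable_on k S f" for k
  proof (cases k)
    case 0
    then show ?thesis
      using assms
      by (auto intro!: continuous_at_imp_continuous_on has_derivative_continuous)
  next
    case (Suc j)
    then show ?thesis
      using assms times_differentiable_on_const
      by (auto simp: frechet_derivative_at[OF assms, symmetric] differentiable_def)
  qed
  then show ?thesis by (simp add: smooth_on_def)
qed

lemma smooth_on_imp_differentiable: "smooth_on S f \<Longrightarrow> x \<in> S \<Longrightarrow> f differentiable at x"
  unfolding smooth_on_def using times_differentiable_on.simps(2)[of 0 S f] by blast

lemma smooth_on_frechet_derivative:
  "smooth_on S f \<Longrightarrow> smooth_on S (\<lambda>x. frechet_derivative f (at x) w)"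
  unfolding smooth_on_def using times_differentiable_on.simps(2)[of _ S f] by blast

text \<open>Both the base point and the direction move with \<open>q\<close>, as in
  \<open>neg_lift_source\<close>, where the derivative of \<open>F\<close> is taken along a vector
  built from \<phi>; the basis expansion separates the two dependences. It is available where
  \<open>k q\<close> lies in \<open>S\<close>, hence the neighbourhood \<open>V\<close>.\<close>

lemma differentiable_frechet_derivative_apply:
  fixes f :: "'a::euclidean_space \<Rightarrow> 'b::real_normed_vector"
  assumes f: "smooth_on S f" and S: "open S" and k: "k differentiable at p" "k p \<in> S"
    and g: "g differentiable at p"
  shows "(\<lambda>q. frechet_derivative f (at (k q)) (g q)) differentiable at p"
proof -
  have "isCont k p"
    using k(1) by (simp add: differentiable_imp_continuous_within)
  then have "\<exists>V. open V \<and> p \<in> V \<and> (\<forall>q\<in>V. k q \<in> S)"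
    unfolding continuous_at_open using S k(2) by simp
  then obtain V where V: "open V" "p \<in> V" "\<And>q. q \<in> V \<Longrightarrow> k q \<in> S"
    by auto
  have D: "(\<lambda>q. frechet_derivative f (at (k q)) e) differentiable at p" for e
  proof -
    have "(\<lambda>y. frechet_derivative f (at y) e) differentiable at (k p)"
      using smooth_on_imp_differentiable[OF smooth_on_frechet_derivative[OF f] k(2)] .
    then show ?thesis
      using differentiable_chain_at[OF k(1)] by (simp add: o_def)
  qed
  have "(\<lambda>q. \<Sum>e\<in>Basis. (g q \<bullet> e) *\<^sub>R frechet_derivative f (at (k q)) e) differentiable at p"
    using g by (intro differentiable_sum ballI differentiable_scaleR D differentiable_inner) auto
  moreover have "frechet_derivative f (at (k q)) (g q) =
      (\<Sum>e\<in>Basis. (g q \<bullet> e) *\<^sub>R frechet_derivative f (at (k q)) e)" if "q \<in> V" for q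
    by (intro linear_eq_sum_Basis linear_frechet_derivative smooth_on_imp_differentiable[OF f] V(3) that)
  ultimately show ?thesis
    using V(1,2) by (rule differentiable_cong_open)
qed

section \<open>Symmetry of second derivatives\<close>

lemma second_difference_mean_value:
  fixes f :: "'a::euclidean_space \<Rightarrow> real"
  assumes f: "times_differentiable_on 2 S f" and s: "0 < s"
    and mem: "\<And>\<sigma> \<tau>. 0 \<le> \<sigma> \<Longrightarrow> \<sigma> \<le> s \<Longrightarrow> 0 \<le> \<tau> \<Longrightarrow> \<tau> \<le> s \<Longrightarrow> x + \<sigma> *\<^sub>R u + \<tau> *\<^sub>R w \<in> S"
  shows "\<exists>\<sigma> \<tau>. 0 < \<sigma> \<and> \<sigma> < s \<and> 0 < \<tau> \<and> \<tau> < s \<and>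
    f (x + s *\<^sub>R u + s *\<^sub>R w) - f (x + s *\<^sub>R u) - f (x + s *\<^sub>R w) + f x =
      s * s * frechet_derivative (\<lambda>y. frechet_derivative f (at y) u) (at (x + \<sigma> *\<^sub>R u + \<tau> *\<^sub>R w)) w"
proof -
  have f1: "(f has_derivative frechet_derivative f (at y)) (at y)" if "y \<in> S" for y
    using f that by (auto simp: numeral_2_eq_2 frechet_derivative_works)
  define g where "g y = frechet_derivative f (at y) u" for y
  have g1: "(g has_derivative frechet_derivative g (at y)) (at y)" if "y \<in> S" for y
    using f that by (simp add: numeral_2_eq_2 g_def[abs_def] frechet_derivative_works[symmetric])
  \<comment> \<open>The second difference is \<open>\<phi> s - \<phi> 0\<close>. The mean value
    theorem in the direction \<open>u\<close> turns it into a first difference of \<open>g\<close>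
    in the direction \<open>w\<close>, and a second application turns that into a second
    derivative.\<close>
  define \<phi> where "\<phi> \<sigma> = f (x + \<sigma> *\<^sub>R u + s *\<^sub>R w) - f (x + \<sigma> *\<^sub>R u)" for \<sigma>
  have chain: "((\<lambda>t. h (c t)) has_real_derivative h' u) (at \<sigma>)"
    if "(h has_derivative h') (at (c \<sigma>))" "(c has_derivative (\<lambda>t. t *\<^sub>R u)) (at \<sigma>)"
    for h h' :: "'a \<Rightarrow> real" and c u \<sigma>
  proof -
    have "h' (t *\<^sub>R u) = h' u * t" for t
      using linear_scale[OF has_derivative_linear[OF that(1)], of t u] by (simp add: mult.commute)
    then show ?thesis
      using has_derivative_compose[OF that(2), of h h'] that(1) unfolding has_field_derivative_def
      by simp
  qed
  have d: "(\<phi> has_real_derivative (g (x + \<sigma> *\<^sub>R u + s *\<^sub>R w) - g (x + \<sigma> *\<^sub>R u))) (at \<sigma>)"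
    if "0 \<le> \<sigma>" "\<sigma> \<le> s" for \<sigma>
    unfolding \<phi>_def g_def using mem[of \<sigma> s] mem[of \<sigma> 0] that s
    by (intro DERIV_diff chain[where h=f] f1) (auto intro!: derivative_eq_intros)
  obtain \<sigma> where \<sigma>: "0 < \<sigma>" "\<sigma> < s"
    "\<phi> s - \<phi> 0 = (s - 0) * (g (x + \<sigma> *\<^sub>R u + s *\<^sub>R w) - g (x + \<sigma> *\<^sub>R u))"
    using MVT2[OF s d] by auto
  have d2: "((\<lambda>\<tau>. g (x + \<sigma> *\<^sub>R u + \<tau> *\<^sub>R w)) has_real_derivative
      frechet_derivative g (at (x + \<sigma> *\<^sub>R u + \<tau> *\<^sub>R w)) w) (at \<tau>)"
    if "0 \<le> \<tau>" "\<tau> \<le> s" for \<tau>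
    using mem[of \<sigma> \<tau>] that \<sigma>
    by (intro chain[where h=g] g1) (auto intro!: derivative_eq_intros)
  obtain \<tau> where \<tau>: "0 < \<tau>" "\<tau> < s"
    "g (x + \<sigma> *\<^sub>R u + s *\<^sub>R w) - g (x + \<sigma> *\<^sub>R u + 0 *\<^sub>R w) =
       (s - 0) * frechet_derivative g (at (x + \<sigma> *\<^sub>R u + \<tau> *\<^sub>R w)) w"
    using MVT2[OF s d2] by auto
  have "f (x + s *\<^sub>R u + s *\<^sub>R w) - f (x + s *\<^sub>R u) - f (x + s *\<^sub>R w) + f x = \<phi> s - \<phi> 0"
    by (simp add: \<phi>_def)
  also have "\<dots> = s * s * frechet_derivative g (at (x + \<sigma> *\<^sub>R u + \<tau> *\<^sub>R w)) w"
    using \<sigma>(3) \<tau>(3) by simp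
  finally show ?thesis using \<sigma> \<tau> unfolding g_def by blast
qed

text \<open>The second difference over a small parallelogram is symmetric in \<open>u\<close> and
  \<open>w\<close>, and divided by \<open>s * s\<close> it is a value of either mixed derivative at
  a nearby point. By continuity both mixed derivatives at \<open>x\<close> are limits of the same
  quotient.\<close>

lemma second_derivative_symmetric_real:
  fixes f :: "'a::euclidean_space \<Rightarrow> real"
  assumes f: "times_differentiable_on 2 S f" and S: "open S" "x \<in> S"
  shows "frechet_derivative (\<lambda>y. frechet_derivative f (at y) u) (at x) w =
         frechet_derivative (\<lambda>y. frechet_derivative f (at y) w) (at x) u"
proof (rule ccontr)
  define D where "D u w y = frechet_derivative (\<lambda>y. frechet_derivative f (at y) u) (at y) w" for u w y
  assume "\<not> ?thesis"
  then have e: "\<bar>D u w x - D w u x\<bar> > 0" by (simp add: D_def)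
  have c: "continuous_on S (D u w)" for u w
    using f by (simp add: numeral_2_eq_2 D_def[abs_def])
  \<comment> \<open>Half the gap: a common value cannot be closer than \<open>e\<close> to both
    derivatives.\<close>
  define e where "e = \<bar>D u w x - D w u x\<bar> / 2"
  have e0: "e > 0" using e by (simp add: e_def)
  have "\<exists>d>0. \<forall>y. dist y x < d \<longrightarrow> y \<in> S \<and> dist (D a b y) (D a b x) < e" for a b
  proof -
    have "isCont (D a b) x" using c S by (simp add: continuous_on_eq_continuous_at)
    then obtain d1 where "d1 > 0" "\<forall>y. dist y x < d1 \<longrightarrow> dist (D a b y) (D a b x) < e"
      using e0 unfolding continuous_at_eps_delta by blast
    moreover obtain d2 where "d2 > 0" "\<forall>y. dist y x < d2 \<longrightarrow> y \<in> S"
      using S unfolding open_dist by blast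
    ultimately show ?thesis by (intro exI[of _ "min d1 d2"]) auto
  qed
  then obtain d1 d2 where d: "d1 > 0" "\<And>y. dist y x < d1 \<Longrightarrow> y \<in> S \<and> dist (D u w y) (D u w x) < e"
    "d2 > 0" "\<And>y. dist y x < d2 \<Longrightarrow> y \<in> S \<and> dist (D w u y) (D w u x) < e"
    by metis
  \<comment> \<open>The summand \<open>1\<close> keeps \<open>N\<close> positive when both
    directions vanish; \<open>s\<close> is chosen so that the whole parallelogram lies within
    \<open>min d1 d2\<close> of \<open>x\<close>.\<close>
  define N where "N = norm u + norm w + 1"
  define s where "s = min d1 d2 / N / 2"
  have np: "N > 0" unfolding N_def by (meson add_nonneg_pos add_nonneg_nonneg norm_ge_zero zero_less_one)
  have s0: "s > 0" using d np by (simp add: s_def)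
  have nb: "dist (x + \<sigma> *\<^sub>R u + \<tau> *\<^sub>R w) x < min d1 d2" if "0 \<le> \<sigma>" "\<sigma> \<le> s" "0 \<le> \<tau>" "\<tau> \<le> s" for \<sigma> \<tau>
  proof -
    have "dist (x + \<sigma> *\<^sub>R u + \<tau> *\<^sub>R w) x = norm (\<sigma> *\<^sub>R u + \<tau> *\<^sub>R w)"
      by (simp add: dist_norm algebra_simps)
    also have "\<dots> \<le> \<sigma> * norm u + \<tau> * norm w"
      using that norm_triangle_ineq[of "\<sigma> *\<^sub>R u" "\<tau> *\<^sub>R w"] by simp
    also have "\<dots> \<le> s * norm u + s * norm w"
      using that by (intro add_mono mult_right_mono) auto
    also have "\<dots> \<le> s * N" using s0 by (simp add: N_def algebra_simps)
    also have "\<dots> = min d1 d2 / 2" using np by (simp add: s_def)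
    also have "\<dots> < min d1 d2" using d(1,3) by (simp add: min_def)
    finally show ?thesis .
  qed
  have mem1: "x + \<sigma> *\<^sub>R u + \<tau> *\<^sub>R w \<in> S" if "0 \<le> \<sigma>" "\<sigma> \<le> s" "0 \<le> \<tau>" "\<tau> \<le> s" for \<sigma> \<tau>
    using nb[OF that] d by simp
  have mem2: "x + \<sigma> *\<^sub>R w + \<tau> *\<^sub>R u \<in> S" if "0 \<le> \<sigma>" "\<sigma> \<le> s" "0 \<le> \<tau>" "\<tau> \<le> s" for \<sigma> \<tau>
    using mem1[OF that(3,4,1,2)] by (simp add: algebra_simps)
  obtain \<sigma> \<tau> where 1: "0 < \<sigma>" "\<sigma> < s" "0 < \<tau>" "\<tau> < s"
    "f (x + s *\<^sub>R u + s *\<^sub>R w) - f (x + s *\<^sub>R u) - f (x + s *\<^sub>R w) + f x = s * s * D u w (x + \<sigma> *\<^sub>R u + \<tau> *\<^sub>R w)"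
    using second_difference_mean_value[OF f s0 mem1] unfolding D_def by blast
  obtain \<sigma>' \<tau>' where 2: "0 < \<sigma>'" "\<sigma>' < s" "0 < \<tau>'" "\<tau>' < s"
    "f (x + s *\<^sub>R w + s *\<^sub>R u) - f (x + s *\<^sub>R w) - f (x + s *\<^sub>R u) + f x = s * s * D w u (x + \<sigma>' *\<^sub>R w + \<tau>' *\<^sub>R u)"
    using second_difference_mean_value[OF f s0 mem2] unfolding D_def by blast
  have "s * s * D u w (x + \<sigma> *\<^sub>R u + \<tau> *\<^sub>R w) = s * s * D w u (x + \<sigma>' *\<^sub>R w + \<tau>' *\<^sub>R u)"
    using 1(5) 2(5) by (simp add: algebra_simps)
  then have "D u w (x + \<sigma> *\<^sub>R u + \<tau> *\<^sub>R w) = D w u (x + \<tau>' *\<^sub>R u + \<sigma>' *\<^sub>R w)"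
    using s0 by (simp add: algebra_simps)
  moreover have "dist (D u w (x + \<sigma> *\<^sub>R u + \<tau> *\<^sub>R w)) (D u w x) < e"
    using nb[of \<sigma> \<tau>] 1 d(2) by simp
  moreover have "dist (D w u (x + \<tau>' *\<^sub>R u + \<sigma>' *\<^sub>R w)) (D w u x) < e"
    using nb[of \<tau>' \<sigma>'] 2 d(4) by simp
  ultimately have "dist (D u w x) (D w u x) < e + e"
    by (metis (no_types) add_strict_mono dist_commute dist_triangle_lt order_le_less_trans dist_triangle)
  then show False by (simp add: e_def dist_real_def)
qed

lemma second_derivative_symmetric:
  fixes f :: "'a::euclidean_space \<Rightarrow> 'b::euclidean_space"
  assumes f: "smooth_on S f" and S: "open S" "x \<in> S"
  shows "frechet_derivative (\<lambda>y. frechet_derivative f (at y) u) (at x) w =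
         frechet_derivative (\<lambda>y. frechet_derivative f (at y) w) (at x) u"
proof (rule euclidean_eqI)
  fix e :: 'b
  assume "e \<in> Basis"
  have se: "smooth_on S (\<lambda>y. f y \<bullet> e)"
    using smooth_on_bounded_linear[OF S(1) f bounded_linear_inner_left] .
  have 1: "frechet_derivative (\<lambda>y. h y \<bullet> e) (at y) u = frechet_derivative h (at y) u \<bullet> e"
    if "h differentiable at y" for h y and u :: 'a
  proof -
    have "((\<lambda>y. h y \<bullet> e) has_derivative (\<lambda>u. frechet_derivative h (at y) u \<bullet> e)) (at y)"
      using that unfolding frechet_derivative_works
      by (rule bounded_linear.has_derivative[OF bounded_linear_inner_left])
    from frechet_derivative_at[OF this] show ?thesis by metis
  qed
  have 2: "frechet_derivative (\<lambda>y. frechet_derivative (\<lambda>y. f y \<bullet> e) (at y) u) (at x) w =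
      frechet_derivative (\<lambda>y. frechet_derivative f (at y) u) (at x) w \<bullet> e" for u w
  proof -
    have d: "(\<lambda>y. frechet_derivative f (at y) u) differentiable at x"
      using smooth_on_imp_differentiable[OF smooth_on_frechet_derivative[OF f] S(2)] .
    have "(\<lambda>y. frechet_derivative (\<lambda>y. f y \<bullet> e) (at y) u) differentiable at x"
      using smooth_on_imp_differentiable[OF smooth_on_frechet_derivative[OF se] S(2)] .
    then have "frechet_derivative (\<lambda>y. frechet_derivative (\<lambda>y. f y \<bullet> e) (at y) u) (at x) =
        frechet_derivative (\<lambda>y. frechet_derivative f (at y) u \<bullet> e) (at x)"
      using frechet_derivative_transform_within_open[OF _ S, of _ "\<lambda>y. frechet_derivative f (at y) u \<bullet> e"]
        1[OF smooth_on_imp_differentiable[OF f]] by simp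
    then show ?thesis using 1[OF d] by simp
  qed
  have "times_differentiable_on 2 S (\<lambda>y. f y \<bullet> e)" using se by (simp add: smooth_on_def)
  from second_derivative_symmetric_real[OF this S]
  show "frechet_derivative (\<lambda>y. frechet_derivative f (at y) u) (at x) w \<bullet> e =
     frechet_derivative (\<lambda>y. frechet_derivative f (at y) w) (at x) u \<bullet> e"
    by (simp add: 2)
qed

section \<open>Local sections and jets\<close>

lemma smooth_on_chart_change:
  "smooth_structure A \<Longrightarrow> c \<in> A \<Longrightarrow> d \<in> A \<Longrightarrow>
    smooth_on (snd c ` (fst c \<inter> fst d)) (\<lambda>a. snd d (chart_inv c a))"
  unfolding smooth_structure_def compatible_def o_def by blast

lemma chart_inv_apply: "is_chart c \<Longrightarrow> p \<in> fst c \<Longrightarrow> chart_inv c (snd c p) = p"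
  unfolding is_chart_def homeomorphism_def by blast

lemma apply_chart_inv: "is_chart c \<Longrightarrow> a \<in> snd c ` fst c \<Longrightarrow> snd c (chart_inv c a) = a"
  unfolding is_chart_def homeomorphism_def by blast

lemma chart_inv_mem: "is_chart c \<Longrightarrow> a \<in> snd c ` fst c \<Longrightarrow> chart_inv c a \<in> fst c"
  unfolding is_chart_def homeomorphism_def by blast

lemma chart_open_domain: "is_chart c \<Longrightarrow> open (fst c)"
  unfolding is_chart_def by blast

lemma chart_open_range: "is_chart c \<Longrightarrow> open (snd c ` fst c)"
  unfolding is_chart_def by blast

lemma continuous_on_chart_inv: "is_chart c \<Longrightarrow> continuous_on (snd c ` fst c) (chart_inv c)"
  unfolding is_chart_def homeomorphism_def by blast

lemma continuous_on_chart: "is_chart c \<Longrightarrow> continuous_on (fst c) (snd c)"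
  unfolding is_chart_def homeomorphism_def by blast

lemma open_vimage_Int: "open S \<Longrightarrow> continuous_on S f \<Longrightarrow> open T \<Longrightarrow> open (f -` T \<inter> S)"
  by (simp add: continuous_on_open_vimage)

lemma open_chart_image:
  assumes c: "is_chart c" and "open W" shows "open (snd c ` (W \<inter> fst c))"
proof -
  have "snd c ` (W \<inter> fst c) = chart_inv c -` W \<inter> snd c ` fst c"
  proof (intro equalityI subsetI)
    fix a assume "a \<in> snd c ` (W \<inter> fst c)"
    then obtain p where "p \<in> W" "p \<in> fst c" "a = snd c p" by auto
    then show "a \<in> chart_inv c -` W \<inter> snd c ` fst c" using chart_inv_apply[OF c] by simp
  next
    fix a assume a: "a \<in> chart_inv c -` W \<inter> snd c ` fst c"
    then have "chart_inv c a \<in> W \<inter> fst c" using chart_inv_mem[OF c] by simp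
    moreover have "a = snd c (chart_inv c a)" using apply_chart_inv[OF c] a by simp
    ultimately show "a \<in> snd c ` (W \<inter> fst c)" by (rule rev_image_eqI)
  qed
  then show ?thesis
    using open_vimage_Int[OF chart_open_range[OF c] continuous_on_chart_inv[OF c] assms(2)] by simp
qed

lemma fibred_chart_is_chart:
  assumes "fibred_manifold M" "fibred_chart M c b"
  shows "is_chart c" "is_chart b"
  using assms by (simp_all add: fibred_manifold_def fibred_chart_def smooth_structure_def)

lemma fibred_chart_base_mem:
  assumes "fibred_chart M c b" "a \<in> snd c ` fst c"
  shows "fst a \<in> snd b ` fst b"
proof -
  obtain y where "y \<in> fst c" "a = snd c y" using assms(2) by auto
  then have "fst a = snd b (proj M y)" "proj M y \<in> fst b"
    using assms(1) unfolding fibred_chart_def by auto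
  then show ?thesis by simp
qed

lemma fst_jet [simp]: "fst (jet M k x s) = x"
  by (simp add: jet_def)

lemma jet_equivD:
  assumes "jet_equiv M k x s t"
  shows "section_at M x t" "t x = s x"
  using assms by (simp_all add: jet_equiv_def)

lemma jet_rep_jet:
  assumes "section_at M x s"
  shows "jet_equiv M k x s (jet_rep (jet M k x s))"
proof -
  have "s \<in> snd (jet M k x s)"
    using assms by (simp add: jet_def jet_equiv_def)
  then have "jet_rep (jet M k x s) \<in> snd (jet M k x s)"
    unfolding jet_rep_def by (rule someI[where P = "\<lambda>s'. s' \<in> snd (jet M k x s)"])
  then show ?thesis unfolding jet_def by simp
qed

lemma jet_target_jet:
  assumes "section_at M x s"
  shows "jet_target (jet M k x s) = s x"
  unfolding jet_target_def fst_jet by (rule jet_equivD(2)[OF jet_rep_jet[OF assms]])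

lemma section_at_jet_rep:
  assumes "j \<in> jets M k"
  shows "section_at M (fst j) (jet_rep j)"
proof -
  obtain x s where j: "j = jet M k x s" and "section_at M x s"
    using assms by (auto simp: jets_def)
  then show ?thesis
    unfolding j fst_jet by (intro jet_equivD(1)[OF jet_rep_jet])
qed

text \<open>The representative chosen for \<open>jet_forget M l j\<close> may be another section
  than that of \<open>j\<close>, but equivalent sections pass through the same point.\<close>

lemma jet_target_forget:
  assumes "j \<in> jets M k"
  shows "jet_target (jet_forget M l j) = jet_target j"
  unfolding jet_forget_def jet_target_jet[OF section_at_jet_rep[OF assms]]
  by (simp add: jet_target_def)

lemma section_at_proj: "section_at M x s \<Longrightarrow> proj M (s x) = x"
  unfolding section_at_def by auto

lemma smooth_fibre_rep:
  assumes M: "fibred_manifold M" and cb: "fibred_chart M c b"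
    and s: "section_at M x s" "s x \<in> fst c"
  obtains U where "open U" "snd b x \<in> U" "smooth_on U (fibre_rep c b s)"
proof -
  obtain W where W: "x \<in> W" "smooth_map_on (base_atlas M) (total_atlas M) W s"
    "\<forall>w\<in>W. proj M (s w) = w"
    using s(1) unfolding section_at_def by blast
  have "open W" "continuous_on W s"
    using W(2) by (auto simp: smooth_map_on_def)
  have "b \<in> base_atlas M" "c \<in> total_atlas M"
    using cb by (auto simp: fibred_chart_def)
  then have sm: "smooth_on (snd b ` (W \<inter> fst b \<inter> s -` fst c)) (snd c \<circ> s \<circ> chart_inv b)"
    using W(2) unfolding smooth_map_on_def by blast
  have ic: "is_chart c" "is_chart b" using fibred_chart_is_chart[OF M cb] by auto
  then have "open (W \<inter> s -` fst c)"
    using open_vimage_Int[OF \<open>open W\<close> \<open>continuous_on W s\<close> chart_open_domain[OF ic(1)]]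
    by (simp add: Int_commute)
  then have o: "open (snd b ` (W \<inter> fst b \<inter> s -` fst c))"
    using open_chart_image[OF ic(2), of "W \<inter> s -` fst c"] by (simp add: Int_assoc Int_commute[of "fst b"])
  have "x = proj M (s x)" using section_at_proj[OF s(1)] by simp
  then have "x \<in> fst b" using cb s(2) unfolding fibred_chart_def by auto
  then have "snd b x \<in> snd b ` (W \<inter> fst b \<inter> s -` fst c)"
    using W s(2) by auto
  moreover have "smooth_on (snd b ` (W \<inter> fst b \<inter> s -` fst c)) (fibre_rep c b s)"
    using smooth_on_bounded_linear[OF o sm bounded_linear_snd]
    by (simp add: fibre_rep_def[abs_def] o_def)
  ultimately show ?thesis by (rule that[OF o])
qed

text \<open>The definition of a second order connection has no symmetry clause: its values are jets
  of actual sections, and the symmetry of its components is that of second partial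
  derivatives.\<close>

lemma jet_y2_symmetric:
  assumes M: "fibred_manifold M" and cb: "fibred_chart M c b"
    and j: "j \<in> jets M k" "jet_target j \<in> fst c"
  shows "jet_y2 c b j $ \<sigma> $ i $ l = jet_y2 c b j $ \<sigma> $ l $ i"
proof -
  obtain U where U: "open U" "snd b (fst j) \<in> U" "smooth_on U (fibre_rep c b (jet_rep j))"
    by (rule smooth_fibre_rep[OF M cb section_at_jet_rep[OF j(1)] j(2)[unfolded jet_target_def]])
  show ?thesis
    using second_derivative_symmetric[OF U(3,1,2), of "axis i 1" "axis l 1"]
    by (simp add: jet_y2_def)
qed

text \<open>In the chart this is the graph of an affine map through \<open>a\<close> with linear
  part \<open>y1\<close>, so its 1-jet has the coordinates \<open>(a, y1)\<close>. Since
  \<open>jet1_inv\<close> is an \<open>inv_into\<close>, its values carry information only on the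
  range of \<open>jet1_coord\<close>; the section shows that this range contains every such
  pair.\<close>

lemma affine_section:
  fixes M :: "('x::topological_space, 'y::topological_space, 'n::finite, 'm::finite) fibring"
  assumes M: "fibred_manifold M" and cb: "fibred_chart M c b"
    and a: "a \<in> snd c ` fst c"
    and s: "s = (\<lambda>x. chart_inv c (snd b x, snd a + y1 *v (snd b x - fst a)))"
  shows "section_at M (chart_inv b (fst a)) s"
    and "\<exists>U. open U \<and> fst a \<in> U \<and>
      (\<forall>q\<in>U. fibre_rep c b s q = snd a + y1 *v (q - fst a))"
proof -
  define g where "g q = (q, snd a + y1 *v (q - fst a))" for q
  have ic: "is_chart c" "is_chart b" using fibred_chart_is_chart[OF M cb] by auto
  have bc: "b \<in> base_atlas M" "c \<in> total_atlas M" using cb by (auto simp: fibred_chart_def)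
  have g': "(g has_derivative (\<lambda>w. (w, y1 *v w))) (at q)" for q
    unfolding g_def
    by (auto intro!: derivative_eq_intros bounded_linear.has_derivative[OF matrix_vector_mul_bounded_linear])
  have gc: "continuous_on S g" for S
    using has_derivative_continuous[OF g'] by (intro continuous_at_imp_continuous_on ballI)
  have sg: "s x = chart_inv c (g (snd b x))" for x by (simp add: s g_def)
  \<comment> \<open>The affine graph may leave the range of the chart; \<open>T\<close> is the open
    set of base coordinates where it does not.\<close>
  define T where "T = g -` (snd c ` fst c)"
  have oc: "open (snd c ` fst c)" using ic(1) by (simp add: is_chart_def)
  have T: "open T" unfolding T_def using open_vimage_Int[OF open_UNIV gc oc] by simp
  define W where "W = snd b -` T \<inter> fst b"
  have oW: "open W" unfolding W_def
    using open_vimage_Int[OF chart_open_domain[OF ic(2)] continuous_on_chart[OF ic(2)] T] .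
  have gW: "g (snd b x) \<in> snd c ` fst c" if "x \<in> W" for x using that by (auto simp: W_def T_def)
  have sW: "s x \<in> fst c" if "x \<in> W" for x using chart_inv_mem[OF ic(1) gW[OF that]] by (simp add: sg)
  have pW: "proj M (s x) = x" if "x \<in> W" for x
  proof -
    have "snd b (proj M (s x)) = fst (snd c (s x))"
      using cb sW[OF that] unfolding fibred_chart_def by blast
    also have "\<dots> = snd b x" using apply_chart_inv[OF ic(1) gW[OF that]] by (simp add: sg g_def)
    finally have "snd b (proj M (s x)) = snd b x" .
    moreover have "proj M (s x) \<in> fst b"
      using cb sW[OF that] unfolding fibred_chart_def by blast
    moreover have "x \<in> fst b" using that by (simp add: W_def)
    ultimately show ?thesis using chart_inv_apply[OF ic(2)] by metis
  qed
  have cs: "continuous_on W s"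
  proof -
    have "continuous_on W (\<lambda>x. chart_inv c (g (snd b x)))"
    proof (rule continuous_on_compose2[OF continuous_on_chart_inv[OF ic(1)]])
      show "continuous_on W (\<lambda>x. g (snd b x))"
        by (rule continuous_on_compose2[OF gc[of UNIV]])
          (auto intro: continuous_on_subset[OF continuous_on_chart[OF ic(2)]] simp: W_def)
    qed (use gW in auto)
    then show ?thesis by (simp add: sg[abs_def])
  qed
  have "smooth_on (snd e ` (W \<inter> fst e \<inter> s -` fst d)) (snd d \<circ> s \<circ> chart_inv e)"
    if ed: "e \<in> base_atlas M" "d \<in> total_atlas M" for e d
  proof -
    have str: "smooth_structure (base_atlas M)" "smooth_structure (total_atlas M)"
      using M by (auto simp: fibred_manifold_def)
    then have ie: "is_chart e" and id: "is_chart d"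
      using ed by (auto simp: smooth_structure_def)
    have "open (W \<inter> s -` fst d)"
      using open_vimage_Int[OF oW cs chart_open_domain[OF id]] by (simp add: Int_commute)
    then have o1: "open (snd e ` (W \<inter> fst e \<inter> s -` fst d))"
      using open_chart_image[OF ie, of "W \<inter> s -` fst d"] by (simp add: Int_assoc Int_commute[of "fst e"])
    have o2: "open (snd c ` (fst c \<inter> fst d))"
      using open_chart_image[OF ic(1) chart_open_domain[OF id]] by (simp only: Int_commute)
    \<comment> \<open>Smoothness is tested in arbitrary charts \<open>e\<close> and
      \<open>d\<close>; the map factors into the chart change from \<open>e\<close> to
      \<open>b\<close>, the affine map \<open>g\<close>, and the chart change from \<open>c\<close>
      to \<open>d\<close>.\<close>
    have m1: "smooth_on (snd e ` (W \<inter> fst e \<inter> s -` fst d)) (\<lambda>q. snd b (chart_inv e q))"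
    proof -
      have "smooth_on (snd e ` (fst e \<inter> fst b)) (\<lambda>q. snd b (chart_inv e q))"
        using smooth_on_chart_change[OF str(1) ed(1) bc(1)] .
      moreover have "W \<inter> fst e \<inter> s -` fst d \<subseteq> fst e \<inter> fst b" unfolding W_def by blast
      ultimately show ?thesis by (rule smooth_on_subset[OF _ image_mono])
    qed
    have m2: "smooth_on (snd e ` (W \<inter> fst e \<inter> s -` fst d)) (\<lambda>q. g (snd b (chart_inv e q)))"
      by (rule smooth_on_compose[OF o1 open_UNIV _ m1 smooth_on_affine[OF g']]) simp
    have m3: "smooth_on (snd c ` (fst c \<inter> fst d)) (\<lambda>q. snd d (chart_inv c q))"
      using smooth_on_chart_change[OF str(2) bc(2) ed(2)] .
    have "(\<lambda>q. g (snd b (chart_inv e q))) ` (snd e ` (W \<inter> fst e \<inter> s -` fst d))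
        \<subseteq> snd c ` (fst c \<inter> fst d)"
    proof (rule image_subsetI)
      fix q assume "q \<in> snd e ` (W \<inter> fst e \<inter> s -` fst d)"
      then obtain x where x: "x \<in> W" "x \<in> fst e" "s x \<in> fst d" and q: "q = snd e x" by auto
      have "g (snd b x) = snd c (s x)"
        using apply_chart_inv[OF ic(1) gW[OF x(1)]] by (simp add: sg)
      then show "g (snd b (chart_inv e q)) \<in> snd c ` (fst c \<inter> fst d)"
        using x sW[OF x(1)] chart_inv_apply[OF ie x(2)] by (simp add: q)
    qed
    from smooth_on_compose[OF o1 o2 this m2 m3]
    show ?thesis by (simp add: o_def sg)
  qed
  then have sm: "smooth_map_on (base_atlas M) (total_atlas M) W s"
    unfolding smooth_map_on_def using oW cs by blast
  have fa: "fst a \<in> snd b ` fst b" using fibred_chart_base_mem[OF cb a] .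
  have ga: "g (fst a) = a" by (simp add: g_def matrix_vector_mult_0_right)
  have "chart_inv b (fst a) \<in> W"
    using chart_inv_mem[OF ic(2) fa] apply_chart_inv[OF ic(2) fa] a ga by (simp add: W_def T_def)
  then show "section_at M (chart_inv b (fst a)) s"
    unfolding section_at_def using sm pW by blast
  have "open (snd b ` fst b \<inter> T)" using T ic(2) by (auto simp: is_chart_def)
  moreover have "fst a \<in> snd b ` fst b \<inter> T" using fa a ga by (simp add: T_def)
  moreover have "fibre_rep c b s q = snd a + y1 *v (q - fst a)" if "q \<in> snd b ` fst b \<inter> T" for q
  proof -
    have "snd b (chart_inv b q) = q" using apply_chart_inv[OF ic(2)] that by blast
    then have "snd c (s (chart_inv b q)) = g q"
      using apply_chart_inv[OF ic(1), of "g q"] that by (simp add: sg T_def)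
    then show ?thesis by (simp add: fibre_rep_def g_def)
  qed
  ultimately show "\<exists>U. open U \<and> fst a \<in> U \<and>
      (\<forall>q\<in>U. fibre_rep c b s q = snd a + y1 *v (q - fst a))" by blast
qed

lemma jet1_coord_surj:
  fixes M :: "('x::topological_space, 'y::topological_space, 'n::finite, 'm::finite) fibring"
  assumes M: "fibred_manifold M" and cb: "fibred_chart M c b"
    and p: "p \<in> (snd c ` fst c) \<times> UNIV"
  shows "\<exists>j\<in>jets M 1. jet_target j \<in> fst c \<and> jet1_coord c b j = p"
proof -
  obtain a y1 where p: "p = (a, y1)" and a: "a \<in> snd c ` fst c" using p by auto
  have ic: "is_chart c" "is_chart b" using fibred_chart_is_chart[OF M cb] by auto
  define s where "s = (\<lambda>x. chart_inv c (snd b x, snd a + y1 *v (snd b x - fst a)))"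
  define x where "x = chart_inv b (fst a)"
  have fa: "fst a \<in> snd b ` fst b" using fibred_chart_base_mem[OF cb a] .
  have bx: "snd b x = fst a" using apply_chart_inv[OF ic(2) fa] by (simp add: x_def)
  have sx: "section_at M x s" using affine_section(1)[OF M cb a s_def] by (simp add: x_def)
  obtain U where U: "open U" "fst a \<in> U" "\<And>q. q \<in> U \<Longrightarrow> fibre_rep c b s q = snd a + y1 *v (q - fst a)"
    using affine_section(2)[OF M cb a s_def] by blast
  have "((\<lambda>q. snd a + y1 *v (q - fst a)) has_derivative (\<lambda>w. y1 *v w)) (at (fst a))"
    by (auto intro!: derivative_eq_intros bounded_linear.has_derivative[OF matrix_vector_mul_bounded_linear])
  then have "(fibre_rep c b s has_derivative (\<lambda>w. y1 *v w)) (at (fst a))"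
    by (rule has_derivative_transform_within_open[OF _ U(1,2)]) (simp add: U(3))
  then have D: "pderivs [i] (fibre_rep c b s) (snd b x) $ \<sigma> = y1 $ \<sigma> $ i" for i \<sigma>
    by (simp add: frechet_derivative_at[symmetric] bx matrix_vector_mul_component inner_axis)
  have sa: "s x = chart_inv c a" by (simp add: s_def bx matrix_vector_mult_0_right)
  define j where "j = jet M 1 x s"
  have "j \<in> jets M 1" unfolding jets_def j_def using sx by blast
  moreover have t: "jet_target j = chart_inv c a"
    using jet_target_jet[OF sx] by (simp add: j_def sa)
  \<comment> \<open>\<open>jet_y1\<close> reads the derivatives off the chosen representative, not
    off \<open>s\<close>; they agree because jet equivalence includes the chart \<open>c\<close>
    over \<open>b\<close>.\<close>
  moreover have "jet_y1 c b j = y1"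
  proof -
    have "jet_equiv M 1 x s (jet_rep j)" unfolding j_def by (rule jet_rep_jet[OF sx])
    then have "\<forall>is. length is \<le> 1 \<longrightarrow> pderivs is (fibre_rep c b s) (snd b x) =
        pderivs is (fibre_rep c b (jet_rep j)) (snd b x)"
      using cb chart_inv_mem[OF ic(1) a] unfolding jet_equiv_def sa by blast
    then have "pderivs [i] (fibre_rep c b (jet_rep j)) (snd b x) = pderivs [i] (fibre_rep c b s) (snd b x)" for i
      by (auto simp del: pderivs.simps)
    then show ?thesis
      using D by (simp add: jet_y1_def vec_eq_iff fst_jet j_def del: pderivs.simps)
  qed
  ultimately show ?thesis
    using chart_inv_mem[OF ic(1) a] apply_chart_inv[OF ic(1) a]
    by (intro bexI[of _ j]) (auto simp: jet1_coord_def p)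
qed

text \<open>Surjectivity makes \<open>jet1_inv M c b p\<close> a genuine 1-jet with target in the
  chart domain. As \<Gamma> is a section of the jet projection, the 2-jet over it has the same
  target, so the symmetry of its second order coordinates applies.\<close>

lemma conn_coeff_symmetric:
  fixes M :: "('x::topological_space, 'y::topological_space, 'n::finite, 'm::finite) fibring"
  assumes M: "fibred_manifold M" and cb: "fibred_chart M c b"
    and \<Gamma>: "second_order_connection M \<Gamma>"
    and p: "p \<in> (snd c ` fst c) \<times> UNIV"
  shows "conn_coeff M \<Gamma> c b p $ \<sigma> $ i $ k = conn_coeff M \<Gamma> c b p $ \<sigma> $ k $ i"
proof -
  define j where "j = jet1_inv M c b p"
  have "p \<in> jet1_coord c b ` {j \<in> jets M 1. jet_target j \<in> fst c}"
    using jet1_coord_surj[OF M cb p] by blast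
  then have "j \<in> {j \<in> jets M 1. jet_target j \<in> fst c}"
    unfolding j_def jet1_inv_def by (rule inv_into_into)
  then have j: "j \<in> jets M 1" "jet_target j \<in> fst c" by auto
  have "\<Gamma> j \<in> jets M 2" "jet_forget M 1 (\<Gamma> j) = j"
    using \<Gamma> j(1) by (auto simp: second_order_connection_def)
  moreover have "jet_target (\<Gamma> j) \<in> fst c"
    using jet_target_forget[OF calculation(1), of 1] calculation(2) j(2) by simp
  ultimately show ?thesis
    unfolding conn_coeff_def j_def[symmetric] using jet_y2_symmetric[OF M cb] by blast
qed

section \<open>Evaluation of the brackets\<close>

lemma sum_permutes_lessThan_2:
  "(\<Sum>\<tau> | \<tau> permutes {..<2::nat}. f \<tau>) = f id + f (Transposition.transpose 0 1)"
proof -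
  have "{..<2::nat} = insert 0 {1}" by auto
  then show ?thesis by (simp add: sum_over_permutations_insert permutes_sing)
qed

lemma sum_permutes_lessThan_3:
  "(\<Sum>\<tau> | \<tau> permutes {..<3::nat}. f \<tau>) =
     f id + f (Transposition.transpose 1 2) + (f (Transposition.transpose 0 1) + f (Transposition.transpose 0 1 \<circ> Transposition.transpose 1 2))
     + (f (Transposition.transpose 0 2) + f (Transposition.transpose 0 2 \<circ> Transposition.transpose 1 2))"
proof -
  have "{..<3::nat} = insert 0 (insert 1 {2})" by auto
  then show ?thesis by (simp add: sum_over_permutations_insert permutes_sing add.assoc)
qed

lemma sign_transpose_comp:
  "a \<noteq> b \<Longrightarrow> c \<noteq> d \<Longrightarrow> sign (Transposition.transpose a b \<circ> Transposition.transpose c (d::nat)) = 1"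
  by (simp add: sign_compose permutation_swap_id sign_swap_id)

text \<open>The factors are described by their values at the single point \<open>p\<close>, because
  some of the forms to be multiplied are derivatives that are known there only.\<close>

lemma wedge_1_1:
  assumes "\<And>Y. \<alpha> p Y = a (Y 0)" "\<And>Y. \<beta> p Y = b (Y 0)"
  shows "wedge 1 1 \<alpha> \<beta> p X = a (X 0) * b (X 1) - a (X 1) * b (X 0)"
  unfolding wedge_def assms one_add_one sum_permutes_lessThan_2
  by (simp add: sign_swap_id)

lemma wedge_2_0:
  assumes "\<And>Y. \<alpha> p Y = a (Y 0) (Y 1)" "\<And>Y. \<beta> p Y = c" "\<And>x y. a x y = - a y x"
  shows "wedge 2 0 \<alpha> \<beta> p X = a (X 0) (X 1) * c"
  unfolding wedge_def assms(1,2) add_0_right sum_permutes_lessThan_2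
  by (simp add: sign_swap_id assms(3)[of "X 1" "X 0"] fact_2 algebra_simps del: One_nat_def)

lemma wedge_0_2:
  assumes "\<And>Y. \<alpha> p Y = c" "\<And>Y. \<beta> p Y = b (Y 0) (Y 1)" "\<And>x y. b x y = - b y x"
  shows "wedge 0 2 \<alpha> \<beta> p X = c * b (X 0) (X 1)"
  unfolding wedge_def assms(1,2) add_0_left sum_permutes_lessThan_2
  by (simp add: sign_swap_id assms(3)[of "X 1" "X 0"] fact_2 algebra_simps del: One_nat_def)

text \<open>The six permutations fall into three pairs; skewness makes the two terms of a pair
  equal, which cancels the normalising factor \<open>fact 1 * fact 2\<close>.\<close>

lemma wedge_1_2:
  assumes "\<And>Y. \<alpha> p Y = a (Y 0)" "\<And>Y. \<beta> p Y = b (Y 0) (Y 1)" "\<And>x y. b x y = - b y x"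
  shows "wedge 1 2 \<alpha> \<beta> p X =
    a (X 0) * b (X 1) (X 2) + a (X 1) * b (X 2) (X 0) + a (X 2) * b (X 0) (X 1)"
proof -
  have e: "1 + 2 = (3::nat)" by simp
  show ?thesis
    unfolding wedge_def assms(1,2) e sum_permutes_lessThan_3
    by (simp add: sign_swap_id sign_transpose_comp Transposition.transpose_def fact_2
        assms(3)[of "X 0" "X 2"] assms(3)[of "X 2" "X 1"] assms(3)[of "X 1" "X 0"] algebra_simps del: One_nat_def)
qed

lemma wedge_2_1:
  assumes "\<And>Y. \<alpha> p Y = a (Y 0) (Y 1)" "\<And>Y. \<beta> p Y = b (Y 0)" "\<And>x y. a x y = - a y x"
  shows "wedge 2 1 \<alpha> \<beta> p X =
    a (X 0) (X 1) * b (X 2) + a (X 1) (X 2) * b (X 0) + a (X 2) (X 0) * b (X 1)"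
proof -
  have e: "2 + 1 = (3::nat)" by simp
  show ?thesis
    unfolding wedge_def assms(1,2) e sum_permutes_lessThan_3
    by (simp add: sign_swap_id sign_transpose_comp Transposition.transpose_def fact_2
        assms(3)[of "X 0" "X 2"] assms(3)[of "X 2" "X 1"] assms(3)[of "X 1" "X 0"] algebra_simps numeral_2_eq_2[symmetric] del: One_nat_def)
qed

lemma wedge_0_3:
  assumes "\<And>Y. \<alpha> p Y = c" "\<And>Y. \<beta> p Y = b (Y 0) (Y 1) (Y 2)"
    and "\<And>x y z. b x y z = - b y x z" "\<And>x y z. b x y z = - b x z y"
  shows "wedge 0 3 \<alpha> \<beta> p X = c * b (X 0) (X 1) (X 2)"
proof -
  let ?x = "X 0" and ?y = "X 1" and ?z = "X 2"
  have b: "b ?x ?z ?y = - b ?x ?y ?z" "b ?y ?x ?z = - b ?x ?y ?z" "b ?y ?z ?x = b ?x ?y ?z"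
    "b ?z ?x ?y = b ?x ?y ?z" "b ?z ?y ?x = - b ?x ?y ?z"
    using assms(3)[of ?x ?y ?z] assms(4)[of ?x ?y ?z] assms(4)[of ?y ?x ?z]
      assms(3)[of ?x ?z ?y] assms(4)[of ?z ?x ?y] by linarith+
  have f: "fact (3::nat) = (6::real)" by (simp add: fact_numeral)
  show ?thesis
    unfolding wedge_def assms(1,2) add_0_left sum_permutes_lessThan_3
    by (simp add: sign_swap_id sign_transpose_comp Transposition.transpose_def b f algebra_simps del: One_nat_def)
qed

lemma insertion_2_2:
  assumes L: "\<And>Y. L p Y = l (Y 0) (Y 1)" and K: "\<And>Y. K p Y = k (Y 0) (Y 1)" "\<And>x y. k x y = - k y x"
    and l: "\<And>x y. l (- x) y = - l x y"
  shows "insertion 2 2 K L p X =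
    l (k (X 0) (X 1)) (X 2) + l (k (X 1) (X 2)) (X 0) + l (k (X 2) (X 0)) (X 1)"
proof -
  have e: "2 + 2 - 1 = (3::nat)" by simp
  have h: "(1/2) *\<^sub>R (a + a) = a" for a :: 'a by (simp add: scaleR_2[symmetric])
  have k: "k (X 0) (X 2) = - k (X 2) (X 0)" "k (X 2) (X 1) = - k (X 1) (X 2)" "k (X 1) (X 0) = - k (X 0) (X 1)"
    by (rule K(2))+
  have c: "case_nat a f (1::nat) = f 0" for a :: 'a and f by simp
  have "insertion 2 2 K L p X = (1/2) *\<^sub>R ((l (k (X 0) (X 1)) (X 2) + l (k (X 1) (X 2)) (X 0) + l (k (X 2) (X 0)) (X 1))
    + (l (k (X 0) (X 1)) (X 2) + l (k (X 1) (X 2)) (X 0) + l (k (X 2) (X 0)) (X 1)))"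
    unfolding insertion_def L K(1) e sum_permutes_lessThan_3
    by (simp add: sign_swap_id sign_transpose_comp Transposition.transpose_def fact_2 k l c algebra_simps numeral_2_eq_2[symmetric] del: One_nat_def)
  then show ?thesis unfolding h .
qed

section \<open>Froelicher-Nijenhuis brackets through directional derivatives\<close>

lemma sum_Basis_collapse:
  fixes f :: "'e::euclidean_space \<Rightarrow> 'e"
  assumes "linear f"
  shows "(\<Sum>a\<in>Basis. \<Sum>b\<in>Basis. ((x \<bullet> a) * (f a \<bullet> b)) *\<^sub>R b) = f x"
proof -
  have "(\<Sum>b\<in>Basis. ((x \<bullet> a) * (f a \<bullet> b)) *\<^sub>R b) = (x \<bullet> a) *\<^sub>R f a" for a
    by (simp add: scaleR_scaleR[symmetric] scaleR_sum_right[symmetric] euclidean_representation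
        del: scaleR_scaleR)
  then show ?thesis by (simp only: linear_eq_sum_Basis[OF assms, of x])
qed

lemma sum_Basis_collapse':
  fixes f :: "'e::euclidean_space \<Rightarrow> 'e"
  assumes "linear f"
  shows "(\<Sum>a\<in>Basis. \<Sum>b\<in>Basis. ((f b \<bullet> a) * (x \<bullet> b)) *\<^sub>R a) = f x"
  using sum_Basis_collapse[OF assms, of x] by (subst sum.swap) (simp add: mult.commute)

lemma frechet_derivative_inner:
  "(f has_derivative f') (at p) \<Longrightarrow> frechet_derivative (\<lambda>q. f q \<bullet> b) (at p) = (\<lambda>u. f' u \<bullet> b)"
  by (rule frechet_derivative_at[symmetric])
    (rule bounded_linear.has_derivative[OF bounded_linear_inner_left])

text \<open>The vector parts \<open>a\<close> and \<open>b\<close> of the decomposition are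
  constant, so the Lie bracket term vanishes and Lie derivatives reduce to derivatives of the
  coefficients. The sums over the basis then undo the decomposition. Here \<open>DK u w\<close> is
  the derivative of \<open>K\<close> along \<open>u\<close>, evaluated on \<open>w\<close>.\<close>

lemma fn_bracket_1_1:
  fixes K L :: "('e::euclidean_space, 'e) form"
  assumes k: "\<And>Y. K p Y = k (Y 0)" "linear k"
    and DK: "\<And>Y. ((\<lambda>q. K q Y) has_derivative (\<lambda>u. DK u (Y 0))) (at p)"
    and l: "\<And>Y. L p Y = l (Y 0)" "linear l"
    and DL: "\<And>Y. ((\<lambda>q. L q Y) has_derivative (\<lambda>u. DL u (Y 0))) (at p)"
  shows "fn_bracket 1 1 K L p X =
    DL (k (X 0)) (X 1) - DL (k (X 1)) (X 0) + DK (l (X 0)) (X 1) - DK (l (X 1)) (X 0)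
    - l (DK (X 0) (X 1) - DK (X 1) (X 0)) - k (DL (X 0) (X 1) - DL (X 1) (X 0))"
proof -
  have lin: "linear (\<lambda>u. DK u w)" "linear (\<lambda>u. DL u w)" for w
    using has_derivative_linear[OF DK[of "\<lambda>_. w"]] has_derivative_linear[OF DL[of "\<lambda>_. w"]] by auto
  have lie: "lie_deriv 1 (\<lambda>_. a) (\<lambda>q Y. L q Y \<bullet> b) p Y = DL a (Y 0) \<bullet> b"
    "lie_deriv 1 (\<lambda>_. a) (\<lambda>q Y. K q Y \<bullet> b) p Y = DK a (Y 0) \<bullet> b" for a b Y
    by (simp_all add: lie_deriv_def frechet_derivative_inner[OF DK] frechet_derivative_inner[OF DL]
        k l linear_0)
  have ext: "ext_deriv 1 (\<lambda>q Y. L q Y \<bullet> b) p Y = (DL (Y 0) (Y 1) - DL (Y 1) (Y 0)) \<bullet> b"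
    "ext_deriv 1 (\<lambda>q Y. K q Y \<bullet> b) p Y = (DK (Y 0) (Y 1) - DK (Y 1) (Y 0)) \<bullet> b" for b Y
    by (simp_all add: ext_deriv_def frechet_derivative_inner[OF DK] frechet_derivative_inner[OF DL]
        omit_def inner_diff_left)
  have hook: "hook 1 (\<lambda>_. a) (\<lambda>q Y. L q Y \<bullet> b) p Y = l a \<bullet> b"
    "hook 1 (\<lambda>_. a) (\<lambda>q Y. K q Y \<bullet> b) p Y = k a \<bullet> b" for a b Y
    by (simp_all add: hook_def k l)
  have e: "(1::nat) + 1 = 2" "(1::nat) - 1 = 0" by simp_all
  have *: "fn_decomposable 1 1 (\<lambda>q Y. K q Y \<bullet> a) (\<lambda>_. a) (\<lambda>q Y. L q Y \<bullet> b) (\<lambda>_. b) p X =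
      ((k (X 0) \<bullet> a) * (DL a (X 1) \<bullet> b)) *\<^sub>R b - ((k (X 1) \<bullet> a) * (DL a (X 0) \<bullet> b)) *\<^sub>R b
      + ((DK b (X 1) \<bullet> a) * (l (X 0) \<bullet> b)) *\<^sub>R a - ((DK b (X 0) \<bullet> a) * (l (X 1) \<bullet> b)) *\<^sub>R a
      - (((DK (X 0) (X 1) - DK (X 1) (X 0)) \<bullet> a) * (l a \<bullet> b)) *\<^sub>R b
      - ((k b \<bullet> a) * ((DL (X 0) (X 1) - DL (X 1) (X 0)) \<bullet> b)) *\<^sub>R a" for a b
  proof -
    have 1: "wedge 1 1 (\<lambda>q Y. K q Y \<bullet> a) (lie_deriv 1 (\<lambda>_. a) (\<lambda>q Y. L q Y \<bullet> b)) p X =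
        (k (X 0) \<bullet> a) * (DL a (X 1) \<bullet> b) - (k (X 1) \<bullet> a) * (DL a (X 0) \<bullet> b)"
      by (rule wedge_1_1) (simp_all add: k lie del: One_nat_def)
    have 2: "wedge 1 1 (lie_deriv 1 (\<lambda>_. b) (\<lambda>q Y. K q Y \<bullet> a)) (\<lambda>q Y. L q Y \<bullet> b) p X =
        (DK b (X 0) \<bullet> a) * (l (X 1) \<bullet> b) - (DK b (X 1) \<bullet> a) * (l (X 0) \<bullet> b)"
      by (rule wedge_1_1) (simp_all add: l lie del: One_nat_def)
    have 3: "wedge 2 0 (ext_deriv 1 (\<lambda>q Y. K q Y \<bullet> a)) (hook 1 (\<lambda>_. a) (\<lambda>q Y. L q Y \<bullet> b)) p X =
        ((DK (X 0) (X 1) - DK (X 1) (X 0)) \<bullet> a) * (l a \<bullet> b)"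
      by (rule wedge_2_0[where a = "\<lambda>x y. (DK x y - DK y x) \<bullet> a"])
         (simp_all add: ext hook inner_diff_left del: One_nat_def)
    have 4: "wedge 0 2 (hook 1 (\<lambda>_. b) (\<lambda>q Y. K q Y \<bullet> a)) (ext_deriv 1 (\<lambda>q Y. L q Y \<bullet> b)) p X =
        (k b \<bullet> a) * ((DL (X 0) (X 1) - DL (X 1) (X 0)) \<bullet> b)"
      by (rule wedge_0_2[where b = "\<lambda>x y. (DL x y - DL y x) \<bullet> b"])
         (simp_all add: ext hook inner_diff_left del: One_nat_def)
    show ?thesis
      unfolding fn_decomposable_def e 1 2 3 4
      by (simp add: lie_bracket_def scaleR_diff_left)
  qed
  show ?thesis
    unfolding fn_bracket_def *
    by (simp only: sum_subtractf sum.distrib sum_Basis_collapse[OF lin(2)]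
        sum_Basis_collapse'[OF lin(1)] sum_Basis_collapse[OF l(2)] sum_Basis_collapse'[OF k(2)])
qed

lemma fn_bracket_1_2:
  fixes K L :: "('e::euclidean_space, 'e) form"
  assumes k: "\<And>Y. K p Y = k (Y 0)" "linear k"
    and DK: "\<And>Y. ((\<lambda>q. K q Y) has_derivative (\<lambda>u. DK u (Y 0))) (at p)"
    and l: "\<And>Y. L p Y = l (Y 0) (Y 1)" "\<And>y. linear (\<lambda>x. l x y)" "\<And>x y. l x y = - l y x"
    and DL: "\<And>Y. ((\<lambda>q. L q Y) has_derivative (\<lambda>u. DL u (Y 0) (Y 1))) (at p)"
      "\<And>u x y. DL u x y = - DL u y x"
  shows "fn_bracket 1 2 K L p X =
    DL (k (X 0)) (X 1) (X 2) + DL (k (X 1)) (X 2) (X 0) + DL (k (X 2)) (X 0) (X 1)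
    - (DK (l (X 0) (X 1)) (X 2) + DK (l (X 1) (X 2)) (X 0) + DK (l (X 2) (X 0)) (X 1))
    - (l (DK (X 0) (X 1) - DK (X 1) (X 0)) (X 2) + l (DK (X 1) (X 2) - DK (X 2) (X 1)) (X 0)
       + l (DK (X 2) (X 0) - DK (X 0) (X 2)) (X 1))
    - k (DL (X 0) (X 1) (X 2) + DL (X 1) (X 2) (X 0) + DL (X 2) (X 0) (X 1))"
proof -
  have lin: "linear (\<lambda>u. DK u w)" "linear (\<lambda>u. DL u w w')" for w w'
    using has_derivative_linear[OF DK[of "\<lambda>_. w"]]
      has_derivative_linear[OF DL(1)[of "\<lambda>i. if i = 0 then w else w'"]] by auto
  \<comment> \<open>A constant field has derivative \<open>0\<close>, so the Lie derivative of the
    2-form contains \<open>l\<close> with \<open>0\<close> in either slot; linearity is assumed in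
    the first slot and passes to the second by skewness.\<close>
  have l0: "l 0 y = 0" "l x 0 = 0" for x y
    using linear_0[OF l(2)[of y]] linear_0[OF l(2)[of x]] l(3)[of x 0] by auto
  have lieL: "lie_deriv 2 (\<lambda>_. a) (\<lambda>q Y. L q Y \<bullet> b) p Y = DL a (Y 0) (Y 1) \<bullet> b" for a b Y
    by (simp add: lie_deriv_def frechet_derivative_inner[OF DL(1)] l(1) l0 numeral_2_eq_2)
  have lieK: "lie_deriv 1 (\<lambda>_. a) (\<lambda>q Y. K q Y \<bullet> b) p Y = DK a (Y 0) \<bullet> b" for a b Y
    by (simp add: lie_deriv_def frechet_derivative_inner[OF DK] k linear_0)
  have extK: "ext_deriv 1 (\<lambda>q Y. K q Y \<bullet> b) p Y = (DK (Y 0) (Y 1) - DK (Y 1) (Y 0)) \<bullet> b" for b Y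
    by (simp add: ext_deriv_def frechet_derivative_inner[OF DK] omit_def inner_diff_left)
  \<comment> \<open>The alternating sum over omitted arguments becomes cyclic once the middle term
    is turned around by skewness.\<close>
  have extL: "ext_deriv 2 (\<lambda>q Y. L q Y \<bullet> b) p Y =
      (DL (Y 0) (Y 1) (Y 2) + DL (Y 1) (Y 2) (Y 0) + DL (Y 2) (Y 0) (Y 1)) \<bullet> b" for b Y
    using DL(2)[of "Y 1" "Y 0" "Y 2"]
    by (simp add: ext_deriv_def frechet_derivative_inner[OF DL(1)] omit_def inner_add_left
        numeral_2_eq_2)
  have hookL: "hook 2 (\<lambda>_. a) (\<lambda>q Y. L q Y \<bullet> b) p Y = l a (Y 0) \<bullet> b" for a b Y
    by (simp add: hook_def l(1))
  have hookK: "hook 1 (\<lambda>_. a) (\<lambda>q Y. K q Y \<bullet> b) p Y = k a \<bullet> b" for a b Y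
    by (simp add: hook_def k)
  have DLm: "DL a x y \<bullet> b = - (DL a y x \<bullet> b)" and lm: "l x y \<bullet> b = - (l y x \<bullet> b)" for a b x y
    using DL(2)[of a x y] l(3)[of x y] by simp_all
  have e: "(1::nat) + 1 = 2" "(1::nat) - 1 = 0" "(2::nat) - 1 = 1" "(2::nat) + 1 = 3" by simp_all
  have *: "fn_decomposable 1 2 (\<lambda>q Y. K q Y \<bullet> a) (\<lambda>_. a) (\<lambda>q Y. L q Y \<bullet> b) (\<lambda>_. b) p X =
      ((k (X 0) \<bullet> a) * (DL a (X 1) (X 2) \<bullet> b)) *\<^sub>R b + ((k (X 1) \<bullet> a) * (DL a (X 2) (X 0) \<bullet> b)) *\<^sub>R b
      + ((k (X 2) \<bullet> a) * (DL a (X 0) (X 1) \<bullet> b)) *\<^sub>R b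
      - (((DK b (X 2) \<bullet> a) * (l (X 0) (X 1) \<bullet> b)) *\<^sub>R a + ((DK b (X 0) \<bullet> a) * (l (X 1) (X 2) \<bullet> b)) *\<^sub>R a
        + ((DK b (X 1) \<bullet> a) * (l (X 2) (X 0) \<bullet> b)) *\<^sub>R a)
      - ((((DK (X 0) (X 1) - DK (X 1) (X 0)) \<bullet> a) * (l a (X 2) \<bullet> b)) *\<^sub>R b
        + (((DK (X 1) (X 2) - DK (X 2) (X 1)) \<bullet> a) * (l a (X 0) \<bullet> b)) *\<^sub>R b
        + (((DK (X 2) (X 0) - DK (X 0) (X 2)) \<bullet> a) * (l a (X 1) \<bullet> b)) *\<^sub>R b)
      - ((k b \<bullet> a) * ((DL (X 0) (X 1) (X 2) + DL (X 1) (X 2) (X 0) + DL (X 2) (X 0) (X 1)) \<bullet> b)) *\<^sub>R a" for a b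
  proof -
    have 1: "wedge 1 2 (\<lambda>q Y. K q Y \<bullet> a) (lie_deriv 2 (\<lambda>_. a) (\<lambda>q Y. L q Y \<bullet> b)) p X =
        (k (X 0) \<bullet> a) * (DL a (X 1) (X 2) \<bullet> b) + (k (X 1) \<bullet> a) * (DL a (X 2) (X 0) \<bullet> b)
        + (k (X 2) \<bullet> a) * (DL a (X 0) (X 1) \<bullet> b)"
      by (rule wedge_1_2[where b = "\<lambda>x y. DL a x y \<bullet> b", OF _ _ DLm]) (simp_all only: k(1) lieL)
    have 2: "wedge 1 2 (lie_deriv 1 (\<lambda>_. b) (\<lambda>q Y. K q Y \<bullet> a)) (\<lambda>q Y. L q Y \<bullet> b) p X =
        (DK b (X 0) \<bullet> a) * (l (X 1) (X 2) \<bullet> b) + (DK b (X 1) \<bullet> a) * (l (X 2) (X 0) \<bullet> b)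
        + (DK b (X 2) \<bullet> a) * (l (X 0) (X 1) \<bullet> b)"
      by (rule wedge_1_2[where b = "\<lambda>x y. l x y \<bullet> b", OF _ _ lm]) (simp_all only: l(1) lieK)
    have 3: "wedge 2 1 (ext_deriv 1 (\<lambda>q Y. K q Y \<bullet> a)) (hook 2 (\<lambda>_. a) (\<lambda>q Y. L q Y \<bullet> b)) p X =
        ((DK (X 0) (X 1) - DK (X 1) (X 0)) \<bullet> a) * (l a (X 2) \<bullet> b)
        + ((DK (X 1) (X 2) - DK (X 2) (X 1)) \<bullet> a) * (l a (X 0) \<bullet> b)
        + ((DK (X 2) (X 0) - DK (X 0) (X 2)) \<bullet> a) * (l a (X 1) \<bullet> b)"
      by (rule wedge_2_1[where a = "\<lambda>x y. (DK x y - DK y x) \<bullet> a"])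
         (simp_all add: extK hookL inner_diff_left del: One_nat_def)
    have 4: "wedge 0 3 (hook 1 (\<lambda>_. b) (\<lambda>q Y. K q Y \<bullet> a)) (ext_deriv 2 (\<lambda>q Y. L q Y \<bullet> b)) p X =
        (k b \<bullet> a) * ((DL (X 0) (X 1) (X 2) + DL (X 1) (X 2) (X 0) + DL (X 2) (X 0) (X 1)) \<bullet> b)"
    proof (rule wedge_0_3[where b = "\<lambda>x y z. (DL x y z + DL y z x + DL z x y) \<bullet> b"])
      show "(DL x y z + DL y z x + DL z x y) \<bullet> b = - ((DL y x z + DL x z y + DL z y x) \<bullet> b)" for x y z
        using DL(2)[of x y z] DL(2)[of y z x] DL(2)[of z x y] by (simp add: inner_add_left inner_diff_left)
      show "(DL x y z + DL y z x + DL z x y) \<bullet> b = - ((DL x z y + DL z y x + DL y x z) \<bullet> b)" for x y z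
        using DL(2)[of x y z] DL(2)[of y z x] DL(2)[of z x y] by (simp add: inner_add_left inner_diff_left)
    qed (simp_all only: extL hookK)
    show ?thesis
      unfolding fn_decomposable_def e 1 2 3 4
      by (simp add: lie_bracket_def scaleR_add_left)
  qed
  show ?thesis
    unfolding fn_bracket_def *
    by (simp only: sum_subtractf sum.distrib sum_Basis_collapse[OF lin(2)]
        sum_Basis_collapse'[OF lin(1)] sum_Basis_collapse[OF l(2)] sum_Basis_collapse'[OF k(2)])
qed

section \<open>The negative eigenspace\<close>

text \<open>Contracting one lower index of a component array leaves a matrix, whose product
  \<open>*v\<close> with a base vector contracts the other. In this form the expressions are built
  from bounded bilinear maps, to which the product rule applies without indices.\<close>

definition fop :: "real^'n^'n^'m \<Rightarrow> real^'n \<Rightarrow> real^'n::finite^'m::finite" where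
  "fop F x = (\<chi> \<sigma> j. \<Sum>i\<in>UNIV. F $ \<sigma> $ i $ j * x $ i)"

definition hop :: "real^'n^'m^'m \<Rightarrow> real^'m \<Rightarrow> real^'n::finite^'m::finite" where
  "hop h b = (\<chi> \<nu> k. \<Sum>\<sigma>\<in>UNIV. h $ \<nu> $ \<sigma> $ k * b $ \<sigma>)"

definition outer :: "real^'m \<Rightarrow> real^'n \<Rightarrow> real^'n::finite^'m::finite" where
  "outer b \<psi> = (\<chi> \<sigma> i. b $ \<sigma> * \<psi> $ i)"

definition omv :: "('n::finite, 'm::finite) jcoord \<Rightarrow> ('n, 'm) jcoord \<Rightarrow> real^'m" where
  "omv p \<xi> = snd (fst \<xi>) - snd p *v fst (fst \<xi>)"

lemma bounded_bilinear_mv: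
  "bounded_bilinear ((*v) :: real^'n::finite^'m::finite \<Rightarrow> real^'n \<Rightarrow> real^'m)"
  unfolding bilinear_conv_bounded_bilinear[symmetric] bilinear_def linear_iff
  by (simp add: vec_eq_iff matrix_vector_mult_def sum.distrib sum_distrib_left algebra_simps)

lemma bounded_bilinear_fop: "bounded_bilinear fop"
  unfolding bilinear_conv_bounded_bilinear[symmetric] bilinear_def linear_iff
  by (simp add: vec_eq_iff fop_def sum.distrib sum_distrib_left algebra_simps)

lemma bounded_bilinear_hop: "bounded_bilinear hop"
  unfolding bilinear_conv_bounded_bilinear[symmetric] bilinear_def linear_iff
  by (simp add: vec_eq_iff hop_def sum.distrib sum_distrib_left algebra_simps)

lemma bounded_bilinear_outer: "bounded_bilinear outer"
  unfolding bilinear_conv_bounded_bilinear[symmetric] bilinear_def linear_iff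
  by (simp add: vec_eq_iff outer_def algebra_simps)

lemmas has_derivative_mv [derivative_intros] = bounded_bilinear.FDERIV[OF bounded_bilinear_mv]
lemmas has_derivative_fop [derivative_intros] = bounded_bilinear.FDERIV[OF bounded_bilinear_fop]
lemmas has_derivative_hop [derivative_intros] = bounded_bilinear.FDERIV[OF bounded_bilinear_hop]
lemmas has_derivative_outer [derivative_intros] = bounded_bilinear.FDERIV[OF bounded_bilinear_outer]

lemmas mv_linear_simps =
  bounded_bilinear.add_left[OF bounded_bilinear_mv] bounded_bilinear.add_right[OF bounded_bilinear_mv]
  bounded_bilinear.diff_left[OF bounded_bilinear_mv] bounded_bilinear.diff_right[OF bounded_bilinear_mv]
  bounded_bilinear.minus_left[OF bounded_bilinear_mv] bounded_bilinear.minus_right[OF bounded_bilinear_mv]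
  bounded_bilinear.scaleR_left[OF bounded_bilinear_mv] bounded_bilinear.scaleR_right[OF bounded_bilinear_mv]
  bounded_bilinear.zero_left[OF bounded_bilinear_mv] bounded_bilinear.zero_right[OF bounded_bilinear_mv]

lemmas fop_linear_simps =
  bounded_bilinear.add_left[OF bounded_bilinear_fop] bounded_bilinear.add_right[OF bounded_bilinear_fop]
  bounded_bilinear.diff_left[OF bounded_bilinear_fop] bounded_bilinear.diff_right[OF bounded_bilinear_fop]
  bounded_bilinear.minus_left[OF bounded_bilinear_fop] bounded_bilinear.minus_right[OF bounded_bilinear_fop]
  bounded_bilinear.scaleR_left[OF bounded_bilinear_fop] bounded_bilinear.scaleR_right[OF bounded_bilinear_fop]
  bounded_bilinear.zero_left[OF bounded_bilinear_fop] bounded_bilinear.zero_right[OF bounded_bilinear_fop]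

lemmas hop_linear_simps =
  bounded_bilinear.add_left[OF bounded_bilinear_hop] bounded_bilinear.add_right[OF bounded_bilinear_hop]
  bounded_bilinear.diff_left[OF bounded_bilinear_hop] bounded_bilinear.diff_right[OF bounded_bilinear_hop]
  bounded_bilinear.minus_left[OF bounded_bilinear_hop] bounded_bilinear.minus_right[OF bounded_bilinear_hop]
  bounded_bilinear.scaleR_left[OF bounded_bilinear_hop] bounded_bilinear.scaleR_right[OF bounded_bilinear_hop]
  bounded_bilinear.zero_left[OF bounded_bilinear_hop] bounded_bilinear.zero_right[OF bounded_bilinear_hop]

lemmas outer_linear_simps =
  bounded_bilinear.add_left[OF bounded_bilinear_outer] bounded_bilinear.add_right[OF bounded_bilinear_outer]
  bounded_bilinear.diff_left[OF bounded_bilinear_outer] bounded_bilinear.diff_right[OF bounded_bilinear_outer]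
  bounded_bilinear.minus_left[OF bounded_bilinear_outer] bounded_bilinear.minus_right[OF bounded_bilinear_outer]
  bounded_bilinear.scaleR_left[OF bounded_bilinear_outer] bounded_bilinear.scaleR_right[OF bounded_bilinear_outer]
  bounded_bilinear.zero_left[OF bounded_bilinear_outer] bounded_bilinear.zero_right[OF bounded_bilinear_outer]

lemma bounded_bilinear_differentiable:
  assumes "bounded_bilinear f" "g differentiable at x" "h differentiable at x"
  shows "(\<lambda>y. f (g y) (h y)) differentiable at x"
proof -
  obtain g' h' where "(g has_derivative g') (at x)" "(h has_derivative h') (at x)"
    using assms(2,3) by (auto simp: differentiable_def)
  from bounded_bilinear.FDERIV[OF assms(1) this] show ?thesis by (auto simp: differentiable_def)
qed

lemma bounded_linear_differentiable:
  assumes "bounded_linear f" "g differentiable at x"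
  shows "(\<lambda>y. f (g y)) differentiable at x"
proof -
  obtain g' where "(g has_derivative g') (at x)"
    using assms(2) by (auto simp: differentiable_def)
  from bounded_linear.has_derivative[OF assms(1) this] show ?thesis by (auto simp: differentiable_def)
qed

lemma differentiable_Pair:
  assumes "g differentiable at x" "h differentiable at x"
  shows "(\<lambda>y. (g y, h y)) differentiable at x"
proof -
  obtain g' h' where "(g has_derivative g') (at x)" "(h has_derivative h') (at x)"
    using assms by (auto simp: differentiable_def)
  from has_derivative_Pair[OF this] show ?thesis by (auto simp: differentiable_def)
qed

lemma outer_mv: "outer b \<psi> *v w = (\<psi> \<bullet> w) *\<^sub>R b"
  by (simp add: vec_eq_iff outer_def matrix_vector_mult_def inner_vec_def sum_distrib_left algebra_simps)

lemma fop_symmetric_mv: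
  assumes "\<And>\<sigma> i k. F $ \<sigma> $ i $ k = F $ \<sigma> $ k $ i"
  shows "fop F x *v y = fop F y *v x"
proof -
  have "(\<Sum>j\<in>UNIV. (\<Sum>i\<in>UNIV. F $ \<sigma> $ i $ j * x $ i) * y $ j) =
      (\<Sum>j\<in>UNIV. (\<Sum>i\<in>UNIV. F $ \<sigma> $ i $ j * y $ i) * x $ j)" for \<sigma>
    unfolding sum_distrib_right
    by (subst sum.swap) (simp add: assms[of _ "_::'b" _] algebra_simps cong: sum.cong)
  then show ?thesis
    by (simp add: vec_eq_iff fop_def matrix_vector_mult_def)
qed

lemma omega_eq_omv: "omega \<sigma> p \<xi> = omv p \<xi> $ \<sigma>"
  by (simp add: omega_def omv_def matrix_vector_mult_def)

lemma sum_Gam: "(\<Sum>i\<in>UNIV. (x $ i) *\<^sub>R Gam F i p) = ((x, snd p *v x), fop (F p) x)"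
  by (simp add: Gam_def prod_eq_iff fst_sum snd_sum vec_eq_iff matrix_vector_mult_def fop_def
      axis_def if_distrib if_distribR mult.commute cong: if_cong)

lemma sum_H_vec: "(\<Sum>\<sigma>\<in>UNIV. (b $ \<sigma>) *\<^sub>R H_vec h \<sigma>) = ((0, b), hop h b)"
  by (simp add: H_vec_def prod_eq_iff fst_sum snd_sum vec_eq_iff hop_def
      axis_def if_distrib if_distribR mult.commute cong: if_cong)

lemma S_endo_eq: "S_endo \<phi> p \<xi> = ((0, 0), outer (omv p \<xi>) (\<phi> (fst (fst p))))"
  by (simp add: S_endo_def outer_def omega_eq_omv vec_eq_iff)

lemma Gam_v_eq:
  "Gam_v F v p = ((v (fst (fst p)), snd p *v v (fst (fst p))), fop (F p) (v (fst (fst p))))"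
  unfolding Gam_v_def by (rule sum_Gam)

lemma proj_G_eq:
  "proj_G F p \<xi> = ((fst (fst \<xi>), snd p *v fst (fst \<xi>)), fop (F p) (fst (fst \<xi>)))"
  unfolding proj_G_def by (rule sum_Gam)

lemma proj_P_eq: "proj_P F \<phi> v p \<xi> = ((0, omv p \<xi>), hop (H_coeff F \<phi> v p) (omv p \<xi>))"
  unfolding proj_P_def omega_eq_omv by (rule sum_H_vec)

text \<open>\<open>psi\<close> contracts the last lower index of \<open>F\<close> and
  \<open>fop\<close> the first; the symmetry at \<open>p\<close> reconciles them.\<close>

lemma proj_Q_eq:
  assumes "\<And>\<sigma> i k. F p $ \<sigma> $ i $ k = F p $ \<sigma> $ k $ i"
  shows "proj_Q F \<phi> v p \<xi> = ((0, 0),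
    snd \<xi> - fop (F p) (fst (fst \<xi>)) - hop (H_coeff F \<phi> v p) (omv p \<xi>))"
proof -
  have "(\<Sum>i\<in>UNIV. F p $ \<nu> $ k $ i * fst (fst \<xi>) $ i) = (\<Sum>i\<in>UNIV. F p $ \<nu> $ i $ k * fst (fst \<xi>) $ i)"
    for \<nu> k
    by (rule sum.cong) (simp_all add: assms[of \<nu> k])
  then show ?thesis
    by (simp add: proj_Q_def psi_def vec_eq_iff fop_def hop_def omega_eq_omv)
qed

lemma span_range_H_vec:
  fixes h :: "real^'n::finite^'m::finite^'m"
  shows "span (range (H_vec h)) = {((0, b), hop h b) | b. True}"
proof
  let ?E = "{((0, b), hop h b) | b. True} :: ('n, 'm) jcoord set"
  show "span (range (H_vec h)) \<subseteq> ?E"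
  proof (rule span_minimal)
    show "range (H_vec h) \<subseteq> ?E"
    proof
      fix w assume "w \<in> range (H_vec h)"
      then obtain \<sigma> where "w = H_vec h \<sigma>" by auto
      then have "w = ((0, axis \<sigma> 1), hop h (axis \<sigma> 1))"
        by (simp add: H_vec_def vec_eq_iff hop_def axis_def if_distrib cong: if_cong)
      then show "w \<in> ?E" by auto
    qed
    show "subspace ?E"
    proof (rule subspaceI)
      show "0 \<in> ?E"
        by (auto simp: zero_prod_def hop_linear_simps)
    next
      fix x y :: "('n, 'm) jcoord"
      assume "x \<in> ?E" "y \<in> ?E"
      then obtain a b where "x = ((0, a), hop h a)" "y = ((0, b), hop h b)" by auto
      then have "x + y = ((0, a + b), hop h (a + b))" by (simp add: hop_linear_simps)
      then show "x + y \<in> ?E" by blast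
    next
      fix x :: "('n, 'm) jcoord" and c :: real
      assume "x \<in> ?E"
      then obtain a where "x = ((0, a), hop h a)" by auto
      then have "c *\<^sub>R x = ((0, c *\<^sub>R a), hop h (c *\<^sub>R a))" by (simp add: hop_linear_simps)
      then show "c *\<^sub>R x \<in> ?E" by blast
    qed
  qed
  show "?E \<subseteq> span (range (H_vec h))"
  proof
    fix w assume "w \<in> ?E"
    then obtain b where "w = (\<Sum>\<sigma>\<in>UNIV. (b $ \<sigma>) *\<^sub>R H_vec h \<sigma>)" unfolding sum_H_vec by auto
    then show "w \<in> span (range (H_vec h))"
      by (simp add: span_sum span_scale span_base)
  qed
qed

lemma hop_eqI:
  fixes h h' :: "real^'n::finite^'m::finite^'m"
  assumes "\<And>b. hop h b = hop h' b" shows "h = h'"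
proof -
  have "hop g (axis \<sigma> 1) $ \<nu> $ k = g $ \<nu> $ \<sigma> $ k" for g :: "real^'n^'m^'m" and \<nu> \<sigma> k
    by (simp add: hop_def axis_def if_distrib cong: if_cong)
  from this[of h] this[of h'] assms show ?thesis by (simp add: vec_eq_iff)
qed

text \<open>The span of the \<open>H_vec h \<sigma>\<close> is the graph of \<open>hop h\<close>
  over the fibre directions, and a graph determines its map. Thus the definite description in
  \<open>H_coeff\<close> has exactly one value as soon as the eigenspace is known to be such a
  graph.\<close>

lemma H_coeff_eqI:
  assumes "neg_eigenspace F \<phi> v p = {((0, b), hop h b) | b. True}"
  shows "H_coeff F \<phi> v p = h"
  unfolding H_coeff_def
proof (rule the_equality)
  show "span (range (H_vec h)) = neg_eigenspace F \<phi> v p" unfolding assms by (rule span_range_H_vec)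
next
  fix h' assume "span (range (H_vec h')) = neg_eigenspace F \<phi> v p"
  then have eq: "{((0::real^'a, b), hop h' b) | b. True} = {((0, b), hop h b) | b. True}"
    unfolding assms span_range_H_vec .
  have "hop h' b = hop h b" for b
  proof -
    have "((0::real^'a, b), hop h' b) \<in> {((0, b), hop h b) | b. True}"
      unfolding eq[symmetric] by blast
    then show ?thesis by simp
  qed
  then show "h' = h" by (rule hop_eqI)
qed

section \<open>The Lie derivative of \<open>S_endo\<close> along \<open>Gam_v\<close>\<close>

lemma has_derivative_compose_fst_fst:
  "(f has_derivative f') (at (fst (fst p))) \<Longrightarrow>
    ((\<lambda>q. f (fst (fst q))) has_derivative (\<lambda>u. f' (fst (fst u)))) (at p)"
  by (rule has_derivative_compose[where g = f and f = "\<lambda>q. fst (fst q)"])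
    (intro has_derivative_fst has_derivative_ident)

lemma Gam_v_has_derivative:
  assumes "(F has_derivative DF) (at p)" "(v has_derivative Dv) (at (fst (fst p)))"
  shows "(Gam_v F v has_derivative (\<lambda>u. let w = Dv (fst (fst u)); V = v (fst (fst p)) in
    ((w, snd p *v w + snd u *v V), fop (F p) w + fop (DF u) V))) (at p)"
proof -
  have v: "((\<lambda>q. v (fst (fst q))) has_derivative (\<lambda>u. Dv (fst (fst u)))) (at p)"
    by (rule has_derivative_compose_fst_fst) (rule assms(2))
  show ?thesis
    unfolding Gam_v_eq[abs_def] Let_def
    by (intro has_derivative_Pair has_derivative_mv has_derivative_fop v assms(1)
        has_derivative_snd has_derivative_ident)
qed

lemma S_endo_has_derivative:
  assumes "(\<phi> has_derivative D\<phi>) (at (fst (fst p)))"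
  shows "((\<lambda>q. S_endo \<phi> q \<xi>) has_derivative (\<lambda>u. ((0, 0),
    outer (omv p \<xi>) (D\<phi> (fst (fst u))) - outer (snd u *v fst (fst \<xi>)) (\<phi> (fst (fst p)))))) (at p)"
proof -
  have f: "((\<lambda>q. \<phi> (fst (fst q))) has_derivative (\<lambda>u. D\<phi> (fst (fst u)))) (at p)"
    by (rule has_derivative_compose_fst_fst) (rule assms)
  have o: "((\<lambda>q. omv q \<xi>) has_derivative (\<lambda>u. - (snd u *v fst (fst \<xi>)))) (at p)"
    unfolding omv_def by (auto intro!: derivative_eq_intros simp: mv_linear_simps)
  have "((\<lambda>q. outer (omv q \<xi>) (\<phi> (fst (fst q)))) has_derivative (\<lambda>u.
    outer (omv p \<xi>) (D\<phi> (fst (fst u))) + outer (- (snd u *v fst (fst \<xi>))) (\<phi> (fst (fst p))))) (at p)"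
    by (intro has_derivative_outer o f)
  then show ?thesis
    unfolding S_endo_eq[abs_def]
    by (intro has_derivative_Pair has_derivative_const) (simp add: outer_linear_simps)
qed

text \<open>The derivative of \<open>v\<close> disappears: values of \<open>S_endo\<close> have base
  part zero, where it contributes \<open>Dv 0\<close>, and in the other bracket it contributes a
  vector of D_\<Gamma>, on which the contact forms vanish. The component
  \<open>- omv p \<xi>\<close> comes from \<open>outer b (\<phi> x) *v v x = b\<close>, which is the
  normalisation of \<open>v\<close> against \<phi>.\<close>

lemma lie_endo_Gam_v_S_endo:
  assumes F: "(F has_derivative DF) (at p)" and v: "(v has_derivative Dv) (at x)"
    and \<phi>: "(\<phi> has_derivative D\<phi>) (at x)" and x: "x = fst (fst p)" and v\<phi>: "v x \<bullet> \<phi> x = 1"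
  shows "lie_endo (Gam_v F v) (S_endo \<phi>) p \<xi> = ((0, - omv p \<xi>),
    outer (omv p \<xi>) (D\<phi> (v x)) - outer (fop (F p) (v x) *v fst (fst \<xi>)) (\<phi> x)
    - fop (DF ((0, 0), outer (omv p \<xi>) (\<phi> x))) (v x) + outer (snd \<xi> *v v x) (\<phi> x))"
proof -
  have l0: "Dv 0 = 0" using linear_0[OF has_derivative_linear[OF v]] .
  note DG = frechet_derivative_at[OF Gam_v_has_derivative[OF F v[unfolded x]], symmetric]
  note DS = frechet_derivative_at[OF S_endo_has_derivative[OF \<phi>[unfolded x]], symmetric]
  have "\<phi> x \<bullet> v x = 1" using v\<phi> by (simp add: inner_commute)
  then show ?thesis
    unfolding lie_endo_def lie_bracket_def DG DS Let_def
    by (simp add: Gam_v_eq S_endo_eq omv_def l0 x[symmetric] outer_mv mv_linear_simps fop_linear_simps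
        outer_linear_simps)
qed

text \<open>On a vertical vector \<open>((0, b), c)\<close> the endomorphism takes the value
  \<open>((0, - b), (c v) \<otimes> \<phi> - N b)\<close> with \<open>N = neg_lift_source\<close>. So the negative eigenvalue is \<open>- 1\<close> and
  \<open>c = N b - (c v) \<otimes> \<phi>\<close>; contracting this with \<open>v\<close> gives \<open>2 (c v) = (N b) v\<close>, hence \<open>neg_lift\<close>.\<close>

definition neg_lift_source :: "(('n::finite, 'm::finite) jcoord \<Rightarrow> real^'n^'n^'m) \<Rightarrow>
    (real^'n \<Rightarrow> real^'n) \<Rightarrow> (real^'n \<Rightarrow> real^'n) \<Rightarrow> ('n, 'm) jcoord \<Rightarrow> real^'m \<Rightarrow> real^'n^'m" where
  "neg_lift_source F \<phi> v p b = fop (frechet_derivative F (at p) ((0, 0), outer b (\<phi> (fst (fst p))))) (v (fst (fst p)))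
     - outer b (frechet_derivative \<phi> (at (fst (fst p))) (v (fst (fst p))))"

definition neg_lift :: "(('n::finite, 'm::finite) jcoord \<Rightarrow> real^'n^'n^'m) \<Rightarrow>
    (real^'n \<Rightarrow> real^'n) \<Rightarrow> (real^'n \<Rightarrow> real^'n) \<Rightarrow> ('n, 'm) jcoord \<Rightarrow> real^'m \<Rightarrow> real^'n^'m" where
  "neg_lift F \<phi> v p b = neg_lift_source F \<phi> v p b - outer ((1/2) *\<^sub>R (neg_lift_source F \<phi> v p b *v v (fst (fst p)))) (\<phi> (fst (fst p)))"

lemma neg_eigenspace_eq:
  fixes F :: "('n::finite, 'm::finite) jcoord \<Rightarrow> real^'n^'n^'m"
  assumes F: "F differentiable at p" and v: "v differentiable at x"
    and \<phi>: "\<phi> differentiable at x" and x: "x = fst (fst p)" and v\<phi>: "v x \<bullet> \<phi> x = 1"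
  shows "neg_eigenspace F \<phi> v p = {((0, b), neg_lift F \<phi> v p b) | b. True}"
proof -
  define N where "N = neg_lift_source F \<phi> v p"
  note lie = lie_endo_Gam_v_S_endo[OF F[unfolded frechet_derivative_works]
      v[unfolded frechet_derivative_works] \<phi>[unfolded frechet_derivative_works] x v\<phi>]
  have l: "lie_endo (Gam_v F v) (S_endo \<phi>) p ((0, b), c) = ((0, - b), outer (c *v v x) (\<phi> x) - N b)"
    for b :: "real^'m" and c :: "real^'n^'m"
    unfolding lie
    by (simp add: omv_def mv_linear_simps outer_linear_simps N_def neg_lift_source_def x)
  have pv: "outer b (\<phi> x) *v v x = b" for b
    using v\<phi> by (simp add: outer_mv inner_commute)
  have H: "neg_lift F \<phi> v p b = N b - outer ((1/2) *\<^sub>R (N b *v v x)) (\<phi> x)" for b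
    by (simp add: neg_lift_def N_def x)
  have N0: "N 0 = 0"
    using linear_0[OF linear_frechet_derivative[OF F]]
    by (simp add: N_def neg_lift_source_def outer_linear_simps fop_linear_simps zero_prod_def)
  show ?thesis
  proof (intro equalityI subsetI)
    fix \<xi> :: "('n, 'm) jcoord" assume "\<xi> \<in> neg_eigenspace F \<phi> v p"
    then obtain \<mu> where \<mu>: "\<mu> < 0" "lie_endo (Gam_v F v) (S_endo \<phi>) p \<xi> = \<mu> *\<^sub>R \<xi>"
      by (auto simp: neg_eigenspace_def)
    obtain a b c where \<xi>: "\<xi> = ((a, b), c)" by (metis prod.collapse)
    \<comment> \<open>The values of the endomorphism have no base component, so
      \<open>\<mu> *\<^sub>R a = 0\<close> with \<open>\<mu>\<close> nonzero.\<close>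
    have "a = 0" using \<mu> unfolding lie \<xi> by (simp add: prod_eq_iff)
    then have e: "- b = \<mu> *\<^sub>R b" "outer (c *v v x) (\<phi> x) - N b = \<mu> *\<^sub>R c"
      using \<mu>(2) l[of b c] unfolding \<xi> by simp_all
    have "(\<mu> *\<^sub>R c) *v v x = c *v v x - N b *v v x"
      unfolding e(2)[symmetric] by (simp add: mv_linear_simps pv)
    then have cv: "\<mu> *\<^sub>R (c *v v x) = c *v v x - N b *v v x" by (simp add: mv_linear_simps)
    \<comment> \<open>For \<open>b \<noteq> 0\<close> the fibre component forces
      \<open>\<mu> = - 1\<close>. For \<open>b = 0\<close> it says nothing about
      \<open>\<mu>\<close>; there the contraction with \<open>v\<close> gives
      \<open>\<mu> = 1\<close> or \<open>c *v v x = 0\<close>, and \<open>c = 0\<close> follows from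
      \<open>\<mu> < 0\<close>.\<close>
    have "c = neg_lift F \<phi> v p b"
    proof (cases "b = 0")
      case True
      then have "(\<mu> - 1) *\<^sub>R (c *v v x) = 0" using cv by (simp add: N0 mv_linear_simps scaleR_diff_left)
      then have "c *v v x = 0" using \<mu>(1) by simp
      then have "\<mu> *\<^sub>R c = 0" using e(2) True by (simp add: N0 outer_linear_simps)
      then show ?thesis using \<mu>(1) True by (simp add: H N0 outer_linear_simps mv_linear_simps)
    next
      case False
      have "(\<mu> + 1) *\<^sub>R b = 0" using e(1) by (simp add: scaleR_add_left) (metis add.left_inverse)
      then have m: "\<mu> = - 1" using False by simp
      then have "2 *\<^sub>R (c *v v x) = N b *v v x" using cv by (simp add: scaleR_2 algebra_simps)
      then have "c *v v x = (1/2) *\<^sub>R (N b *v v x)" by (metis (no_types) scaleR_scaleR scaleR_one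
            nonzero_eq_divide_eq zero_neq_numeral mult.commute)
      then show ?thesis using e(2) m unfolding H by (simp add: algebra_simps)
    qed
    then show "\<xi> \<in> {((0, b), neg_lift F \<phi> v p b) | b. True}" using \<xi> \<open>a = 0\<close> by simp
  next
    fix \<xi> :: "('n, 'm) jcoord" assume "\<xi> \<in> {((0, b), neg_lift F \<phi> v p b) | b. True}"
    then obtain b where \<xi>: "\<xi> = ((0, b), neg_lift F \<phi> v p b)" by auto
    have "neg_lift F \<phi> v p b *v v x = N b *v v x - (1/2) *\<^sub>R (N b *v v x)"
      unfolding H by (simp add: mv_linear_simps pv)
    also have "\<dots> = (1/2) *\<^sub>R (N b *v v x)"
      by (simp add: vec_eq_iff)
    finally have "lie_endo (Gam_v F v) (S_endo \<phi>) p \<xi> = (-1) *\<^sub>R \<xi>"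
      unfolding \<xi> l by (simp add: H)
    then show "\<xi> \<in> neg_eigenspace F \<phi> v p"
      unfolding neg_eigenspace_def by (intro CollectI exI[of _ "-1"]) simp
  qed
qed

section \<open>The Jacobi endomorphism\<close>

text \<open>Each slice of the array is inserted by a bounded linear map \<open>E \<sigma>\<close>,
  and the array is the sum of its slices.\<close>

lemma differentiable_columns:
  fixes g :: "'m::finite \<Rightarrow> 'a::real_normed_vector \<Rightarrow> real^'n::finite^'m"
  assumes "\<And>\<sigma>. g \<sigma> differentiable at p"
  shows "(\<lambda>q. (\<chi> \<nu> \<sigma> k. g \<sigma> q $ \<nu> $ k)) differentiable at p"
proof -
  define E :: "'m \<Rightarrow> real^'n^'m \<Rightarrow> real^'n^'m^'m"
    where "E \<sigma>' M = (\<chi> \<nu> \<sigma> k. if \<sigma> = \<sigma>' then M $ \<nu> $ k else 0)" for \<sigma>' M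
  have E: "bounded_linear (E \<sigma>)" for \<sigma>
    unfolding linear_conv_bounded_linear[symmetric]
    by (rule linearI) (simp_all add: E_def vec_eq_iff)
  have "(\<lambda>q. \<Sum>\<sigma>\<in>UNIV. E \<sigma> (g \<sigma> q)) differentiable at p"
    by (intro differentiable_sum finite ballI bounded_linear_differentiable[OF E] assms)
  moreover have "(\<Sum>\<sigma>\<in>UNIV. E \<sigma> (g \<sigma> q)) = (\<chi> \<nu> \<sigma> k. g \<sigma> q $ \<nu> $ k)" for q
    by (simp add: E_def vec_eq_iff)
  ultimately show ?thesis by simp
qed

lemma hop_columns:
  assumes "linear f"
  shows "hop (\<chi> \<nu> \<sigma> k. f (axis \<sigma> 1) $ \<nu> $ k) b = f b"
proof -
  have e: "(\<Sum>\<sigma>\<in>UNIV. b $ \<sigma> *\<^sub>R axis \<sigma> 1) = b"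
    by (simp add: vec_eq_iff axis_def if_distrib cong: if_cong)
  have "f b = (\<Sum>\<sigma>\<in>UNIV. b $ \<sigma> *\<^sub>R f (axis \<sigma> 1))"
    by (simp only: linear_sum[OF assms, symmetric] linear_scale[OF assms, symmetric] e)
  then show ?thesis
    by (simp add: hop_def vec_eq_iff mult.commute)
qed

text \<open>What the computation needs to know about the connection and the base data in one fibred
  chart: \<open>S\<close> and \<open>B\<close> stand for the coordinate ranges of the jet bundle and
  of the base.\<close>

locale connection_data =
  fixes S :: "('n::finite, 'm::finite) jcoord set" and B :: "(real^'n) set"
    and F :: "('n, 'm) jcoord \<Rightarrow> real^'n^'n^'m" and \<phi> v :: "real^'n \<Rightarrow> real^'n"
  assumes S: "open S" and F: "smooth_on S F"
    and F_symmetric: "p \<in> S \<Longrightarrow> F p $ \<sigma> $ i $ k = F p $ \<sigma> $ k $ i"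
    and B: "open B" and \<phi>: "smooth_on B \<phi>" and v: "smooth_on B v"
    and v_\<phi>: "x \<in> B \<Longrightarrow> v x \<bullet> \<phi> x = 1"
    and S_B: "p \<in> S \<Longrightarrow> fst (fst p) \<in> B"
begin

abbreviation "H \<equiv> H_coeff F \<phi> v"

lemma F_differentiable: "p \<in> S \<Longrightarrow> F differentiable at p"
  by (rule smooth_on_imp_differentiable[OF F])

lemma linear_neg_lift:
  assumes "p \<in> S"
  shows "linear (neg_lift F \<phi> v p)"
proof -
  let ?D = "frechet_derivative F (at p)"
  have D: "linear ?D" by (rule linear_frechet_derivative[OF F_differentiable[OF assms]])
  have 1: "?D ((0, 0), a + b) = ?D ((0, 0), a) + ?D ((0, 0), b)" for a b
    using linear_add[OF D, of "((0, 0), a)" "((0, 0), b)"] by simp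
  have 2: "?D ((0, 0), c *\<^sub>R a) = c *\<^sub>R ?D ((0, 0), a)" for c a
    using linear_scale[OF D, of c "((0, 0), a)"] by simp
  show ?thesis
    unfolding neg_lift_def[abs_def] neg_lift_source_def[abs_def]
    by (rule linearI) (simp_all add: outer_linear_simps fop_linear_simps mv_linear_simps 1 2
        scaleR_add_right scaleR_diff_right)
qed

definition hmat :: "('n, 'm) jcoord \<Rightarrow> real^'n^'m^'m" where
  "hmat p = (\<chi> \<nu> \<sigma> k. neg_lift F \<phi> v p (axis \<sigma> 1) $ \<nu> $ k)"

lemma hop_hmat:
  assumes "p \<in> S"
  shows "hop (hmat p) b = neg_lift F \<phi> v p b"
  unfolding hmat_def by (rule hop_columns[OF linear_neg_lift[OF assms]])

lemma H_eq_hmat: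
  assumes "p \<in> S"
  shows "H p = hmat p"
proof (rule H_coeff_eqI)
  have x: "fst (fst p) \<in> B" by (rule S_B[OF assms])
  show "neg_eigenspace F \<phi> v p = {((0, b), hop (hmat p) b) | b. True}"
    unfolding hop_hmat[OF assms]
    by (rule neg_eigenspace_eq[OF F_differentiable[OF assms]
          smooth_on_imp_differentiable[OF v x] smooth_on_imp_differentiable[OF \<phi> x] refl v_\<phi>[OF x]])
qed

text \<open>\<open>neg_lift\<close> contains first derivatives of \<open>F\<close> and \<phi>, so
  its differentiability rests on second derivatives of both, in directions that move with the point.
  \<open>H\<close> agrees with \<open>hmat\<close> on the whole open set \<open>S\<close>, so the
  property passes over.\<close>

lemma H_differentiable:
  assumes p: "p \<in> S"
  shows "H differentiable at p"
proof -
  have x: "fst (fst p) \<in> B" by (rule S_B[OF assms])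
  have ff: "(\<lambda>q. fst (fst q)) differentiable at p"
    by (intro bounded_linear_differentiable[OF bounded_linear_fst] differentiable_ident)
  have c: "(\<lambda>q. f (fst (fst q))) differentiable at p" if "smooth_on B f" for f :: "real^'n \<Rightarrow> real^'n"
    using differentiable_chain_at[OF ff smooth_on_imp_differentiable[OF that x]] by (simp add: o_def)
  have N: "(\<lambda>q. neg_lift_source F \<phi> v q b) differentiable at p" for b
    unfolding neg_lift_source_def
  proof (intro differentiable_diff bounded_bilinear_differentiable[OF bounded_bilinear_fop]
      bounded_bilinear_differentiable[OF bounded_bilinear_outer] differentiable_const c[OF v]
      differentiable_frechet_derivative_apply[OF F S] differentiable_ident p
      differentiable_frechet_derivative_apply[OF \<phi> B] ff x)
    show "(\<lambda>q. ((0, 0), outer b (\<phi> (fst (fst q))))) differentiable at p"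
      by (intro differentiable_Pair differentiable_const c[OF \<phi>]
          bounded_bilinear_differentiable[OF bounded_bilinear_outer])
  qed
  have "(\<lambda>q. neg_lift F \<phi> v q b) differentiable at p" for b
    unfolding neg_lift_def
    by (intro differentiable_diff N bounded_bilinear_differentiable[OF bounded_bilinear_outer]
        bounded_linear_differentiable[OF bounded_linear_scaleR_right]
        bounded_bilinear_differentiable[OF bounded_bilinear_mv] c v \<phi>)
  then have "hmat differentiable at p"
    unfolding hmat_def[abs_def] by (rule differentiable_columns)
  then show ?thesis
    by (rule differentiable_cong_open[OF _ H_eq_hmat S p])
qed

lemma proj_Q:
  "p \<in> S \<Longrightarrow> proj_Q F \<phi> v p \<xi> = ((0, 0), snd \<xi> - fop (F p) (fst (fst \<xi>)) - hop (H p) (omv p \<xi>))"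
  by (rule proj_Q_eq[OF F_symmetric])

text \<open>This is the vector \<open>x\<^sup>i \<Gamma>\<^sub>i\<close> at \<open>p\<close>;
  likewise \<open>H_lift p b\<close> is \<open>b\<^sup>\<sigma> H\<^sub>\<sigma>\<close>.\<close>

definition Gam_lift :: "('n, 'm) jcoord \<Rightarrow> real^'n \<Rightarrow> ('n, 'm) jcoord" where
  "Gam_lift p x = ((x, snd p *v x), fop (F p) x)"

definition H_lift :: "('n, 'm) jcoord \<Rightarrow> real^'m \<Rightarrow> ('n, 'm) jcoord" where
  "H_lift p b = ((0, b), hop (H p) b)"

text \<open>The value \<open>\<Phi>\<^sup>\<nu>\<^sub>i\<^sub>\<sigma>\<^sub>k x\<^sup>i b\<^sup>\<sigma>\<close> of the Jacobi endomorphism.\<close>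

definition Jac :: "('n, 'm) jcoord \<Rightarrow> real^'n \<Rightarrow> real^'m \<Rightarrow> real^'n^'m" where
  "Jac p x b = hop (frechet_derivative H (at p) (Gam_lift p x)) b
     - fop (frechet_derivative F (at p) (H_lift p b)) x + hop (H p) (hop (H p) b *v x)"

text \<open>The projector \<open>proj_Q\<close> kills D_\<Gamma> and H, the images of the other two
  projectors. Of the six terms of the bracket only the derivatives of \<open>proj_P\<close> along
  D_\<Gamma> and of \<open>proj_G\<close> along H remain, each for both orders of the
  arguments.\<close>

lemma jacobi_endo_eq:
  assumes p: "p \<in> S"
  shows "jacobi_endo F \<phi> v p X = ((0, 0),
    Jac p (fst (fst (X 0))) (omv p (X 1)) - Jac p (fst (fst (X 1))) (omv p (X 0)))"
proof -
  define DF where "DF = frechet_derivative F (at p)"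
  define DH where "DH = frechet_derivative H (at p)"
  have DF: "(F has_derivative DF) (at p)"
    using F_differentiable[OF p] by (simp add: DF_def frechet_derivative_works)
  have DH: "(H has_derivative DH) (at p)"
    using H_differentiable[OF p] by (simp add: DH_def frechet_derivative_works)
  define k where "k \<xi> = Gam_lift p (fst (fst \<xi>))" for \<xi> :: "('n, 'm) jcoord"
  define l where "l \<xi> = H_lift p (omv p \<xi>)" for \<xi> :: "('n, 'm) jcoord"
  define DK where "DK u \<xi> = (((0, snd u *v fst (fst \<xi>)), fop (DF u) (fst (fst \<xi>))) :: ('n, 'm) jcoord)"
    for u \<xi> :: "('n, 'm) jcoord"
  define DL where "DL u \<xi> = (((0, - (snd u *v fst (fst \<xi>))),
      hop (DH u) (omv p \<xi>) - hop (H p) (snd u *v fst (fst \<xi>))) :: ('n, 'm) jcoord)"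
    for u \<xi> :: "('n, 'm) jcoord"
  have lin: "linear k" "linear l"
    unfolding k_def[abs_def] l_def[abs_def] Gam_lift_def H_lift_def omv_def
    by (rule linearI; simp add: mv_linear_simps fop_linear_simps hop_linear_simps algebra_simps)+
  have DK: "((\<lambda>q. proj_G F q \<xi>) has_derivative (\<lambda>u. DK u \<xi>)) (at p)" for \<xi>
    unfolding proj_G_eq DK_def
    by (auto intro!: derivative_eq_intros DF simp: mv_linear_simps fop_linear_simps)
  have DL: "((\<lambda>q. proj_P F \<phi> v q \<xi>) has_derivative (\<lambda>u. DL u \<xi>)) (at p)" for \<xi>
    unfolding proj_P_eq DL_def omv_def
    by (auto intro!: derivative_eq_intros DH simp: mv_linear_simps hop_linear_simps)
  have K': "endo_form (proj_G F) p Y = k (Y 0)" "endo_form (proj_P F \<phi> v) p Y = l (Y 0)" for Y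
    by (simp_all add: endo_form_def k_def l_def Gam_lift_def H_lift_def proj_G_eq proj_P_eq)
  have DK': "((\<lambda>q. endo_form (proj_G F) q Y) has_derivative (\<lambda>u. DK u (Y 0))) (at p)"
    and DL': "((\<lambda>q. endo_form (proj_P F \<phi> v) q Y) has_derivative (\<lambda>u. DL u (Y 0))) (at p)" for Y
    unfolding endo_form_def by (rule DK DL)+
  note br = fn_bracket_1_1[where K = "endo_form (proj_G F)" and k = k and DK = DK
      and L = "endo_form (proj_P F \<phi> v)" and l = l and DL = DL, OF K'(1) lin(1) DK' K'(2) lin(2) DL']
  define q where "q \<xi> = snd \<xi> - fop (F p) (fst (fst \<xi>)) - hop (H p) (omv p \<xi>)"
    for \<xi> :: "('n, 'm) jcoord"
  have q: "q (\<xi> + \<zeta>) = q \<xi> + q \<zeta>" "q (\<xi> - \<zeta>) = q \<xi> - q \<zeta>" for \<xi> \<zeta>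
    by (simp_all add: q_def omv_def mv_linear_simps fop_linear_simps hop_linear_simps algebra_simps)
  have qk: "q (k \<xi>) = 0" and ql: "q (l \<xi>) = 0" for \<xi>
    by (simp_all add: q_def k_def l_def Gam_lift_def H_lift_def omv_def mv_linear_simps
        fop_linear_simps hop_linear_simps)
  have qDL: "q (DL (k \<xi>) \<zeta>) = hop (DH (Gam_lift p (fst (fst \<xi>)))) (omv p \<zeta>)" for \<xi> \<zeta>
    by (simp add: q_def DL_def k_def omv_def[of p "((_, _), _)"] mv_linear_simps
        fop_linear_simps hop_linear_simps)
  \<comment> \<open>The derivative of \<open>proj_G\<close> along H has a fibre component; removing
    the corresponding vector of H produces the term of Phi that is quadratic in
    \<open>H\<close>.\<close>
  have qDK: "q (DK (l \<xi>) \<zeta>) = fop (DF (H_lift p (omv p \<xi>))) (fst (fst \<zeta>))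
      - hop (H p) (hop (H p) (omv p \<xi>) *v fst (fst \<zeta>))" for \<xi> \<zeta>
    by (simp add: q_def DK_def l_def omv_def[of p "((_, _), _)"] H_lift_def mv_linear_simps
        fop_linear_simps hop_linear_simps)
  show ?thesis
    unfolding jacobi_endo_def proj_Q[OF p] q_def[symmetric] br q qk ql qDL qDK Jac_def
      DF_def[symmetric] DH_def[symmetric]
    by (simp add: algebra_simps)
qed

end

section \<open>The total shape operator of an embedded connection\<close>

lemma has_derivative_unique_on_open:
  fixes f g :: "'a::real_normed_vector \<Rightarrow> real"
  assumes "open S" "p \<in> S" "\<And>q. q \<in> S \<Longrightarrow> f q = g q"
    and "(f has_derivative f') (at p)" "(g has_derivative g') (at p)"
  shows "f' = g'"
proof -
  have "(g has_derivative f') (at p)"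
    by (rule has_derivative_transform_within_open[OF assms(4,1,2)]) (rule assms(3))
  then show ?thesis using assms(5) by (rule has_derivative_unique)
qed

lemma has_derivative_vec_nth3:
  "(f has_derivative f') F \<Longrightarrow> ((\<lambda>q. f q $ i $ j $ k) has_derivative (\<lambda>u. f' u $ i $ j $ k)) F"
  by (intro bounded_linear.has_derivative[OF bounded_linear_vec_nth])

lemma sum_Zvec: "(\<Sum>i\<in>UNIV. (x $ i) *\<^sub>R Zvec z i a) = (x, z a *v x)"
  by (simp add: Zvec_def prod_eq_iff fst_sum snd_sum vec_eq_iff matrix_vector_mult_def
      axis_def if_distrib if_distribR mult.commute cong: if_cong)

lemma span_range_Gam:
  assumes "w \<in> span (range (\<lambda>i. Gam F i p))"
  shows "w = ((fst (fst w), snd p *v fst (fst w)), fop (F p) (fst (fst w)))"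
  using assms
proof (induction rule: span_induct_alt)
  case base
  then show ?case by (simp add: zero_prod_def mv_linear_simps fop_linear_simps)
next
  case (step c x y)
  then obtain i where x: "x = Gam F i p" by auto
  have "x = ((fst (fst x), snd p *v fst (fst x)), fop (F p) (fst (fst x)))"
    unfolding x by (simp add: Gam_def vec_eq_iff matrix_vector_mult_def fop_def axis_def
        if_distrib cong: if_cong)
  then have "c *\<^sub>R x + y = ((c *\<^sub>R fst (fst x) + fst (fst y), c *\<^sub>R (snd p *v fst (fst x)) + snd p *v fst (fst y)),
      c *\<^sub>R fop (F p) (fst (fst x)) + fop (F p) (fst (fst y)))"
    using step(2) by (metis (no_types, lifting) scaleR_Pair add_Pair)
  then show ?case by (simp add: mv_linear_simps fop_linear_simps)
qed

lemma (in connection_data) DF_symmetric: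
  assumes p: "p \<in> S"
  shows "fop (frechet_derivative F (at p) u) x *v y = fop (frechet_derivative F (at p) u) y *v x"
proof (rule fop_symmetric_mv)
  fix \<sigma> i k
  have D: "(F has_derivative frechet_derivative F (at p)) (at p)"
    using F_differentiable[OF p] by (simp add: frechet_derivative_works)
  have "(\<lambda>u. frechet_derivative F (at p) u $ \<sigma> $ i $ k) = (\<lambda>u. frechet_derivative F (at p) u $ \<sigma> $ k $ i)"
    by (rule has_derivative_unique_on_open[OF S p F_symmetric
          has_derivative_vec_nth3[OF D] has_derivative_vec_nth3[OF D]])
  then show "frechet_derivative F (at p) u $ \<sigma> $ i $ k = frechet_derivative F (at p) u $ \<sigma> $ k $ i"
    by (rule fun_cong)
qed

locale embedded_connection = connection_data S B F \<phi> v
  for S :: "('n::finite, 'm::finite) jcoord set" and B :: "(real^'n) set"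
    and F :: "('n, 'm) jcoord \<Rightarrow> real^'n^'n^'m" and \<phi> v :: "real^'n \<Rightarrow> real^'n" +
  fixes U :: "('n, 'm) ycoord set" and z :: "('n, 'm) ycoord \<Rightarrow> real^'n^'m"
  assumes U: "open U" and z: "smooth_on U z"
    and graph: "a \<in> U \<Longrightarrow> (a, z a) \<in> S"
    and tangent: "a \<in> U \<Longrightarrow> tangent_Z z a ` dist_Z z a \<subseteq> dist_Gam F (a, z a)"
begin

abbreviation "Dz a \<equiv> frechet_derivative z (at a)"

definition obv :: "('n, 'm) ycoord \<Rightarrow> ('n, 'm) ycoord \<Rightarrow> real^'m" where
  "obv a w = snd w - z a *v fst w"

lemma Dz: "a \<in> U \<Longrightarrow> (z has_derivative Dz a) (at a)"
  using smooth_on_imp_differentiable[OF z] by (simp add: frechet_derivative_works)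

lemma linear_Dz: "a \<in> U \<Longrightarrow> linear (Dz a)"
  using has_derivative_linear[OF Dz] .

lemma tangent_Z: "a \<in> U \<Longrightarrow> tangent_Z z a w = (w, Dz a w)"
  unfolding tangent_Z_def
  by (subst frechet_derivative_at[OF has_derivative_Pair[OF has_derivative_ident Dz], symmetric]) auto

lemma omv_tangent: "omv (a, z a) (w, c) = obv a w"
  by (simp add: omv_def obv_def)

text \<open>A vector of D_\<Gamma> is determined by its base part, so the inclusion of TZ(D_Z) in
  D_\<Gamma> fixes the derivative of \<open>z\<close> along horizontal vectors. In components these
  are the equations \<open>Z\<^sub>i(Z\<^sup>\<sigma>\<^sub>k) = F\<^sup>\<sigma>\<^sub>i\<^sub>k
  \<circ> Z\<close>.\<close>

lemma Dz_horizontal: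
  assumes a: "a \<in> U"
  shows "Dz a (x, z a *v x) = fop (F (a, z a)) x"
proof -
  have "(x, z a *v x) \<in> dist_Z z a"
    unfolding dist_Z_def sum_Zvec[symmetric] by (intro span_sum span_scale span_base) simp
  then have "tangent_Z z a (x, z a *v x) \<in> dist_Gam F (a, z a)"
    using tangent[OF a] by blast
  from span_range_Gam[OF this[unfolded dist_Gam_def]] show ?thesis
    by (simp add: tangent_Z[OF a])
qed

definition Bmat :: "('n, 'm) ycoord \<Rightarrow> real^'n^'m^'m" where
  "Bmat q = (\<chi> \<nu> \<sigma> k. Dz q (0, axis \<sigma> 1) $ \<nu> $ k)"

definition Amat :: "('n, 'm) ycoord \<Rightarrow> real^'n^'m^'m" where
  "Amat q = Bmat q - H (q, z q)"

lemma hop_Bmat: "a \<in> U \<Longrightarrow> hop (Bmat a) b = Dz a (0, b)"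
  unfolding Bmat_def
proof (rule hop_columns)
  assume a: "a \<in> U"
  have "Dz a (0, x + y) = Dz a (0, x) + Dz a (0, y)" for x y
    using linear_add[OF linear_Dz[OF a], of "(0, x)" "(0, y)"] by simp
  moreover have "Dz a (0, c *\<^sub>R x) = c *\<^sub>R Dz a (0, x)" for x c
    using linear_scale[OF linear_Dz[OF a], of c "(0, x)"] by simp
  ultimately show "linear (\<lambda>b. Dz a (0, b))" by (rule linearI)
qed

lemma Dz_eq:
  assumes a: "a \<in> U"
  shows "Dz a w = fop (F (a, z a)) (fst w) + hop (Bmat a) (obv a w)"
proof -
  have "Dz a w = Dz a ((fst w, z a *v fst w) + (0, obv a w))"
    by (simp add: obv_def)
  also have "\<dots> = Dz a (fst w, z a *v fst w) + Dz a (0, obv a w)"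
    by (rule linear_add[OF linear_Dz[OF a]])
  finally show ?thesis by (simp only: Dz_horizontal[OF a] hop_Bmat[OF a])
qed

lemma A_coeff_eq:
  assumes a: "a \<in> U"
  shows "A_coeff F \<phi> v z \<sigma> \<nu> i a = Amat a $ \<sigma> $ \<nu> $ i"
proof -
  have "((\<lambda>q. z q $ \<sigma> $ i) has_derivative (\<lambda>u. Dz a u $ \<sigma> $ i)) (at a)"
    by (intro bounded_linear.has_derivative[OF bounded_linear_vec_nth] Dz a)
  from frechet_derivative_at[OF this, symmetric] show ?thesis
    by (simp add: A_coeff_def Amat_def Bmat_def dy_vec_def)
qed

definition Lform :: "('n, 'm) ycoord \<Rightarrow> ('n, 'm) ycoord \<Rightarrow> ('n, 'm) ycoord \<Rightarrow> ('n, 'm) ycoord" where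
  "Lform a X Y = (0, hop (Amat a) (obv a Y) *v fst X - hop (Amat a) (obv a X) *v fst Y)"

text \<open>On a vector tangent to the graph, \<open>proj_Q\<close> subtracts from
  \<open>Dz a w\<close> its horizontal part and then \<open>H\<close> applied to the contact part;
  by \<open>Dz_eq\<close> the difference of \<open>Bmat\<close> and \<open>H\<close> is
  left.\<close>

lemma total_shape_eq:
  assumes a: "a \<in> U"
  shows "total_shape F \<phi> v z a X = Lform a (X 0) (X 1)"
proof -
  have Q: "proj_Q F \<phi> v (a, z a) (tangent_Z z a w) = ((0, 0), hop (Amat a) (obv a w))" for w
    by (simp add: proj_Q[OF graph[OF a]] tangent_Z[OF a] omv_tangent Dz_eq[OF a, of w] Amat_def
        hop_linear_simps)
  have s: "s_hat ((0, 0), M) w = (0, M *v fst w)" for M :: "real^'n^'m" and w :: "('n, 'm) ycoord"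
    by (simp add: s_hat_def matrix_vector_mult_def vec_eq_iff)
  show ?thesis
    by (simp add: total_shape_def Z_wedge_def endo_form_def omit_def Q s Lform_def)
qed

lemma linear_obv: "linear (obv a)"
  unfolding obv_def by (rule linearI) (simp_all add: mv_linear_simps algebra_simps)

lemma linear_Lform: "linear (\<lambda>X. Lform a X Y)"
  unfolding Lform_def
  by (rule linearI) (simp_all add: linear_add[OF linear_obv] linear_scale[OF linear_obv]
      mv_linear_simps hop_linear_simps algebra_simps)

lemma Lform_skew: "Lform a X Y = - Lform a Y X"
  by (simp add: Lform_def)

lemma A2_eq:
  assumes a: "a \<in> U"
  shows "(1/4) *\<^sub>R nr_bracket 2 2 (total_shape F \<phi> v z) (total_shape F \<phi> v z) a X =
    (0, hop (Amat a) (snd (Lform a (X 0) (X 1))) *v fst (X 2)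
      + hop (Amat a) (snd (Lform a (X 1) (X 2))) *v fst (X 0)
      + hop (Amat a) (snd (Lform a (X 2) (X 0))) *v fst (X 1))"
proof -
  \<comment> \<open>A value of \<open>Lform\<close> has no base part and is its own vertical part,
    so one of the two terms of the outer \<open>Lform\<close> vanishes.\<close>
  have L: "Lform a (Lform a x y) w = (0, - (hop (Amat a) (snd (Lform a x y)) *v fst w))" for x y w
    by (simp add: Lform_def[of a "Lform a x y"]) (simp add: Lform_def obv_def mv_linear_simps)
  have "insertion 2 2 (total_shape F \<phi> v z) (total_shape F \<phi> v z) a X =
    Lform a (Lform a (X 0) (X 1)) (X 2) + Lform a (Lform a (X 1) (X 2)) (X 0)
    + Lform a (Lform a (X 2) (X 0)) (X 1)"
    by (rule insertion_2_2[where K = "total_shape F \<phi> v z" and L = "total_shape F \<phi> v z"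
          and k = "Lform a" and l = "Lform a",
          OF total_shape_eq[OF a] total_shape_eq[OF a] Lform_skew linear_neg[OF linear_Lform]])
  \<comment> \<open>For degrees \<open>2\<close> and \<open>2\<close> the exponent \<open>9\<close>
    is odd, so the bracket is \<open>-2\<close> times twice the insertion, and the factor
    \<open>1/4\<close> leaves \<open>-1\<close>.\<close>
  moreover have "(1/4) *\<^sub>R nr_bracket 2 2 K K a X = - insertion 2 2 K K a X"
    for K :: "(('n, 'm) ycoord, ('n, 'm) ycoord) form"
    by (simp add: nr_bracket_def scaleR_2[symmetric])
  ultimately show ?thesis by (simp add: L)
qed

lemma Z_wedge_jacobi_eq:
  assumes a: "a \<in> U"
  defines "J \<equiv> Jac (a, z a)"
  shows "Z_wedge 2 z (jacobi_endo F \<phi> v) a X =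
    (0, - ((J (fst (X 1)) (obv a (X 2)) - J (fst (X 2)) (obv a (X 1))) *v fst (X 0))
      + (J (fst (X 0)) (obv a (X 2)) - J (fst (X 2)) (obv a (X 0))) *v fst (X 1)
      - (J (fst (X 0)) (obv a (X 1)) - J (fst (X 1)) (obv a (X 0))) *v fst (X 2))"
proof -
  have s: "s_hat ((0, 0), M) w = (0, M *v fst w)" for M :: "real^'n^'m" and w :: "('n, 'm) ycoord"
    by (simp add: s_hat_def matrix_vector_mult_def vec_eq_iff)
  have "{..2::nat} = {0, 1, 2}" by auto
  then show ?thesis
    by (simp add: Z_wedge_def jacobi_endo_eq[OF graph[OF a]] omit_def tangent_Z[OF a] omv_tangent
        s J_def Suc_1 One_nat_def[symmetric] del: One_nat_def)
qed

section \<open>The derivative of A along the connection\<close>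

lemma has_derivative_graph:
  "a \<in> U \<Longrightarrow> ((\<lambda>q. (q, z q)) has_derivative (\<lambda>u. (u, Dz a u))) (at a)"
  by (intro has_derivative_Pair has_derivative_ident Dz)

lemma has_derivative_on_graph:
  assumes a: "a \<in> U" and f: "f differentiable at (a, z a)"
  shows "((\<lambda>q. f (q, z q)) has_derivative (\<lambda>u. frechet_derivative f (at (a, z a)) (u, Dz a u))) (at a)"
  by (rule has_derivative_compose[where g = f, OF has_derivative_graph[OF a]])
    (use f in \<open>simp add: frechet_derivative_works\<close>)

lemma Bmat_differentiable: "a \<in> U \<Longrightarrow> Bmat differentiable at a"
  unfolding Bmat_def[abs_def]
  by (rule differentiable_columns) (rule smooth_on_imp_differentiable[OF smooth_on_frechet_derivative[OF z]])

abbreviation "DB a \<equiv> frechet_derivative Bmat (at a)"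
abbreviation "DA a \<equiv> frechet_derivative Amat (at a)"

lemma Bmat_has_derivative: "a \<in> U \<Longrightarrow> (Bmat has_derivative DB a) (at a)"
  using Bmat_differentiable by (simp add: frechet_derivative_works)

lemma Amat_has_derivative':
  assumes a: "a \<in> U"
  shows "(Amat has_derivative (\<lambda>u. DB a u - frechet_derivative H (at (a, z a)) (u, Dz a u))) (at a)"
  unfolding Amat_def[abs_def]
  by (intro has_derivative_diff Bmat_has_derivative has_derivative_on_graph H_differentiable graph a)

lemma DA_eq: "a \<in> U \<Longrightarrow> DA a u = DB a u - frechet_derivative H (at (a, z a)) (u, Dz a u)"
  using fun_cong[OF frechet_derivative_at[OF Amat_has_derivative'], of a u] by simp

lemma Amat_has_derivative: "a \<in> U \<Longrightarrow> (Amat has_derivative DA a) (at a)"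
  unfolding frechet_derivative_works[symmetric]
  using Amat_has_derivative' by (rule differentiableI)

lemma hop_DB:
  assumes a: "a \<in> U"
  shows "hop (DB a u) b = frechet_derivative (\<lambda>q. Dz q (0, b)) (at a) u"
proof -
  have "((\<lambda>q. hop (Bmat q) b) has_derivative (\<lambda>u. hop (DB a u) b)) (at a)"
    using Bmat_has_derivative[OF a] by (auto intro!: derivative_eq_intros simp: hop_linear_simps)
  then have "((\<lambda>q. Dz q (0, b)) has_derivative (\<lambda>u. hop (DB a u) b)) (at a)"
    by (rule has_derivative_transform_within_open[OF _ U a]) (rule hop_Bmat)
  from frechet_derivative_at[OF this] show ?thesis by (rule fun_cong)
qed

text \<open>Differentiating the equation \<open>Z\<^sub>i(Z\<^sup>\<sigma>\<^sub>k) = F\<^sup>\<sigma>\<^sub>i\<^sub>k \<circ> Z\<close> in the direction \<open>\<partial>/\<partial>y\<^sup>\<rho>\<close> and exchanging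
  the derivatives.\<close>

lemma hop_DB_horizontal:
  assumes a: "a \<in> U"
  shows "hop (DB a (x, z a *v x)) b =
    fop (frechet_derivative F (at (a, z a)) ((0, b), hop (Bmat a) b)) x - hop (Bmat a) (hop (Bmat a) b *v x)"
proof -
  \<comment> \<open>The horizontal direction \<open>(x, z q *v x)\<close> moves with
    \<open>q\<close>. With \<open>c\<close> frozen at \<open>a\<close> it splits into the fixed
    direction \<open>(x, c)\<close>, to which the symmetry of second derivatives applies, and a
    vertical remainder that vanishes at \<open>a\<close> and whose derivative yields the term
    quadratic in \<open>Bmat\<close>.\<close>
  define c where "c = z a *v x"
  define f where "f q = Dz q (x, c) + hop (Bmat q) (z q *v x - c)" for q
  have f: "f q = fop (F (q, z q)) x" if "q \<in> U" for q
  proof -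
    have "f q = Dz q (x, c) + Dz q (0, z q *v x - c)" by (simp add: f_def hop_Bmat[OF that])
    also have "\<dots> = Dz q ((x, c) + (0, z q *v x - c))" by (rule linear_add[OF linear_Dz[OF that], symmetric])
    finally show ?thesis by (simp add: Dz_horizontal[OF that])
  qed
  have "((\<lambda>q. Dz q (x, c)) has_derivative frechet_derivative (\<lambda>q. Dz q (x, c)) (at a)) (at a)"
    using smooth_on_imp_differentiable[OF smooth_on_frechet_derivative[OF z] a]
    by (simp add: frechet_derivative_works)
  then have "(f has_derivative (\<lambda>u. frechet_derivative (\<lambda>q. Dz q (x, c)) (at a) u
      + (hop (Bmat a) (Dz a u *v x) + hop (DB a u) (z a *v x - c)))) (at a)"
    unfolding f_def[abs_def] using Bmat_has_derivative[OF a] Dz[OF a]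
    by (auto intro!: derivative_eq_intros simp: mv_linear_simps)
  moreover have "(f has_derivative (\<lambda>u. fop (frechet_derivative F (at (a, z a)) (u, Dz a u)) x)) (at a)"
  proof -
    have "((\<lambda>q. fop (F (q, z q)) x) has_derivative (\<lambda>u. fop (frechet_derivative F (at (a, z a)) (u, Dz a u)) x)) (at a)"
      using has_derivative_on_graph[OF a F_differentiable[OF graph[OF a]]]
      by (auto intro!: derivative_eq_intros simp: fop_linear_simps)
    then show ?thesis
      by (rule has_derivative_transform_within_open[OF _ U a]) (rule f[symmetric])
  qed
  ultimately have "(\<lambda>u. frechet_derivative (\<lambda>q. Dz q (x, c)) (at a) u
      + (hop (Bmat a) (Dz a u *v x) + hop (DB a u) (z a *v x - c))) =
      (\<lambda>u. fop (frechet_derivative F (at (a, z a)) (u, Dz a u)) x)"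
    by (rule has_derivative_unique)
  from fun_cong[OF this, of "(0, b)"]
  have "frechet_derivative (\<lambda>q. Dz q (x, c)) (at a) (0, b) + hop (Bmat a) (hop (Bmat a) b *v x) =
      fop (frechet_derivative F (at (a, z a)) ((0, b), hop (Bmat a) b)) x"
    by (simp add: c_def hop_Bmat[OF a, symmetric] hop_linear_simps)
  moreover have "hop (DB a (x, c)) b = frechet_derivative (\<lambda>q. Dz q (x, c)) (at a) (0, b)"
    unfolding hop_DB[OF a] by (rule second_derivative_symmetric[OF z U a])
  ultimately show ?thesis by (simp add: c_def algebra_simps)
qed

text \<open>The derivative of \<open>Amat\<close> along a horizontal vector contains a derivative of
  \<open>F\<close>; by \<open>DF_symmetric\<close> the part skew in \<open>x\<close> and
  \<open>y\<close> is free of it, and the bracket contains only this part.\<close>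

lemma hop_DA_skew:
  assumes a: "a \<in> U"
  defines "DH x \<equiv> frechet_derivative H (at (a, z a)) (Gam_lift (a, z a) x)"
  shows "hop (DA a (x, z a *v x)) b *v y - hop (DA a (y, z a *v y)) b *v x =
    - (hop (Bmat a) (hop (Bmat a) b *v x) *v y) + hop (Bmat a) (hop (Bmat a) b *v y) *v x
    - hop (DH x) b *v y + hop (DH y) b *v x"
proof -
  have "hop (DA a (x, z a *v x)) b = fop (frechet_derivative F (at (a, z a)) ((0, b), hop (Bmat a) b)) x
    - hop (Bmat a) (hop (Bmat a) b *v x) - hop (DH x) b" for x
    by (simp add: DA_eq[OF a] hop_linear_simps hop_DB_horizontal[OF a] Dz_horizontal[OF a] DH_def Gam_lift_def)
  then show ?thesis
    using DF_symmetric[OF graph[OF a], of "((0, b), hop (Bmat a) b)" x y]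
    by (simp add: mv_linear_simps)
qed

lemma total_shape_has_derivative:
  assumes a: "a \<in> U"
  shows "((\<lambda>q. total_shape F \<phi> v z q X) has_derivative (\<lambda>u.
    (0, (hop (DA a u) (obv a (X 1)) - hop (Amat a) (Dz a u *v fst (X 1))) *v fst (X 0)
      - (hop (DA a u) (obv a (X 0)) - hop (Amat a) (Dz a u *v fst (X 0))) *v fst (X 1)))) (at a)"
proof -
  have o: "((\<lambda>q. obv q w) has_derivative (\<lambda>u. - (Dz a u *v fst w))) (at a)" for w
    unfolding obv_def using Dz[OF a] by (auto intro!: derivative_eq_intros simp: mv_linear_simps)
  have h: "((\<lambda>q. hop (Amat q) (obv q w) *v y) has_derivative
      (\<lambda>u. (hop (DA a u) (obv a w) - hop (Amat a) (Dz a u *v fst w)) *v y)) (at a)" for w y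
    using has_derivative_mv[OF has_derivative_hop[OF Amat_has_derivative[OF a] o[of w]] has_derivative_const[of y]]
    by (simp add: mv_linear_simps hop_linear_simps)
  have "((\<lambda>q. Lform q (X 0) (X 1)) has_derivative (\<lambda>u.
    (0, (hop (DA a u) (obv a (X 1)) - hop (Amat a) (Dz a u *v fst (X 1))) *v fst (X 0)
      - (hop (DA a u) (obv a (X 0)) - hop (Amat a) (Dz a u *v fst (X 0))) *v fst (X 1)))) (at a)"
    unfolding Lform_def by (intro has_derivative_Pair has_derivative_const has_derivative_diff h)
  then show ?thesis
    by (rule has_derivative_transform_within_open[OF _ U a]) (rule total_shape_eq[symmetric])
qed

text \<open>The derivatives of the shape operator are vertical, so \<open>k\<close> kills the last
  term of the bracket. The expression A^2 then occurs three times: with sign \<open>-1\<close> from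
  each of the two kinds of terms containing \<open>DK\<close>, and with sign \<open>1\<close> from
  the derivative of \<open>Amat\<close>. The mixed products of A and H in that derivative cancel
  those of the \<open>DK\<close> terms, and the derivative of \<open>H\<close> with the products of
  H with itself makes up the contribution of Phi.\<close>

lemma fn_bracket_total_shape_eq:
  assumes a: "a \<in> U"
  shows "fn_bracket 1 2 (conn_form z) (total_shape F \<phi> v z) a X =
    - ((1/4) *\<^sub>R nr_bracket 2 2 (total_shape F \<phi> v z) (total_shape F \<phi> v z) a X)
    - Z_wedge 2 z (jacobi_endo F \<phi> v) a X"
proof -
  define A where "A = hop (Amat a)"
  define h where "h = hop (H (a, z a))"
  define f where "f = fop (F (a, z a))"
  define k where "k w = (fst w, z a *v fst w)" for w :: "('n, 'm) ycoord"
  define DK where "DK u w = ((0, Dz a u *v fst w) :: ('n, 'm) ycoord)" for u w :: "('n, 'm) ycoord"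
  define D where "D x = hop (DA a (x, z a *v x))" for x
  define DL where "DL u X Y = ((0, (hop (DA a u) (obv a Y) - A (Dz a u *v fst Y)) *v fst X
      - (hop (DA a u) (obv a X) - A (Dz a u *v fst X)) *v fst Y) :: ('n, 'm) ycoord)"
    for u X Y :: "('n, 'm) ycoord"
  have B: "hop (Bmat a) b = A b + h b" for b
    by (simp add: A_def h_def Amat_def hop_linear_simps)
  have Dz': "Dz a w = f (fst w) + (A (obv a w) + h (obv a w))" for w
    using Dz_eq[OF a] by (simp add: B f_def)
  have f: "f x *v y = f y *v x" for x y
    unfolding f_def by (rule fop_symmetric_mv) (rule F_symmetric[OF graph[OF a]])
  have A: "A (b + c) = A b + A c" "A (b - c) = A b - A c" "A (- b) = - A b" for b c
    by (simp_all add: A_def hop_linear_simps)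
  have h: "h (b + c) = h b + h c" "h (b - c) = h b - h c" "h (- b) = - h b" for b c
    by (simp_all add: h_def hop_linear_simps)
  have K: "conn_form z a Y = k (Y 0)" for Y
    unfolding conn_form_def k_def by (rule sum_Zvec)
  have k: "linear k"
    by (rule linearI) (simp_all add: k_def mv_linear_simps)
  have DK: "((\<lambda>q. conn_form z q Y) has_derivative (\<lambda>u. DK u (Y 0))) (at a)" for Y
    unfolding conn_form_def sum_Zvec DK_def using Dz[OF a]
    by (auto intro!: derivative_eq_intros simp: mv_linear_simps)
  have DL: "((\<lambda>q. total_shape F \<phi> v z q Y) has_derivative (\<lambda>u. DL u (Y 0) (Y 1))) (at a)" for Y
    unfolding DL_def A_def by (rule total_shape_has_derivative[OF a])
  have DL': "DL u x y = - DL u y x" for u x y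
    by (simp add: DL_def)
  note br = fn_bracket_1_2[where K = "conn_form z" and L = "total_shape F \<phi> v z" and k = k
      and DK = DK and l = "Lform a" and DL = DL,
      OF K k DK total_shape_eq[OF a] linear_Lform Lform_skew DL DL']
  have o: "obv a (0, b) = b" for b by (simp add: obv_def mv_linear_simps)
  have l: "Lform a x y = (0, A (obv a y) *v fst x - A (obv a x) *v fst y)" for x y
    by (simp add: Lform_def A_def)
  have Dz0: "Dz a (0, b) = A b + h b" for b
    by (simp add: Dz' o f_def fop_linear_simps)
  have Dzk: "Dz a (k w) = f (fst w)" for w
    unfolding k_def f_def by (rule Dz_horizontal[OF a])
  have DAk: "hop (DA a (k w)) = D (fst w)" for w
    by (simp add: k_def D_def)
  have k0: "k (0, b) = 0" and ok: "obv a (k w) = 0" and fk: "fst (k w) = fst w" for b w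
    by (simp_all add: k_def obv_def mv_linear_simps zero_prod_def)
  have zero: "f 0 = 0" "A 0 = 0" "h 0 = 0"
    by (simp_all add: f_def A_def h_def fop_linear_simps hop_linear_simps)
  define J where "J = Jac (a, z a)"
  \<comment> \<open>The derivative of \<open>F\<close> in \<open>Jac\<close> drops out of the part
    skew in \<open>x\<close> and \<open>y\<close>, which is the part that the bracket can be
    compared with. The equation is solved for one of the two terms, to be applied to three triples
    of arguments.\<close>
  have J: "J x b *v y = J y b *v x + D y b *v x - D x b *v y
     - (A (A b *v x) + A (h b *v x) + h (A b *v x)) *v y + (A (A b *v y) + A (h b *v y) + h (A b *v y)) *v x" for x y b
    using hop_DA_skew[OF a, of x b y] DF_symmetric[OF graph[OF a], of "H_lift (a, z a) b" x y]
    by (simp add: J_def Jac_def B D_def A h mv_linear_simps h_def[symmetric]) (simp add: algebra_simps)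
  define x0 x1 x2 w0 w1 w2 where "x0 = fst (X 0)" and "x1 = fst (X 1)" and "x2 = fst (X 2)"
    and "w0 = obv a (X 0)" and "w1 = obv a (X 1)" and "w2 = obv a (X 2)"
  note xw = x0_def[symmetric] x1_def[symmetric] x2_def[symmetric]
    w0_def[symmetric] w1_def[symmetric] w2_def[symmetric]
  \<comment> \<open>Such terms come from the derivative of \<open>obv\<close> inside
    \<open>DL\<close> and from the skew part of \<open>DK\<close>; by symmetry they cancel in
    pairs.\<close>
  have fs: "f x1 *v x0 = f x0 *v x1" "f x2 *v x0 = f x0 *v x2" "f x2 *v x1 = f x1 *v x2"
    by (rule f)+
  show ?thesis
    unfolding br A2_eq[OF a] Z_wedge_jacobi_eq[OF a] J_def[symmetric] A_def[symmetric]
    by (simp add: l DL_def DK_def Dz0 Dzk DAk Dz' o k0 ok fk zero xw fs A h mv_linear_simps del: One_nat_def)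
       (simp add: J[of x0 w2 x1] J[of x1 w0 x2] J[of x2 w1 x0] mv_linear_simps algebra_simps)
qed

section \<open>Component formulas\<close>

lemma wedge_dx_omega_bar:
  "wedge 1 1 (dx i) (omega_bar z \<nu>) a X = fst (X 0) $ i * obv a (X 1) $ \<nu> - fst (X 1) $ i * obv a (X 0) $ \<nu>"
  by (rule wedge_1_1[where b = "\<lambda>w. obv a w $ \<nu>"])
    (simp_all add: dx_def omega_bar_def obv_def matrix_vector_mult_def)

lemma wedge_dx_dx_omega_bar:
  "wedge 2 1 (wedge 1 1 (dx i) (dx k)) (omega_bar z \<rho>) a X =
    (fst (X 0) $ i * fst (X 1) $ k - fst (X 1) $ i * fst (X 0) $ k) * obv a (X 2) $ \<rho>
    + (fst (X 1) $ i * fst (X 2) $ k - fst (X 2) $ i * fst (X 1) $ k) * obv a (X 0) $ \<rho>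
    + (fst (X 2) $ i * fst (X 0) $ k - fst (X 0) $ i * fst (X 2) $ k) * obv a (X 1) $ \<rho>"
proof (rule wedge_2_1[where a = "\<lambda>x y. fst x $ i * fst y $ k - fst y $ i * fst x $ k"
      and b = "\<lambda>w. obv a w $ \<rho>"])
  show "wedge 1 1 (dx i) (dx k) a Y = fst (Y 0) $ i * fst (Y 1) $ k - fst (Y 1) $ i * fst (Y 0) $ k" for Y
    by (rule wedge_1_1) (simp_all add: dx_def)
  show "omega_bar z \<rho> a Y = obv a (Y 0) $ \<rho>" for Y
    by (simp add: omega_bar_def obv_def matrix_vector_mult_def)
qed simp

lemma sum_scaleR_dy_vec: "(\<Sum>\<sigma>\<in>UNIV. c \<sigma> *\<^sub>R dy_vec \<sigma>) = (0, \<chi> \<sigma>. c \<sigma>)"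
  by (simp add: dy_vec_def prod_eq_iff fst_sum snd_sum vec_eq_iff axis_def if_distrib cong: if_cong)

lemma hop_mv_nth: "(hop h b *v x) $ \<sigma> = (\<Sum>\<nu>\<in>UNIV. \<Sum>i\<in>UNIV. h $ \<sigma> $ \<nu> $ i * (x $ i * b $ \<nu>))"
proof -
  have "(hop h b *v x) $ \<sigma> = (\<Sum>i\<in>UNIV. \<Sum>\<nu>\<in>UNIV. h $ \<sigma> $ \<nu> $ i * (x $ i * b $ \<nu>))"
    by (simp add: hop_def matrix_vector_mult_def sum_distrib_left mult_ac)
  then show ?thesis by (subst sum.swap)
qed

lemma total_shape_components:
  assumes a: "a \<in> U"
  shows "total_shape F \<phi> v z a X = (\<Sum>\<sigma>\<in>UNIV. \<Sum>\<nu>\<in>UNIV. \<Sum>i\<in>UNIV.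
    (A_coeff F \<phi> v z \<sigma> \<nu> i a * wedge 1 1 (dx i) (omega_bar z \<nu>) a X) *\<^sub>R dy_vec \<sigma>)"
  unfolding total_shape_eq[OF a] Lform_def scaleR_sum_left[symmetric] sum_scaleR_dy_vec
    wedge_dx_omega_bar
  by (simp add: vec_eq_iff hop_mv_nth A_coeff_eq[OF a] right_diff_distrib
      sum_subtractf)

text \<open>The sums are reordered so that the contracted index \<sigma> is innermost, as in the
  coefficients of A^2.\<close>

lemma hop_hop_mv_nth:
  "(hop h (hop h b *v y) *v x) $ \<nu> =
    (\<Sum>\<rho>\<in>UNIV. \<Sum>i\<in>UNIV. \<Sum>k\<in>UNIV. (\<Sum>\<sigma>\<in>UNIV. h $ \<sigma> $ \<rho> $ k * h $ \<nu> $ \<sigma> $ i) * (x $ i * y $ k * b $ \<rho>))"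
proof -
  have "(hop h (hop h b *v y) *v x) $ \<nu> = (\<Sum>\<sigma>\<in>UNIV. \<Sum>i\<in>UNIV. \<Sum>\<rho>\<in>UNIV. \<Sum>k\<in>UNIV.
      h $ \<sigma> $ \<rho> $ k * h $ \<nu> $ \<sigma> $ i * (x $ i * y $ k * b $ \<rho>))"
    unfolding hop_mv_nth by (simp add: hop_mv_nth sum_distrib_left mult_ac)
  also have "\<dots> = (\<Sum>i\<in>UNIV. \<Sum>\<rho>\<in>UNIV. \<Sum>\<sigma>\<in>UNIV. \<Sum>k\<in>UNIV.
      h $ \<sigma> $ \<rho> $ k * h $ \<nu> $ \<sigma> $ i * (x $ i * y $ k * b $ \<rho>))"
    by (subst sum.swap) (intro sum.cong refl sum.swap)
  also have "\<dots> = (\<Sum>\<rho>\<in>UNIV. \<Sum>i\<in>UNIV. \<Sum>k\<in>UNIV. \<Sum>\<sigma>\<in>UNIV.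
      h $ \<sigma> $ \<rho> $ k * h $ \<nu> $ \<sigma> $ i * (x $ i * y $ k * b $ \<rho>))"
    by (subst sum.swap) (intro sum.cong refl sum.swap)
  finally show ?thesis by (simp only: sum_distrib_right)
qed

text \<open>The 3-form \<open>dx\<^sup>i \<and> dx\<^sup>k \<and> \<omega>\<^sup>\<rho>\<close>
  changes sign when \<open>i\<close> and \<open>k\<close> are exchanged, and so does its
  coefficient. Each of the six terms obtained from \<open>A2_eq\<close> therefore arises twice,
  which accounts for the factor \<open>1/2\<close>.\<close>

lemma A2_components:
  assumes a: "a \<in> U"
  shows "(1/4) *\<^sub>R nr_bracket 2 2 (total_shape F \<phi> v z) (total_shape F \<phi> v z) a X =
    (\<Sum>\<rho>\<in>UNIV. \<Sum>\<nu>\<in>UNIV. \<Sum>i\<in>UNIV. \<Sum>k\<in>UNIV.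
      ((1/2) * (\<Sum>\<sigma>\<in>UNIV. A_coeff F \<phi> v z \<sigma> \<rho> k a * A_coeff F \<phi> v z \<nu> \<sigma> i a
          - A_coeff F \<phi> v z \<sigma> \<rho> i a * A_coeff F \<phi> v z \<nu> \<sigma> k a)
        * wedge 2 1 (wedge 1 1 (dx i) (dx k)) (omega_bar z \<rho>) a X) *\<^sub>R dy_vec \<nu>)"
proof -
  define A where "A = Amat a"
  define q where "q \<nu> \<rho> i k = (\<Sum>\<sigma>\<in>UNIV. A $ \<sigma> $ \<rho> $ k * A $ \<nu> $ \<sigma> $ i)" for \<nu> \<rho> i k
  define Q where "Q \<nu> x y b = (\<Sum>\<rho>\<in>UNIV. \<Sum>i\<in>UNIV. \<Sum>k\<in>UNIV. q \<nu> \<rho> i k * (x $ i * y $ k * b $ \<rho>))"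
    for \<nu> and x y :: "real^'n" and b :: "real^'m"
  have Q: "(hop A (hop A b *v y) *v x) $ \<nu> = Q \<nu> x y b" for b x y \<nu>
    unfolding Q_def q_def by (rule hop_hop_mv_nth)
  \<comment> \<open>Renaming the summation indices moves the exchange of \<open>i\<close> and
    \<open>k\<close> from the coefficient to the two base vectors.\<close>
  have Q': "(\<Sum>\<rho>\<in>UNIV. \<Sum>i\<in>UNIV. \<Sum>k\<in>UNIV. q \<nu> \<rho> k i * (x $ i * y $ k * b $ \<rho>)) = Q \<nu> y x b" for \<nu> x y b
    unfolding Q_def by (rule sum.cong[OF refl], subst sum.swap) (simp add: mult_ac)
  define x0 x1 x2 w0 w1 w2 where "x0 = fst (X 0)" and "x1 = fst (X 1)" and "x2 = fst (X 2)"
    and "w0 = obv a (X 0)" and "w1 = obv a (X 1)" and "w2 = obv a (X 2)"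
  note xw = x0_def[symmetric] x1_def[symmetric] x2_def[symmetric]
    w0_def[symmetric] w1_def[symmetric] w2_def[symmetric]
  define W where "W i k \<rho> = (x0 $ i * x1 $ k - x1 $ i * x0 $ k) * w2 $ \<rho>
    + (x1 $ i * x2 $ k - x2 $ i * x1 $ k) * w0 $ \<rho> + (x2 $ i * x0 $ k - x0 $ i * x2 $ k) * w1 $ \<rho>" for i k \<rho>
  have c: "(\<Sum>\<rho>\<in>UNIV. \<Sum>i\<in>UNIV. \<Sum>k\<in>UNIV. (1/2) * (q \<nu> \<rho> i k - q \<nu> \<rho> k i) * W i k \<rho>) =
      Q \<nu> x0 x1 w2 - Q \<nu> x1 x0 w2 + Q \<nu> x1 x2 w0 - Q \<nu> x2 x1 w0 + Q \<nu> x2 x0 w1 - Q \<nu> x0 x2 w1" for \<nu>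
  proof -
    have "2 * ((1/2) * (q \<nu> \<rho> i k - q \<nu> \<rho> k i) * W i k \<rho>) =
      q \<nu> \<rho> i k * (x0 $ i * x1 $ k * w2 $ \<rho>) - q \<nu> \<rho> i k * (x1 $ i * x0 $ k * w2 $ \<rho>)
      + q \<nu> \<rho> i k * (x1 $ i * x2 $ k * w0 $ \<rho>) - q \<nu> \<rho> i k * (x2 $ i * x1 $ k * w0 $ \<rho>)
      + q \<nu> \<rho> i k * (x2 $ i * x0 $ k * w1 $ \<rho>) - q \<nu> \<rho> i k * (x0 $ i * x2 $ k * w1 $ \<rho>)
      - q \<nu> \<rho> k i * (x0 $ i * x1 $ k * w2 $ \<rho>) + q \<nu> \<rho> k i * (x1 $ i * x0 $ k * w2 $ \<rho>)
      - q \<nu> \<rho> k i * (x1 $ i * x2 $ k * w0 $ \<rho>) + q \<nu> \<rho> k i * (x2 $ i * x1 $ k * w0 $ \<rho>)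
      - q \<nu> \<rho> k i * (x2 $ i * x0 $ k * w1 $ \<rho>) + q \<nu> \<rho> k i * (x0 $ i * x2 $ k * w1 $ \<rho>)" for \<rho> i k
      by (simp add: W_def algebra_simps)
    then have "2 * (\<Sum>\<rho>\<in>UNIV. \<Sum>i\<in>UNIV. \<Sum>k\<in>UNIV. (1/2) * (q \<nu> \<rho> i k - q \<nu> \<rho> k i) * W i k \<rho>) =
      2 * (Q \<nu> x0 x1 w2 - Q \<nu> x1 x0 w2 + Q \<nu> x1 x2 w0 - Q \<nu> x2 x1 w0 + Q \<nu> x2 x0 w1 - Q \<nu> x0 x2 w1)"
      by (simp only: sum_distrib_left sum.distrib sum_subtractf Q_def[symmetric] Q') simp
    then show ?thesis by simp
  qed
  have r: "(\<Sum>\<rho>\<in>UNIV. \<Sum>\<nu>\<in>UNIV. \<Sum>i\<in>UNIV. \<Sum>k\<in>UNIV. c \<rho> \<nu> i k *\<^sub>R dy_vec \<nu>) =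
      (0, \<chi> \<nu>. \<Sum>\<rho>\<in>UNIV. \<Sum>i\<in>UNIV. \<Sum>k\<in>UNIV. c \<rho> \<nu> i k)" for c :: "'m \<Rightarrow> 'm \<Rightarrow> 'n \<Rightarrow> 'n \<Rightarrow> real"
    by (subst sum.swap) (simp only: scaleR_sum_left[symmetric] sum_scaleR_dy_vec)
  show ?thesis
    unfolding A2_eq[OF a] wedge_dx_dx_omega_bar A_coeff_eq[OF a] A_def[symmetric] sum_subtractf
      q_def[symmetric] xw W_def[symmetric] r c
    by (simp add: Lform_def A_def[symmetric] xw vec_eq_iff hop_linear_simps mv_linear_simps Q
        del: One_nat_def)
qed

end

theorem theorem3p4p4:
  fixes M :: "('x::{t2_space, second_countable_topology}, 'y::{t2_space, second_countable_topology},
               'n::finite, 'm::finite) fibring"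
    and \<Gamma> :: "('x, 'y) jet \<Rightarrow> ('x, 'y) jet"
    and \<phi> v :: "('x, real^'n) chart \<Rightarrow> real^'n \<Rightarrow> real^'n"
    and V :: "'y set"
    and Z :: "'y \<Rightarrow> ('x, 'y) jet"
  assumes "CARD('n) > 1"
    and "fibred_manifold M"
    and "second_order_connection M \<Gamma>"
    and "one_form (base_atlas M) \<phi>"
    and "closed_one_form (base_atlas M) \<phi>"
    and "\<forall>b\<in>base_atlas M. \<forall>x\<in>fst b. \<phi> b (snd b x) \<noteq> 0"
    and "vector_field (base_atlas M) v"
    and "\<forall>b\<in>base_atlas M. \<forall>x\<in>fst b. v b (snd b x) \<bullet> \<phi> b (snd b x) = 1"
    and "local_connection M V Z"
    and "embedded M \<Gamma> V Z"
  shows "\<forall>c b. fibred_chart M c b \<longrightarrow>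
    (let F = conn_coeff M \<Gamma> c b;
         z = section_coeff Z c b;
         Ahat = total_shape F (\<phi> b) (v b) z;
         A = A_coeff F (\<phi> b) (v b) z;
         A2 = (\<lambda>a X. (1/4) *\<^sub>R nr_bracket 2 2 Ahat Ahat a X)
     in \<forall>a\<in>snd c ` (V \<inter> fst c). \<forall>X.
          Ahat a X =
            (\<Sum>\<sigma>\<in>UNIV. \<Sum>\<nu>\<in>UNIV. \<Sum>i\<in>UNIV.
               (A \<sigma> \<nu> i a * wedge 1 1 (dx i) (omega_bar z \<nu>) a X) *\<^sub>R dy_vec \<sigma>) \<and>
          fn_bracket 1 2 (conn_form z) Ahat a X =
            - A2 a X - Z_wedge 2 z (jacobi_endo F (\<phi> b) (v b)) a X \<and>
          A2 a X =
            (\<Sum>\<rho>\<in>UNIV. \<Sum>\<nu>\<in>UNIV. \<Sum>i\<in>UNIV. \<Sum>k\<in>UNIV.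
               ((1/2) * (\<Sum>\<sigma>\<in>UNIV. A \<sigma> \<rho> k a * A \<nu> \<sigma> i a - A \<sigma> \<rho> i a * A \<nu> \<sigma> k a)
                * wedge 2 1 (wedge 1 1 (dx i) (dx k)) (omega_bar z \<rho>) a X) *\<^sub>R dy_vec \<nu>))"
proof (intro allI impI)
  fix c :: "('y, ('n, 'm) ycoord) chart" and b :: "('x, real^'n) chart"
  assume cb: "fibred_chart M c b"
  \<comment> \<open>The derivative coordinates range over everything, since each value is realised
    by a section; the symmetry of the components thereby holds on an open set.\<close>
  define S :: "('n, 'm) jcoord set" where "S = (snd c ` fst c) \<times> UNIV"
  define U where "U = snd c ` (V \<inter> fst c)"
  have ic: "is_chart c" "is_chart b" using fibred_chart_is_chart[OF assms(2) cb] by auto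
  have b: "b \<in> base_atlas M" using cb by (simp add: fibred_chart_def)
  interpret embedded_connection S "snd b ` fst b" "conn_coeff M \<Gamma> c b" "\<phi> b" "v b" U "section_coeff Z c b"
  proof unfold_locales
    show "open S" unfolding S_def by (intro open_Times chart_open_range ic open_UNIV)
    show "smooth_on S (conn_coeff M \<Gamma> c b)"
      using assms(3) cb unfolding second_order_connection_def S_def by blast
    show "conn_coeff M \<Gamma> c b p $ \<sigma> $ i $ k = conn_coeff M \<Gamma> c b p $ \<sigma> $ k $ i" if "p \<in> S" for p \<sigma> i k
      by (rule conn_coeff_symmetric[OF assms(2) cb assms(3) that[unfolded S_def]])
    show "open (snd b ` fst b)" by (rule chart_open_range[OF ic(2)])
    show "smooth_on (snd b ` fst b) (\<phi> b)" using assms(4) b by (simp add: one_form_def)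
    show "smooth_on (snd b ` fst b) (v b)" using assms(7) b by (simp add: vector_field_def)
    show "v b x \<bullet> \<phi> b x = 1" if "x \<in> snd b ` fst b" for x using assms(8) b that by auto
    show "fst (fst p) \<in> snd b ` fst b" if "p \<in> S" for p
      using fibred_chart_base_mem[OF cb, of "fst p"] that by (auto simp: S_def)
    have "open V" using assms(9) by (simp add: local_connection_def)
    then show "open U" unfolding U_def by (rule open_chart_image[OF ic(1)])
    show "smooth_on U (section_coeff Z c b)"
      using assms(9) cb unfolding local_connection_def U_def by blast
    show "(a, section_coeff Z c b a) \<in> S" if "a \<in> U" for a using that by (auto simp: S_def U_def)
    show "tangent_Z (section_coeff Z c b) a ` dist_Z (section_coeff Z c b) a
        \<subseteq> dist_Gam (conn_coeff M \<Gamma> c b) (a, section_coeff Z c b a)" if "a \<in> U" for a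
      using assms(10) cb that unfolding embedded_def U_def Let_def by blast
  qed
  show "let F = conn_coeff M \<Gamma> c b;
         z = section_coeff Z c b;
         Ahat = total_shape F (\<phi> b) (v b) z;
         A = A_coeff F (\<phi> b) (v b) z;
         A2 = (\<lambda>a X. (1/4) *\<^sub>R nr_bracket 2 2 Ahat Ahat a X)
     in \<forall>a\<in>snd c ` (V \<inter> fst c). \<forall>X.
          Ahat a X =
            (\<Sum>\<sigma>\<in>UNIV. \<Sum>\<nu>\<in>UNIV. \<Sum>i\<in>UNIV.
               (A \<sigma> \<nu> i a * wedge 1 1 (dx i) (omega_bar z \<nu>) a X) *\<^sub>R dy_vec \<sigma>) \<and>
          fn_bracket 1 2 (conn_form z) Ahat a X =
            - A2 a X - Z_wedge 2 z (jacobi_endo F (\<phi> b) (v b)) a X \<and>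
          A2 a X =
            (\<Sum>\<rho>\<in>UNIV. \<Sum>\<nu>\<in>UNIV. \<Sum>i\<in>UNIV. \<Sum>k\<in>UNIV.
               ((1/2) * (\<Sum>\<sigma>\<in>UNIV. A \<sigma> \<rho> k a * A \<nu> \<sigma> i a - A \<sigma> \<rho> i a * A \<nu> \<sigma> k a)
                * wedge 2 1 (wedge 1 1 (dx i) (dx k)) (omega_bar z \<rho>) a X) *\<^sub>R dy_vec \<nu>)"
    unfolding Let_def U_def[symmetric]
    by (intro ballI allI conjI total_shape_components fn_bracket_total_shape_eq A2_components)
qed

end
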